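(* Let $(M,g)$ be a complete finite-dimensional Riemannian manifold, let $E\subseteq M$ be star-shaped at $p_0\in E$, let $f:E\to\mathbb{I}$, $f(p)=\langle f^c(p),f^w(p)\rangle$, be an interval-valued function and $g_1,\dots,g_m:E\to\mathbb{R}$. Consider the problem of minimizing $f(p)$ (with respect to $\leq^{\min}$) subject to $g_i(p)\le0$, $i\in\{1,\dots,m\}$, with feasible set $X=\{p\in E:g_i(p)\le 0,\ 1\le i\le m\}$. Let $p_0\in X$ and $J=\{i:g_i(p_0)=0\}$. Suppose that $f$ is cw-convex at $p_0$ and that the constraints $g_i$, $i\in J$, are convex at $p_0$. Suppose that for every geodesic $\gamma:I\to M$, $I$ an interval with $0\in I$, $\gamma(I)\subseteq E$ and $\gamma(0)=p_0$, the function $f^w\circ\gamma$ is non-decreasing on $I\cap[0,\infty)$. Suppose that $f$ is gH-directionally differentiable at $p_0$ and that $g_i$, $i\in\{1,\dots,m\}$, are directionally differentiable at $p_0$. Suppose there exist real scalars $\mu_i\ge0$, $i\in\{1,\dots,m\}$, such that (i) $0\leq^{\min} Df(p_0;X_{p_0})+\sum_{i=1}^m\mu_i\,Dg_i(p_0;X_{p_0})$ for all $X_{p_0}\in T_{p_0}(E)$; (ii) $\mu_i g_i(p_0)=0$ for all $i\in\{1,\dots,m\}$. Then $p_0$ is an optimal solution of the problem. Moreover, if $f$ is non-constant on $X$ (in the sense defined in the context), then $p_0$ is a strict optimal solution of the problem.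
   Context: Intervals: $\mathbb{I}$ is the set of closed bounded intervals of $\mathbb{R}$. $T=[t^l,t^u]\in\mathbb{I}$ is written $T=\langle t^c,t^w\rangle$ with center $t^c=\frac{t^l+t^u}{2}$ and half-width $t^w=\frac{t^u-t^l}{2}\ge 0$. A real $s$ is identified with $\langle s,0\rangle$. Sums and real multiples of intervals are taken elementwise, so $s_1T_1+s_2T_2=\langle s_1t_1^c+s_2t_2^c,\ |s_1|t_1^w+|s_2|t_2^w\rangle$. The total order $\leq^{\min}$: $T_1\leq^{\min}T_2$ iff $t_1^c<t_2^c$, or $t_1^c=t_2^c$ and $t_1^w\le t_2^w$; $T_1<^{\min}T_2$ iff $T_1\leq^{\min}T_2$ and $T_1\ne T_2$. The gH-difference is $T_1\ominus_{gH}T_2=\langle t_1^c-t_2^c,\ |t_1^w-t_2^w|\rangle$. Limits in $\mathbb{I}$ are with respect to the Hausdorff distance $d_H(T_1,T_2)=\max\{|t_1^l-t_2^l|,|t_1^u-t_2^u|\}$. An interval-valued function $f:E\to\mathbb{I}$ is written $f=\langle f^c,f^w\rangle$ with $f^c,f^w:E\to\mathbb{R}$, $f^w\ge0$. Star-shaped: $E\subseteq M$ is star-shaped at $p_0\in E$ if for every $p\in E$ and every geodesic $\gamma:[0,1]\to M$ with $\gamma(0)=p_0$, $\gamma(1)=p$, one has $\gamma(s)\in E$ for all $s\in(0,1)$. Convexity at a point: for $E$ star-shaped at $p_0$, $h:E\to\mathbb{R}$ is convex at $p_0$ if $h(\gamma(s))\le(1-s)h(p_0)+s\,h(p)$ for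 all $p\in E$, every geodesic $\gamma:[0,1]\to M$ with $\gamma(0)=p_0$, $\gamma(1)=p$, and all $s\in(0,1)$. $f=\langle f^c,f^w\rangle$ is cw-convex at $p_0$ if both $f^c$ and $f^w$ are convex at $p_0$. Tangent directions and derivatives: $T_{p_0}(E)$ denotes the set of vectors $X_{p_0}\in T_{p_0}M$ for which there is a geodesic $\gamma:I\to M$, $I\subseteq\mathbb{R}$ an interval containing $[0,\varepsilon)$ for some $\varepsilon>0$, with $\gamma(I)\subseteq E$, $\gamma(0)=p_0$, $\dot\gamma(0)=X_{p_0}$. For such $X_{p_0}$, $\gamma$: for real-valued $h$, $Dh(p_0;X_{p_0})=\lim_{s\to0^+}\frac{h(\gamma(s))-h(p_0)}{s}$; for interval-valued $f$, the gH-directional derivative is $Df(p_0;X_{p_0})=\lim_{s\to0^+}\frac1s\big(f(\gamma(s))\ominus_{gH}f(p_0)\big)$. The function is (gH-)directionally differentiable at $p_0$ if this limit exists for every $X_{p_0}\in T_{p_0}(E)$. Non-constant (paper's definition): $f$ is non-constant on $X$ if $f(p)\neq f(q)$ for all $p,q\in X$ with $p\ne q$. Optimal solution: $p_0\in X$ is an optimal solution if there is no $p\in X$ with $f(p)<^{\min}f(p_0)$; it is a strict optimal solution if there is no $p\in X$, $p\ne p_0$, with $f(p)\leq^{\min}f(p_0)$.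
   Formalization: The manifold M is additionally assumed connected (the usual convention for complete Riemannian manifolds); without this the claim fails, since a feasible point in another component is joined to p_0 by no geodesic and is not constrained by the hypotheses. *)

theory Defs
  imports "HOL-Analysis.Analysis" "HOL-Library.Interval"
begin

section \<open>Intervals\<close>

definition center :: "real interval \<Rightarrow> real" where
  "center T = (lower T + upper T) / 2"

definition half_width :: "real interval \<Rightarrow> real" where
  "half_width T = (upper T - lower T) / 2"

text \<open>The interval with center \<open>c\<close> and half-width \<open>w\<close>; only meaningful for \<open>w \<ge> 0\<close>.\<close>

definition cw_interval :: "real \<Rightarrow> real \<Rightarrow> real interval" where
  "cw_interval c w = Ivl (c - w) (c + w)"

definition le_min :: "real interval \<Rightarrow> real interval \<Rightarrow> bool"  (infix "\<le>min" 50) where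
  "S \<le>min T \<longleftrightarrow>
     center S < center T \<or> center S = center T \<and> half_width S \<le> half_width T"

definition less_min :: "real interval \<Rightarrow> real interval \<Rightarrow> bool"  (infix "<min" 50) where
  "S <min T \<longleftrightarrow> S \<le>min T \<and> S \<noteq> T"

definition gH_diff :: "real interval \<Rightarrow> real interval \<Rightarrow> real interval"  (infixl "\<ominus>gH" 65) where
  "S \<ominus>gH T = cw_interval (center S - center T) \<bar>half_width S - half_width T\<bar>"

definition interval_dist :: "real interval \<Rightarrow> real interval \<Rightarrow> real" where
  "interval_dist S T = max \<bar>lower S - lower T\<bar> \<bar>upper S - upper T\<bar>"


section \<open>Smooth functions between normed spaces\<close>

text \<open>Both notions are meant for open sets; over finite-dimensional domains the derivatives in all
  fixed directions determine the order of differentiability.\<close>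

primrec Ck_on :: "nat \<Rightarrow> 'a::real_normed_vector set \<Rightarrow> ('a \<Rightarrow> 'b::real_normed_vector) \<Rightarrow> bool" where
  "Ck_on 0 S f \<longleftrightarrow> continuous_on S f"
| "Ck_on (Suc k) S f \<longleftrightarrow>
     (\<forall>x\<in>S. f differentiable (at x)) \<and>
     (\<forall>v. Ck_on k S (\<lambda>x. frechet_derivative f (at x) v))"

definition smooth_on :: "'a::real_normed_vector set \<Rightarrow> ('a \<Rightarrow> 'b::real_normed_vector) \<Rightarrow> bool" where
  "smooth_on S f \<longleftrightarrow> (\<forall>k. Ck_on k S f)"


section \<open>Riemannian manifolds\<close>

text \<open>A chart is a domain together with a coordinate map, whose values outside the domain are
  irrelevant. The manifold is the whole type \<open>'a\<close>, the model space is \<open>'e\<close>.\<close>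

type_synonym ('a, 'e) chart = "'a set \<times> ('a \<Rightarrow> 'e)"

definition transition :: "('a, 'e) chart \<Rightarrow> ('a, 'e) chart \<Rightarrow> 'e \<Rightarrow> 'e" where
  "transition \<kappa> \<kappa>' = snd \<kappa>' \<circ> inv_into (fst \<kappa>) (snd \<kappa>)"

locale smooth_manifold =
  fixes A :: "('a::{t2_space, second_countable_topology}, 'e::euclidean_space) chart set"
  assumes chart: "\<And>U \<phi>. (U, \<phi>) \<in> A \<Longrightarrow>
      open U \<and> open (\<phi> ` U) \<and> homeomorphism U (\<phi> ` U) \<phi> (inv_into U \<phi>)"
    and cover: "(\<Union>\<kappa>\<in>A. fst \<kappa>) = UNIV"
    and compatible: "\<And>\<kappa> \<kappa>'. \<kappa> \<in> A \<Longrightarrow> \<kappa>' \<in> A \<Longrightarrow>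
      smooth_on (snd \<kappa> ` (fst \<kappa> \<inter> fst \<kappa>')) (transition \<kappa> \<kappa>')"

definition charts_at :: "('a, 'e) chart set \<Rightarrow> 'a \<Rightarrow> ('a, 'e) chart set" where
  "charts_at A p = {\<kappa> \<in> A. p \<in> fst \<kappa>}"

text \<open>A tangent vector at \<open>p\<close> is the family of its coordinate vectors in the charts around \<open>p\<close>,
  which are related by the derivatives of the transition maps. The value is \<open>0\<close> at all other
  charts, so that equality of tangent vectors is equality of functions.\<close>

type_synonym ('a, 'e) tangent = "('a, 'e) chart \<Rightarrow> 'e"

definition tangent_space ::
  "('a, 'e::euclidean_space) chart set \<Rightarrow> 'a \<Rightarrow> ('a, 'e) tangent set" where
  "tangent_space A p = {X.
     (\<forall>\<kappa>\<in>charts_at A p. \<forall>\<kappa>'\<in>charts_at A p.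
        X \<kappa>' = frechet_derivative (transition \<kappa> \<kappa>') (at (snd \<kappa> p)) (X \<kappa>)) \<and>
     (\<forall>\<kappa>. \<kappa> \<notin> charts_at A p \<longrightarrow> X \<kappa> = 0)}"

text \<open>The tangent vector at \<open>p\<close> with coordinate vector \<open>u\<close> in the chart \<open>\<kappa>\<close>.\<close>

definition coord_vector ::
  "('a, 'e::euclidean_space) chart set \<Rightarrow> ('a, 'e) chart \<Rightarrow> 'a \<Rightarrow> 'e \<Rightarrow> ('a, 'e) tangent" where
  "coord_vector A \<kappa> p u = (\<lambda>\<kappa>'. if \<kappa>' \<in> charts_at A p
     then frechet_derivative (transition \<kappa> \<kappa>') (at (snd \<kappa> p)) u else 0)"

text \<open>The local expression of the metric \<open>G\<close> at the point with coordinates \<open>x\<close>.\<close>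

definition metric_coeff ::
  "('a, 'e::euclidean_space) chart set \<Rightarrow> ('a \<Rightarrow> ('a, 'e) tangent \<Rightarrow> ('a, 'e) tangent \<Rightarrow> real) \<Rightarrow>
   ('a, 'e) chart \<Rightarrow> 'e \<Rightarrow> 'e \<Rightarrow> 'e \<Rightarrow> real" where
  "metric_coeff A G \<kappa> x u v = (let p = inv_into (fst \<kappa>) (snd \<kappa>) x in
     G p (coord_vector A \<kappa> p u) (coord_vector A \<kappa> p v))"

locale riemannian_manifold = smooth_manifold A
  for A :: "('a::{t2_space, second_countable_topology}, 'e::euclidean_space) chart set" +
  fixes G :: "'a \<Rightarrow> ('a, 'e) tangent \<Rightarrow> ('a, 'e) tangent \<Rightarrow> real"
  assumes metric_sym: "\<And>p X Y. X \<in> tangent_space A p \<Longrightarrow> Y \<in> tangent_space A p \<Longrightarrow>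
      G p X Y = G p Y X"
    and metric_add: "\<And>p X Y Z. X \<in> tangent_space A p \<Longrightarrow> Y \<in> tangent_space A p \<Longrightarrow>
      Z \<in> tangent_space A p \<Longrightarrow> G p (\<lambda>\<kappa>. X \<kappa> + Y \<kappa>) Z = G p X Z + G p Y Z"
    and metric_scale: "\<And>p X Y r. X \<in> tangent_space A p \<Longrightarrow> Y \<in> tangent_space A p \<Longrightarrow>
      G p (\<lambda>\<kappa>. r *\<^sub>R X \<kappa>) Y = r * G p X Y"
    and metric_pos: "\<And>p X. X \<in> tangent_space A p \<Longrightarrow> X \<noteq> (\<lambda>\<kappa>. 0) \<Longrightarrow> 0 < G p X X"
    and metric_smooth: "\<And>\<kappa> u v. \<kappa> \<in> A \<Longrightarrow>
      smooth_on (snd \<kappa> ` fst \<kappa>) (\<lambda>x. metric_coeff A G \<kappa> x u v)"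

text \<open>One-sided at the endpoints of \<open>I\<close> that belong to \<open>I\<close>.\<close>

definition velocity ::
  "('a, 'e::euclidean_space) chart set \<Rightarrow> (real \<Rightarrow> 'a) \<Rightarrow> real set \<Rightarrow> real \<Rightarrow> ('a, 'e) tangent" where
  "velocity A \<gamma> I t = (\<lambda>\<kappa>. if \<kappa> \<in> charts_at A (\<gamma> t)
     then vector_derivative (snd \<kappa> \<circ> \<gamma>) (at t within I) else 0)"


subsection \<open>Riemannian distance and completeness\<close>

definition C1_curve ::
  "('a::topological_space, 'e::euclidean_space) chart set \<Rightarrow> real set \<Rightarrow> (real \<Rightarrow> 'a) \<Rightarrow> bool" where
  "C1_curve A I \<gamma> \<longleftrightarrow> continuous_on I \<gamma> \<and>
     (\<forall>t\<in>I. \<forall>\<kappa>\<in>charts_at A (\<gamma> t).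
        (snd \<kappa> \<circ> \<gamma>) differentiable (at t within I) \<and>
        continuous (at t within I) (\<lambda>s. vector_derivative (snd \<kappa> \<circ> \<gamma>) (at s within I)))"

text \<open>\<open>S\<close> is the set of break points, including both ends.\<close>

definition piecewise_C1_curve ::
  "('a::topological_space, 'e::euclidean_space) chart set \<Rightarrow> (real \<Rightarrow> 'a) \<Rightarrow> bool" where
  "piecewise_C1_curve A \<gamma> \<longleftrightarrow> continuous_on {0..1} \<gamma> \<and>
     (\<exists>S. finite S \<and> {0, 1} \<subseteq> S \<and> S \<subseteq> {0..1} \<and>
        (\<forall>a\<in>S. \<forall>b\<in>S. a < b \<and> {a<..<b} \<inter> S = {} \<longrightarrow> C1_curve A {a..b} \<gamma>))"

definition curve_length ::
  "('a, 'e::euclidean_space) chart set \<Rightarrow> ('a \<Rightarrow> ('a, 'e) tangent \<Rightarrow> ('a, 'e) tangent \<Rightarrow> real) \<Rightarrow>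
   (real \<Rightarrow> 'a) \<Rightarrow> real" where
  "curve_length A G \<gamma> = integral {0..1}
     (\<lambda>t. sqrt (G (\<gamma> t) (velocity A \<gamma> {0..1} t) (velocity A \<gamma> {0..1} t)))"

text \<open>The set below is nonempty for all \<open>p\<close>, \<open>q\<close> exactly if the manifold is connected.\<close>

definition riemannian_dist ::
  "('a::topological_space, 'e::euclidean_space) chart set \<Rightarrow>
   ('a \<Rightarrow> ('a, 'e) tangent \<Rightarrow> ('a, 'e) tangent \<Rightarrow> real) \<Rightarrow> 'a \<Rightarrow> 'a \<Rightarrow> real" where
  "riemannian_dist A G p q =
     Inf {curve_length A G \<gamma> | \<gamma>. piecewise_C1_curve A \<gamma> \<and> \<gamma> 0 = p \<and> \<gamma> 1 = q}"

definition complete_metric ::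
  "('a::topological_space, 'e::euclidean_space) chart set \<Rightarrow>
   ('a \<Rightarrow> ('a, 'e) tangent \<Rightarrow> ('a, 'e) tangent \<Rightarrow> real) \<Rightarrow> bool" where
  "complete_metric A G \<longleftrightarrow> Metric_space.mcomplete UNIV (riemannian_dist A G)"


subsection \<open>Geodesics\<close>

text \<open>The Christoffel symbols of the Levi-Civita connection as a bilinear map: with \<open>u, v, w\<close>
  constant coordinate fields, \<open>\<langle>\<nabla>\<^sub>u v, w\<rangle>\<close> is given by the Koszul formula. The vector is unique
  because the metric is nondegenerate.\<close>

definition christoffel ::
  "('a, 'e::euclidean_space) chart set \<Rightarrow> ('a \<Rightarrow> ('a, 'e) tangent \<Rightarrow> ('a, 'e) tangent \<Rightarrow> real) \<Rightarrow>
   ('a, 'e) chart \<Rightarrow> 'e \<Rightarrow> 'e \<Rightarrow> 'e \<Rightarrow> 'e" where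
  "christoffel A G \<kappa> x u v = (THE z. \<forall>w.
     metric_coeff A G \<kappa> x z w =
       (frechet_derivative (\<lambda>y. metric_coeff A G \<kappa> y v w) (at x) u
      + frechet_derivative (\<lambda>y. metric_coeff A G \<kappa> y u w) (at x) v
      - frechet_derivative (\<lambda>y. metric_coeff A G \<kappa> y u v) (at x) w) / 2)"

text \<open>Vanishing covariant acceleration, written in charts. The domain is a nondegenerate interval,
  open or not, with one-sided derivatives at the endpoints; smoothness of \<open>\<gamma>\<close> follows from the
  equation.\<close>

definition geodesic ::
  "('a::topological_space, 'e::euclidean_space) chart set \<Rightarrow>
   ('a \<Rightarrow> ('a, 'e) tangent \<Rightarrow> ('a, 'e) tangent \<Rightarrow> real) \<Rightarrow> real set \<Rightarrow> (real \<Rightarrow> 'a) \<Rightarrow> bool" where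
  "geodesic A G I \<gamma> \<longleftrightarrow> is_interval I \<and> interior I \<noteq> {} \<and> continuous_on I \<gamma> \<and>
     (\<forall>t\<in>I. \<forall>\<kappa>\<in>charts_at A (\<gamma> t).
        let c = snd \<kappa> \<circ> \<gamma>; c' = (\<lambda>s. vector_derivative c (at s within I)) in
          c differentiable (at t within I) \<and>
          (c' has_vector_derivative - christoffel A G \<kappa> (c t) (c' t) (c' t)) (at t within I))"


section \<open>Star-shapedness and convexity at a point\<close>

definition star_shaped_at ::
  "('a::topological_space, 'e::euclidean_space) chart set \<Rightarrow>
   ('a \<Rightarrow> ('a, 'e) tangent \<Rightarrow> ('a, 'e) tangent \<Rightarrow> real) \<Rightarrow> 'a set \<Rightarrow> 'a \<Rightarrow> bool" where
  "star_shaped_at A G E p0 \<longleftrightarrow> p0 \<in> E \<and>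
     (\<forall>p\<in>E. \<forall>\<gamma>. geodesic A G {0..1} \<gamma> \<and> \<gamma> 0 = p0 \<and> \<gamma> 1 = p \<longrightarrow>
        (\<forall>s\<in>{0<..<1}. \<gamma> s \<in> E))"

definition convex_at ::
  "('a::topological_space, 'e::euclidean_space) chart set \<Rightarrow>
   ('a \<Rightarrow> ('a, 'e) tangent \<Rightarrow> ('a, 'e) tangent \<Rightarrow> real) \<Rightarrow> 'a set \<Rightarrow> ('a \<Rightarrow> real) \<Rightarrow> 'a \<Rightarrow> bool" where
  "convex_at A G E h p0 \<longleftrightarrow>
     (\<forall>p\<in>E. \<forall>\<gamma>. geodesic A G {0..1} \<gamma> \<and> \<gamma> 0 = p0 \<and> \<gamma> 1 = p \<longrightarrow>
        (\<forall>s\<in>{0<..<1}. h (\<gamma> s) \<le> (1 - s) * h p0 + s * h p))"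

definition cw_convex_at ::
  "('a::topological_space, 'e::euclidean_space) chart set \<Rightarrow>
   ('a \<Rightarrow> ('a, 'e) tangent \<Rightarrow> ('a, 'e) tangent \<Rightarrow> real) \<Rightarrow> 'a set \<Rightarrow> ('a \<Rightarrow> real interval) \<Rightarrow>
   'a \<Rightarrow> bool" where
  "cw_convex_at A G E f p0 \<longleftrightarrow>
     convex_at A G E (center \<circ> f) p0 \<and> convex_at A G E (half_width \<circ> f) p0"


section \<open>Directional derivatives\<close>

definition geodesic_in_direction ::
  "('a::topological_space, 'e::euclidean_space) chart set \<Rightarrow>
   ('a \<Rightarrow> ('a, 'e) tangent \<Rightarrow> ('a, 'e) tangent \<Rightarrow> real) \<Rightarrow> 'a set \<Rightarrow> 'a \<Rightarrow> ('a, 'e) tangent \<Rightarrow>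
   real set \<Rightarrow> (real \<Rightarrow> 'a) \<Rightarrow> bool" where
  "geodesic_in_direction A G E p0 X I \<gamma> \<longleftrightarrow>
     geodesic A G I \<gamma> \<and> (\<exists>\<epsilon>>0. {0..<\<epsilon>} \<subseteq> I) \<and> \<gamma> ` I \<subseteq> E \<and> \<gamma> 0 = p0 \<and> velocity A \<gamma> I 0 = X"

definition tangent_directions ::
  "('a::topological_space, 'e::euclidean_space) chart set \<Rightarrow>
   ('a \<Rightarrow> ('a, 'e) tangent \<Rightarrow> ('a, 'e) tangent \<Rightarrow> real) \<Rightarrow> 'a set \<Rightarrow> 'a \<Rightarrow> ('a, 'e) tangent set" where
  "tangent_directions A G E p0 =
     {X \<in> tangent_space A p0. \<exists>I \<gamma>. geodesic_in_direction A G E p0 X I \<gamma>}"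

text \<open>Geodesics with the same initial velocity agree near \<open>0\<close> from the right, so the limits below do
  not depend on the choice of \<open>\<gamma>\<close>.\<close>

definition has_dir_deriv ::
  "('a::topological_space, 'e::euclidean_space) chart set \<Rightarrow>
   ('a \<Rightarrow> ('a, 'e) tangent \<Rightarrow> ('a, 'e) tangent \<Rightarrow> real) \<Rightarrow> 'a set \<Rightarrow> ('a \<Rightarrow> real) \<Rightarrow> 'a \<Rightarrow>
   ('a, 'e) tangent \<Rightarrow> real \<Rightarrow> bool" where
  "has_dir_deriv A G E h p0 X D \<longleftrightarrow>
     (\<forall>I \<gamma>. geodesic_in_direction A G E p0 X I \<gamma> \<longrightarrow>
        ((\<lambda>s. (h (\<gamma> s) - h p0) / s) \<longlongrightarrow> D) (at_right 0))"

definition dir_deriv ::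
  "('a::topological_space, 'e::euclidean_space) chart set \<Rightarrow>
   ('a \<Rightarrow> ('a, 'e) tangent \<Rightarrow> ('a, 'e) tangent \<Rightarrow> real) \<Rightarrow> 'a set \<Rightarrow> ('a \<Rightarrow> real) \<Rightarrow> 'a \<Rightarrow>
   ('a, 'e) tangent \<Rightarrow> real" where
  "dir_deriv A G E h p0 X = (THE D. has_dir_deriv A G E h p0 X D)"

definition dir_differentiable_at ::
  "('a::topological_space, 'e::euclidean_space) chart set \<Rightarrow>
   ('a \<Rightarrow> ('a, 'e) tangent \<Rightarrow> ('a, 'e) tangent \<Rightarrow> real) \<Rightarrow> 'a set \<Rightarrow> ('a \<Rightarrow> real) \<Rightarrow> 'a \<Rightarrow> bool" where
  "dir_differentiable_at A G E h p0 \<longleftrightarrow>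
     (\<forall>X\<in>tangent_directions A G E p0. \<exists>D. has_dir_deriv A G E h p0 X D)"

definition has_gH_dir_deriv ::
  "('a::topological_space, 'e::euclidean_space) chart set \<Rightarrow>
   ('a \<Rightarrow> ('a, 'e) tangent \<Rightarrow> ('a, 'e) tangent \<Rightarrow> real) \<Rightarrow> 'a set \<Rightarrow> ('a \<Rightarrow> real interval) \<Rightarrow> 'a \<Rightarrow>
   ('a, 'e) tangent \<Rightarrow> real interval \<Rightarrow> bool" where
  "has_gH_dir_deriv A G E f p0 X D \<longleftrightarrow>
     (\<forall>I \<gamma>. geodesic_in_direction A G E p0 X I \<gamma> \<longrightarrow>
        ((\<lambda>s. interval_dist (interval_of (1 / s) * (f (\<gamma> s) \<ominus>gH f p0)) D) \<longlongrightarrow> 0) (at_right 0))"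

definition gH_dir_deriv ::
  "('a::topological_space, 'e::euclidean_space) chart set \<Rightarrow>
   ('a \<Rightarrow> ('a, 'e) tangent \<Rightarrow> ('a, 'e) tangent \<Rightarrow> real) \<Rightarrow> 'a set \<Rightarrow> ('a \<Rightarrow> real interval) \<Rightarrow> 'a \<Rightarrow>
   ('a, 'e) tangent \<Rightarrow> real interval" where
  "gH_dir_deriv A G E f p0 X = (THE D. has_gH_dir_deriv A G E f p0 X D)"

definition gH_dir_differentiable_at ::
  "('a::topological_space, 'e::euclidean_space) chart set \<Rightarrow>
   ('a \<Rightarrow> ('a, 'e) tangent \<Rightarrow> ('a, 'e) tangent \<Rightarrow> real) \<Rightarrow> 'a set \<Rightarrow> ('a \<Rightarrow> real interval) \<Rightarrow> 'a \<Rightarrow>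
   bool" where
  "gH_dir_differentiable_at A G E f p0 \<longleftrightarrow>
     (\<forall>X\<in>tangent_directions A G E p0. \<exists>D. has_gH_dir_deriv A G E f p0 X D)"


section \<open>The optimization problem\<close>

definition feasible_set :: "'a set \<Rightarrow> nat \<Rightarrow> (nat \<Rightarrow> 'a \<Rightarrow> real) \<Rightarrow> 'a set" where
  "feasible_set E m g = {p \<in> E. \<forall>i\<in>{1..m}. g i p \<le> 0}"

definition nonconstant_on :: "'a set \<Rightarrow> ('a \<Rightarrow> real interval) \<Rightarrow> bool" where
  "nonconstant_on X f \<longleftrightarrow> (\<forall>p\<in>X. \<forall>q\<in>X. p \<noteq> q \<longrightarrow> f p \<noteq> f q)"

definition optimal_solution :: "'a set \<Rightarrow> ('a \<Rightarrow> real interval) \<Rightarrow> 'a \<Rightarrow> bool" where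
  "optimal_solution X f p0 \<longleftrightarrow> p0 \<in> X \<and> \<not> (\<exists>p\<in>X. f p <min f p0)"

definition strict_optimal_solution :: "'a set \<Rightarrow> ('a \<Rightarrow> real interval) \<Rightarrow> 'a \<Rightarrow> bool" where
  "strict_optimal_solution X f p0 \<longleftrightarrow> p0 \<in> X \<and> \<not> (\<exists>p\<in>X. p \<noteq> p0 \<and> f p \<le>min f p0)"

end

theory Submission
  imports Defs
begin

text \<open>
  If a feasible \<open>p\<close> had a smaller center than \<open>p0\<close>, then along a geodesic from \<open>p0\<close> to \<open>p\<close> the
  directional derivatives would be at most the increments of the convex functions, and the center
  in (i) would be negative; equal centers force equal intervals because the half-width does not
  decrease. What this needs is a geodesic from \<open>p0\<close> to \<open>p\<close>, that is, the theorem of Hopf and Rinow.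

  Closed balls of the Riemannian distance are compact by the argument of Cohn-Vossen, and a limit of
  almost minimizing curves is a curve \<open>\<sigma>\<close> with \<open>d (\<sigma> s) (\<sigma> t) = l * \<bar>t - s\<bar>\<close>. Such a curve is only
  known to be Lipschitz in a chart. Its smoothness comes from a discrete first variation: up to
  cubic errors the squared distance is the metric at one of the two points, so at the nodes of a
  mesh \<open>\<sigma>\<close> almost minimizes a discrete energy. Testing with the deviation of \<open>\<sigma>\<close> from the integral of
  the velocity that belongs to the discrete momentum shows that this deviation tends to zero with
  the mesh. Hence \<open>\<sigma>\<close> is differentiable with Lipschitz derivative, and the discrete momentum balance
  becomes the geodesic equation. No flow, exponential map or Gauss lemma is needed.
\<close>

section \<open>Discrete first variation\<close>

text \<open>The limit curve comes from a compactness argument that controls only distances between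
  its values, so neither length nor energy can be differentiated along it; hence a variation of
  finitely many nodes. The squared distance is used because it is quadratic in the increments and
  because equidistant nodes on a minimizer give equality in Cauchy-Schwarz. With
  \<open>N = T / \<tau>\<close> nodes the energy is of order \<tau>, its error against the metric of
  order \<tau>^2, and the second-order term of a variation of size \<epsilon> of order \<epsilon>^2
  \<tau>. The choice \<open>\<bar>\<epsilon>\<bar> = sqrt \<tau>\<close> balances the two errors,
  and division by it bounds the first variation by a multiple of
  \<open>sqrt \<tau> * \<tau>\<close>. The test field is that of the du Bois-Reymond lemma: the
  momentum is the running sum of the forces plus a constant of integration, and this constant is
  chosen so that the deviation vanishes at both ends.\<close>

lemma linear_sum_basis:
  fixes f :: "'e::euclidean_space \<Rightarrow> real"
  assumes "linear f"
  shows "f w = (\<Sum>b\<in>Basis. (w \<bullet> b) * f b)"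
proof -
  have "f w = f (\<Sum>b\<in>Basis. (w \<bullet> b) *\<^sub>R b)" by (simp add: euclidean_representation)
  also have "\<dots> = (\<Sum>b\<in>Basis. (w \<bullet> b) * f b)"
    by (simp add: linear_sum[OF assms] linear_cmul[OF assms])
  finally show ?thesis .
qed

text \<open>Lax-Milgram in finite dimension: coercivity makes \<open>T\<close> injective, hence
  surjective. The explicit bound on the solution keeps later constants independent of the
  mesh.\<close>

lemma coercive_surj:
  fixes T :: "'e::euclidean_space \<Rightarrow> 'e"
  assumes "linear T" "0 < \<mu>" "\<And>k. \<mu> * (norm k)\<^sup>2 \<le> T k \<bullet> k"
  obtains k where "T k = y" "norm k \<le> norm y / \<mu>"
proof -
  have low: "\<mu> * norm k \<le> norm (T k)" for k
  proof (cases "k = 0")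
    case False
    have "\<mu> * (norm k)\<^sup>2 \<le> norm (T k) * norm k"
      using assms(3)[of k] Cauchy_Schwarz_ineq2[of "T k" k] by linarith
    then show ?thesis using False by (simp add: power2_eq_square)
  qed simp
  have "inj T"
  proof (rule linear_injective_0[OF assms(1), THEN iffD2], intro allI impI)
    fix v assume "T v = 0"
    then show "v = 0" using low[of v] assms(2) by (simp add: mult_le_0_iff)
  qed
  then have "surj T" using assms(1) linear_injective_imp_surjective by blast
  then obtain k where "T k = y" by (metis surjD)
  moreover have "norm k \<le> norm y / \<mu>"
    using low[of k] assms(2) \<open>T k = y\<close> by (simp add: field_simps)
  ultimately show ?thesis using that by blast
qed

lemma sum_power2_le: 
  fixes f :: "nat \<Rightarrow> real"
  shows "(\<Sum>i<N. f i)\<^sup>2 \<le> real N * (\<Sum>i<N. (f i)\<^sup>2)"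
  using Cauchy_Schwarz_ineq_sum[of f "\<lambda>_. 1" "{..<N}"] by (simp add: mult.commute)

text \<open>Summation by parts, which moves the difference from the momentum to the test
  field.\<close>

lemma abel_sum:
  fixes P \<phi> :: "nat \<Rightarrow> 'e::real_inner"
  shows "(\<Sum>i<N. (P (Suc i) - P i) \<bullet> \<phi> i) =
     P N \<bullet> \<phi> N - P 0 \<bullet> \<phi> 0 - (\<Sum>i<N. P (Suc i) \<bullet> (\<phi> (Suc i) - \<phi> i))"
  by (induction N) (auto simp: inner_simps)

text \<open>\<open>h' x w\<close> is the derivative of the field of forms \<open>h\<close> at \<open>x\<close> in the direction \<open>w\<close>.\<close>

locale metric_ball =
  fixes B :: "'e::euclidean_space set"
    and h :: "'e \<Rightarrow> 'e \<Rightarrow> 'e \<Rightarrow> real" and h' :: "'e \<Rightarrow> 'e \<Rightarrow> 'e \<Rightarrow> 'e \<Rightarrow> real"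
    and lam K :: real
  assumes lam_pos: "0 < lam" and K_pos: "0 < K"
    and bil: "x \<in> B \<Longrightarrow> bilinear (h x)"
    and sym: "x \<in> B \<Longrightarrow> h x u v = h x v u"
    and bil': "x \<in> B \<Longrightarrow> bilinear (h' x w)"
    and lin': "x \<in> B \<Longrightarrow> linear (\<lambda>w. h' x w u v)"
    and coercive: "x \<in> B \<Longrightarrow> lam * (norm u)\<^sup>2 \<le> h x u u"
    and bound: "x \<in> B \<Longrightarrow> \<bar>h x u v\<bar> \<le> K * norm u * norm v"
    and lip: "x \<in> B \<Longrightarrow> y \<in> B \<Longrightarrow> \<bar>h y u v - h x u v\<bar> \<le> K * norm (y - x) * norm u * norm v"
    and bound': "x \<in> B \<Longrightarrow> \<bar>h' x w u v\<bar> \<le> K * norm w * norm u * norm v"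
    and lip': "x \<in> B \<Longrightarrow> y \<in> B \<Longrightarrow>
        \<bar>h' y w u v - h' x w u v\<bar> \<le> K * norm (y - x) * norm w * norm u * norm v"
    and taylor: "x \<in> B \<Longrightarrow> y \<in> B \<Longrightarrow>
        \<bar>h y u v - h x u v - h' x (y - x) u v\<bar> \<le> K * (norm (y - x))\<^sup>2 * norm u * norm v"
begin

section \<open>The metric at a point and its inverse\<close>

lemmas h_simps = bilinear_ladd[OF bil] bilinear_radd[OF bil] bilinear_lsub[OF bil]
  bilinear_rsub[OF bil] bilinear_lmul[OF bil] bilinear_rmul[OF bil]

lemma ex_riesz:
  assumes "x \<in> B"
  shows "\<exists>z. \<forall>e. h x z e = y \<bullet> e"
proof -
  let ?T = "\<lambda>z. \<Sum>b\<in>Basis. h x z b *\<^sub>R b"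
  have T: "?T z \<bullet> e = h x z e" for z e
  proof -
    have "linear (h x z)" using bil[OF assms] by (simp add: bilinear_def)
    from linear_sum_basis[OF this, of e] show ?thesis
      by (simp add: inner_sum_left inner_commute[of e] mult.commute)
  qed
  have "linear ?T"
    by (rule linearI) (auto simp: h_simps assms scaleR_left.add sum.distrib scaleR_sum_right)
  moreover have "lam * (norm k)\<^sup>2 \<le> ?T k \<bullet> k" for k using T coercive[OF assms] by simp
  ultimately obtain k where "?T k = y" using coercive_surj lam_pos by blast
  then show ?thesis using T by (metis)
qed

text \<open>The inverse metric, or raising of an index: it turns a momentum, represented as
  \<open>y\<close> by the Euclidean inner product, into the velocity that belongs to it.\<close>

definition hi :: "'e \<Rightarrow> 'e \<Rightarrow> 'e" where "hi x y = (SOME z. \<forall>e. h x z e = y \<bullet> e)"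

lemma h_hi: "x \<in> B \<Longrightarrow> h x (hi x y) e = y \<bullet> e"
  unfolding hi_def using someI_ex[OF ex_riesz[of x y]] by blast

text \<open>Testing with \<open>e = z\<close> and coercivity: a one-sided bound on the form
  \<open>h x z\<close> already bounds the vector \<open>z\<close>.\<close>

lemma norm_leI:
  assumes "x \<in> B" "\<And>e. h x z e \<le> C * norm e" "0 \<le> C"
  shows "norm z \<le> C / lam"
proof (cases "z = 0")
  case False
  have "lam * (norm z)\<^sup>2 \<le> C * norm z" using coercive[OF assms(1), of z] assms(2)[of z] by linarith
  then have "lam * norm z \<le> C" using False by (simp add: power2_eq_square)
  then show ?thesis using lam_pos by (simp add: field_simps)
qed (use assms lam_pos in auto)

lemma h_eqI:
  assumes "x \<in> B" "\<And>e. h x z e = h x z' e"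
  shows "z = z'"
  using norm_leI[of x "z - z'" 0] assms by (simp add: h_simps)

lemma linear_hi: "x \<in> B \<Longrightarrow> linear (hi x)"
  by (rule linearI) (rule h_eqI[of x], auto simp: h_simps h_hi inner_simps)+

lemma norm_hi: "x \<in> B \<Longrightarrow> norm (hi x y) \<le> norm y / lam"
  by (rule norm_leI) (auto simp: h_hi norm_cauchy_schwarz)

text \<open>\<open>bound\<close> gives \<open>norm y \<le> K * norm (hi x y)\<close>, and coercivity
  at \<open>hi x y\<close> gives the factor \<open>lam\<close>; hence the constant
  \<open>lam / K\<^sup>2\<close>.\<close>

lemma hi_coercive: "x \<in> B \<Longrightarrow> lam / K\<^sup>2 * (norm y)\<^sup>2 \<le> hi x y \<bullet> y"
proof -
  assume x: "x \<in> B"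
  have "(norm y)\<^sup>2 \<le> K * norm (hi x y) * norm y"
    using bound[OF x, of "hi x y" y] h_hi[OF x, of y y] by (simp add: power2_norm_eq_inner)
  then have "norm y \<le> K * norm (hi x y)"
    by (cases "y = 0") (use K_pos in \<open>auto simp: power2_eq_square\<close>)
  then have "(norm y)\<^sup>2 \<le> K\<^sup>2 * (norm (hi x y))\<^sup>2"
    by (metis norm_ge_zero power_mono power_mult_distrib)
  then have "lam * (norm y)\<^sup>2 \<le> K\<^sup>2 * (lam * (norm (hi x y))\<^sup>2)"
    using lam_pos by (simp add: mult.left_commute)
  also have "\<dots> \<le> K\<^sup>2 * (hi x y \<bullet> y)"
    using coercive[OF x, of "hi x y"] h_hi[OF x, of y "hi x y"] by (simp add: inner_commute mult_left_mono)
  finally show ?thesis using K_pos by (simp add: field_simps)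
qed

text \<open>The resolvent identity for the inverse: \<open>h x'\<close> at the difference equals, up
  to sign, the change of the form from \<open>x\<close> to \<open>x'\<close> at the fixed vector
  \<open>hi x y\<close>. One factor \<open>lam\<close> comes from \<open>norm_hi\<close>, the other
  from \<open>norm_leI\<close>.\<close>

lemma hi_lip:
  assumes "x \<in> B" "x' \<in> B"
  shows "norm (hi x' y - hi x y) \<le> K * norm (x' - x) * norm y / lam\<^sup>2"
proof -
  have "norm (hi x' y - hi x y) \<le> (K * norm (x' - x) * (norm y / lam)) / lam"
  proof (rule norm_leI[OF assms(2)])
    fix e
    have "h x' (hi x' y - hi x y) e = - (h x' (hi x y) e - h x (hi x y) e)"
      using assms by (simp add: h_simps h_hi)
    also have "\<dots> \<le> K * norm (x' - x) * norm (hi x y) * norm e"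
      using lip[OF assms, of "hi x y" e] by linarith
    also have "\<dots> \<le> K * norm (x' - x) * (norm y / lam) * norm e"
      using norm_hi[OF assms(1), of y] K_pos by (intro mult_right_mono mult_left_mono) auto
    finally show "h x' (hi x' y - hi x y) e \<le> K * norm (x' - x) * (norm y / lam) * norm e" .
  qed (use K_pos lam_pos in auto)
  then show ?thesis by (simp add: power2_eq_square)
qed

end

text \<open>\<open>D\<close> stands for the Riemannian distance read in a chart. The metric may be
  frozen at the first point because the error is cubic: over \<open>T / \<tau>\<close> steps of
  length of order \<tau> it adds up to order \<tau>^2, one order below the energy.\<close>

locale metric_ball_dist = metric_ball B h h' lam K
  for B :: "'e::euclidean_space set" and h h' lam K +
  fixes D :: "'e \<Rightarrow> 'e \<Rightarrow> real" and K2 :: real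
  assumes D_tri: "x \<in> B \<Longrightarrow> y \<in> B \<Longrightarrow> z \<in> B \<Longrightarrow> D x z \<le> D x y + D y z"
    and D_nonneg: "x \<in> B \<Longrightarrow> y \<in> B \<Longrightarrow> 0 \<le> D x y"
    and K2_nonneg: "0 \<le> K2"
    and D_approx: "x \<in> B \<Longrightarrow> y \<in> B \<Longrightarrow>
      \<bar>(D x y)\<^sup>2 - h x (y - x) (y - x)\<bar> \<le> K2 * norm (y - x) ^ 3"
begin

lemma polygon:
  "(\<And>i. i \<le> N \<Longrightarrow> x i \<in> B) \<Longrightarrow> 0 < N \<Longrightarrow> D (x 0) (x N) \<le> (\<Sum>i<N. D (x i) (x (Suc i)))"
proof (induction N)
  case (Suc N)
  show ?case
  proof (cases "N = 0")
    case False
    then have "D (x 0) (x N) \<le> (\<Sum>i<N. D (x i) (x (Suc i)))" using Suc by simp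
    then show ?thesis using D_tri[of "x 0" "x N" "x (Suc N)"] Suc.prems by simp
  qed simp
qed simp

text \<open>The two cubic errors of \<open>D_approx\<close>, at the perturbed and at the unperturbed
  pair, give the \<open>K2\<close> term, which carries no factor \<epsilon>. The rest expands
  \<open>h\<close> in the base point and in the increment, with remainders quadratic in
  \<epsilon>.\<close>

lemma discrete_variation_step:
  assumes B: "c \<in> B" "c + dc \<in> B" "c + \<epsilon> *\<^sub>R \<phi> \<in> B" "c + dc + \<epsilon> *\<^sub>R (\<phi> + d\<phi>) \<in> B"
    and n: "norm dc \<le> L * \<tau>" "norm d\<phi> \<le> L' * \<tau>" "norm \<phi> \<le> \<Phi>"
    and pos: "0 < \<tau>" "0 \<le> L" "0 \<le> L'" "\<bar>\<epsilon>\<bar> \<le> 1"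
  shows "(D (c + \<epsilon> *\<^sub>R \<phi>) (c + dc + \<epsilon> *\<^sub>R (\<phi> + d\<phi>)))\<^sup>2 - (D c (c + dc))\<^sup>2 \<le>
     \<epsilon> * (h' c \<phi> dc dc + 2 * h c dc d\<phi>) +
     (K2 * ((L + L') ^ 3 + L ^ 3) * \<tau> + K * (\<Phi>\<^sup>2 * L\<^sup>2 + 2 * \<Phi> * L * L' + L'\<^sup>2) * \<epsilon>\<^sup>2) * \<tau>\<^sup>2"
proof -
  define x where "x = c + \<epsilon> *\<^sub>R \<phi>"
  define v where "v = dc + \<epsilon> *\<^sub>R d\<phi>"
  have xB: "x \<in> B" using B by (simp add: x_def)
  have y: "c + dc + \<epsilon> *\<^sub>R (\<phi> + d\<phi>) = x + v" by (simp add: x_def v_def algebra_simps)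
  have \<Phi>0: "0 \<le> \<Phi>" using n(3) norm_ge_zero order_trans by blast
  have "norm v \<le> norm dc + \<bar>\<epsilon>\<bar> * norm d\<phi>" unfolding v_def by (metis norm_scaleR norm_triangle_ineq)
  also have "\<dots> \<le> L * \<tau> + 1 * (L' * \<tau>)" using n pos by (intro add_mono mult_mono) auto
  finally have nv: "norm v \<le> (L + L') * \<tau>" by (simp add: algebra_simps)
  have "K2 * norm v ^ 3 \<le> K2 * ((L + L') * \<tau>) ^ 3"
    using K2_nonneg nv by (intro mult_left_mono power_mono) auto
  then have 1: "(D x (x + v))\<^sup>2 \<le> h x v v + K2 * (L + L') ^ 3 * \<tau> ^ 3"
    using D_approx[of x "x + v"] xB B(4) by (simp add: y power_mult_distrib)
  have "K2 * norm dc ^ 3 \<le> K2 * (L * \<tau>) ^ 3"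
    using K2_nonneg n by (intro mult_left_mono power_mono) auto
  then have 2: "(D c (c + dc))\<^sup>2 \<ge> h c dc dc - K2 * L ^ 3 * \<tau> ^ 3"
    using D_approx[of c "c + dc"] B by (simp add: power_mult_distrib)
  have 3: "h x v v = h x dc dc + 2 * \<epsilon> * h x dc d\<phi> + \<epsilon>\<^sup>2 * h x d\<phi> d\<phi>"
    using sym[OF xB, of d\<phi> dc] xB unfolding v_def by (simp add: h_simps power2_eq_square algebra_simps)
  have xc: "x - c = \<epsilon> *\<^sub>R \<phi>" by (simp add: x_def)
  have h'e: "h' c (\<epsilon> *\<^sub>R \<phi>) dc dc = \<epsilon> * h' c \<phi> dc dc"
    using linear_cmul[OF lin'[OF B(1), of dc dc], of \<epsilon> \<phi>] by simp
  \<comment> \<open>Facts 4 to 6 treat the three terms of fact 3: Taylor in the base point, the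
    Lipschitz bound for the mixed term, boundedness for the last.\<close>
  have "\<bar>h x dc dc - h c dc dc - \<epsilon> * h' c \<phi> dc dc\<bar> \<le> K * (\<bar>\<epsilon>\<bar> * norm \<phi>)\<^sup>2 * norm dc * norm dc"
    using taylor[OF B(1) xB, of dc dc] unfolding xc h'e by simp
  also have "\<dots> \<le> K * (\<bar>\<epsilon>\<bar> * \<Phi>)\<^sup>2 * (L * \<tau>) * (L * \<tau>)"
    using n pos K_pos \<Phi>0 by (intro mult_mono power_mono) (auto intro!: mult_nonneg_nonneg)
  finally have 4: "h x dc dc \<le> h c dc dc + \<epsilon> * h' c \<phi> dc dc + K * \<Phi>\<^sup>2 * L\<^sup>2 * \<epsilon>\<^sup>2 * \<tau>\<^sup>2"
    by (simp add: power_mult_distrib power2_eq_square algebra_simps)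
  have "\<bar>\<epsilon> * (h x dc d\<phi> - h c dc d\<phi>)\<bar> \<le> \<bar>\<epsilon>\<bar> * (K * (\<bar>\<epsilon>\<bar> * norm \<phi>) * norm dc * norm d\<phi>)"
    using lip[OF B(1) xB, of dc d\<phi>] unfolding xc abs_mult by (intro mult_left_mono) auto
  also have "\<dots> \<le> \<bar>\<epsilon>\<bar> * (K * (\<bar>\<epsilon>\<bar> * \<Phi>) * (L * \<tau>) * (L' * \<tau>))"
    using n pos K_pos \<Phi>0 by (intro mult_left_mono mult_mono) (auto intro!: mult_nonneg_nonneg)
  also have "\<dots> = K * \<Phi> * L * L' * \<epsilon>\<^sup>2 * \<tau>\<^sup>2" by (simp add: power2_eq_square algebra_simps)
  finally have 5: "2 * \<epsilon> * h x dc d\<phi> \<le> 2 * \<epsilon> * h c dc d\<phi> + 2 * (K * \<Phi> * L * L' * \<epsilon>\<^sup>2 * \<tau>\<^sup>2)"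
    by (simp add: algebra_simps)
  have "h x d\<phi> d\<phi> \<le> K * (L' * \<tau>) * (L' * \<tau>)"
    by (rule order_trans[OF order_trans[OF abs_ge_self bound[OF xB]]])
      (use n pos K_pos in \<open>intro mult_mono, auto intro!: mult_nonneg_nonneg\<close>)
  then have "\<epsilon>\<^sup>2 * h x d\<phi> d\<phi> \<le> \<epsilon>\<^sup>2 * (K * (L' * \<tau>) * (L' * \<tau>))" by (intro mult_left_mono) auto
  then have 6: "\<epsilon>\<^sup>2 * h x d\<phi> d\<phi> \<le> K * L'\<^sup>2 * \<epsilon>\<^sup>2 * \<tau>\<^sup>2" by (simp add: power2_eq_square algebra_simps)
  have "(D x (x + v))\<^sup>2 - (D c (c + dc))\<^sup>2 \<le> \<epsilon> * h' c \<phi> dc dc + 2 * \<epsilon> * h c dc d\<phi>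
      + K2 * (L + L') ^ 3 * \<tau> ^ 3 + K2 * L ^ 3 * \<tau> ^ 3
      + K * \<Phi>\<^sup>2 * L\<^sup>2 * \<epsilon>\<^sup>2 * \<tau>\<^sup>2 + 2 * (K * \<Phi> * L * L' * \<epsilon>\<^sup>2 * \<tau>\<^sup>2) + K * L'\<^sup>2 * \<epsilon>\<^sup>2 * \<tau>\<^sup>2"
    using 1 2 3 4 5 6 by linarith
  also have "\<dots> = \<epsilon> * (h' c \<phi> dc dc + 2 * h c dc d\<phi>) +
     (K2 * ((L + L') ^ 3 + L ^ 3) * \<tau> + K * (\<Phi>\<^sup>2 * L\<^sup>2 + 2 * \<Phi> * L * L' + L'\<^sup>2) * \<epsilon>\<^sup>2) * \<tau>\<^sup>2"
    by (simp add: algebra_simps power2_eq_square power3_eq_cube)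
  finally show ?thesis unfolding y x_def[symmetric] .
qed

text \<open>On a minimizing curve, equidistant nodes minimize the sum of the squared distances, by the
  triangle and Cauchy--Schwarz inequalities. Replacing \<open>D\<close> by \<open>h\<close> costs the error
  of order \<open>\<tau>\<close>, and the expansion in \<open>\<epsilon>\<close> the one of order \<open>\<epsilon>\<^sup>2\<close>.\<close>

lemma discrete_variation:
  fixes c \<phi> :: "nat \<Rightarrow> 'e" and N :: nat and l \<tau> :: real
  defines "S \<equiv> \<Sum>i<N. h' (c i) (\<phi> i) (c (Suc i) - c i) (c (Suc i) - c i)
                 + 2 * h (c i) (c (Suc i) - c i) (\<phi> (Suc i) - \<phi> i)"
  assumes in_B: "\<And>i. i \<le> N \<Longrightarrow> cball (c i) \<rho> \<subseteq> B"
    and n: "\<And>i. i < N \<Longrightarrow> norm (c (Suc i) - c i) \<le> L * \<tau>"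
      "\<And>i. i < N \<Longrightarrow> norm (\<phi> (Suc i) - \<phi> i) \<le> L' * \<tau>" "\<And>i. i \<le> N \<Longrightarrow> norm (\<phi> i) \<le> \<Phi>"
    and ends: "\<phi> 0 = 0" "\<phi> N = 0"
    and pos: "0 < \<tau>" "0 \<le> L" "0 \<le> L'" "\<bar>\<epsilon>\<bar> \<le> 1" "0 < N" "\<bar>\<epsilon>\<bar> * \<Phi> \<le> \<rho>"
    and len: "\<And>i. i < N \<Longrightarrow> D (c i) (c (Suc i)) = l * \<tau>" "D (c 0) (c N) = l * (N * \<tau>)"
  shows "- ((K2 * ((L + L') ^ 3 + L ^ 3) * \<tau> + K * (\<Phi>\<^sup>2 * L\<^sup>2 + 2 * \<Phi> * L * L' + L'\<^sup>2) * \<epsilon>\<^sup>2)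
     * (N * \<tau>\<^sup>2)) \<le> \<epsilon> * S"
proof -
  define x where "x i = c i + \<epsilon> *\<^sub>R \<phi> i" for i
  define R where "R = (K2 * ((L + L') ^ 3 + L ^ 3) * \<tau> +
     K * (\<Phi>\<^sup>2 * L\<^sup>2 + 2 * \<Phi> * L * L' + L'\<^sup>2) * \<epsilon>\<^sup>2) * \<tau>\<^sup>2"
  have \<Phi>0: "0 \<le> \<Phi>" using n(3)[of 0] norm_ge_zero order_trans by blast
  then have "0 \<le> \<rho>" using pos by (meson abs_ge_zero mult_nonneg_nonneg order_trans)
  then have cB: "c i \<in> B" if "i \<le> N" for i using in_B[OF that] by auto
  have xB: "x i \<in> B" if "i \<le> N" for i
  proof -
    have "\<bar>\<epsilon>\<bar> * norm (\<phi> i) \<le> \<bar>\<epsilon>\<bar> * \<Phi>" using n(3)[OF that] by (intro mult_left_mono) auto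
    then show ?thesis using in_B[OF that] pos unfolding x_def by (auto simp: dist_norm)
  qed
  \<comment> \<open>Squaring the polygon inequality needs a nonnegative left side, and the sign of
    \<open>l\<close> comes only from \<open>D_nonneg\<close>.\<close>
  have "0 \<le> D (c 0) (c N)" using D_nonneg cB by simp
  then have "0 \<le> l * (N * \<tau>)" by (simp add: len)
  \<comment> \<open>The perturbation vanishes at both ends, so the perturbed polygon joins the same
    two points.\<close>
  moreover have "l * (N * \<tau>) \<le> (\<Sum>i<N. D (x i) (x (Suc i)))"
    using polygon[of N x] xB pos len(2) ends by (simp add: x_def)
  ultimately have "(l * (N * \<tau>))\<^sup>2 \<le> (\<Sum>i<N. D (x i) (x (Suc i)))\<^sup>2"
    by (simp add: power_mono)
  also have "\<dots> \<le> N * (\<Sum>i<N. (D (x i) (x (Suc i)))\<^sup>2)" by (rule sum_power2_le)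
  finally have "N * (N * (l * \<tau>)\<^sup>2) \<le> N * (\<Sum>i<N. (D (x i) (x (Suc i)))\<^sup>2)"
    by (simp add: power_mult_distrib power2_eq_square algebra_simps)
  then have "N * (l * \<tau>)\<^sup>2 \<le> (\<Sum>i<N. (D (x i) (x (Suc i)))\<^sup>2)" using pos by simp
  then have "0 \<le> (\<Sum>i<N. (D (x i) (x (Suc i)))\<^sup>2 - (D (c i) (c (Suc i)))\<^sup>2)"
    by (simp add: sum_subtractf len)
  also have "\<dots> \<le> (\<Sum>i<N. \<epsilon> * (h' (c i) (\<phi> i) (c (Suc i) - c i) (c (Suc i) - c i)
                 + 2 * h (c i) (c (Suc i) - c i) (\<phi> (Suc i) - \<phi> i)) + R)"
  proof (rule sum_mono)
    fix i assume "i \<in> {..<N}"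
    then have i: "i < N" by simp
    show "(D (x i) (x (Suc i)))\<^sup>2 - (D (c i) (c (Suc i)))\<^sup>2 \<le>
       \<epsilon> * (h' (c i) (\<phi> i) (c (Suc i) - c i) (c (Suc i) - c i)
                 + 2 * h (c i) (c (Suc i) - c i) (\<phi> (Suc i) - \<phi> i)) + R"
      using discrete_variation_step[of "c i" "c (Suc i) - c i" \<epsilon> "\<phi> i" "\<phi> (Suc i) - \<phi> i" L \<tau> L' \<Phi>]
        i pos n cB[of i] cB[of "Suc i"] xB[of i] xB[of "Suc i"]
      unfolding R_def x_def by auto
  qed
  also have "\<dots> = \<epsilon> * S + N * R"
    by (subst sum.distrib) (simp add: S_def sum_distrib_left)
  finally show ?thesis unfolding R_def by (simp add: algebra_simps)
qed


text \<open>These properties survive refinement: the bound gives compactness, the Lipschitz bound a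
  quadratic remainder, the third says that \<open>c\<close> is the integral of \<open>w\<close> up
  to \<open>err\<close>, and the fourth is the Euler-Lagrange equation summed over the nodes. Its
  sum starts at 1 because the momentum belonging to index \<open>i\<close> already contains the
  force at node \<open>i\<close>.\<close>

definition discrete_velocity ::
  "real \<Rightarrow> real \<Rightarrow> real \<Rightarrow> nat \<Rightarrow> real \<Rightarrow> (nat \<Rightarrow> 'e) \<Rightarrow> (nat \<Rightarrow> 'e) \<Rightarrow> bool" where
  "discrete_velocity Q W err N \<tau> c w \<longleftrightarrow>
     (\<forall>i<N. norm (w i) \<le> W) \<and> (\<forall>i. Suc i < N \<longrightarrow> norm (w (Suc i) - w i) \<le> Q * \<tau>) \<and>
     (\<forall>i\<le>N. norm (c i - c 0 - \<tau> *\<^sub>R (\<Sum>j<i. w j)) \<le> err) \<and>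
     (\<forall>e. 2 * h (c (N - 1)) (w (N - 1)) e - 2 * h (c 0) (w 0) e =
        (\<Sum>j\<in>{1..<N}. h' (c j) e (c (Suc j) - c j) (c (Suc j) - c j) / \<tau>))"

lemma norm_steps:
  fixes f :: "nat \<Rightarrow> 'b::real_normed_vector"
  assumes "\<And>l. min i j \<le> l \<Longrightarrow> l < max i j \<Longrightarrow> norm (f (Suc l) - f l) \<le> b"
  shows "norm (f j - f i) \<le> \<bar>real j - real i\<bar> * b"
proof -
  have *: "norm (f k' - f k) \<le> (real k' - real k) * b"
    if "k \<le> k'" "\<And>l. k \<le> l \<Longrightarrow> l < k' \<Longrightarrow> norm (f (Suc l) - f l) \<le> b" for k k'
    using that
  proof (induction rule: dec_induct)
    case (step k')
    have "norm (f (Suc k') - f k) \<le> norm (f (Suc k') - f k') + norm (f k' - f k)" by norm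
    also have "\<dots> \<le> b + (real k' - real k) * b" using step by (intro add_mono) auto
    finally show ?case by (simp add: algebra_simps)
  qed simp
  show ?thesis
    using *[of i j] *[of j i] assms by (cases "i \<le> j") (auto simp: norm_minus_commute)
qed

text \<open>\<open>P\<close> is the running sum of the Euler-Lagrange forces, which are linear in
  \<open>e\<close> and hence represented by vectors. The squared increments are of order \<tau>^2,
  so after division by \<tau> the force per step is of order \<tau>.\<close>

lemma discrete_momentum:
  fixes c :: "nat \<Rightarrow> 'e" and N :: nat and \<tau> :: real
  defines "F \<equiv> \<lambda>e i. h' (c i) e (c (Suc i) - c i) (c (Suc i) - c i) / \<tau>"
  assumes cB: "\<And>i. i \<le> N \<Longrightarrow> c i \<in> B" and n: "\<And>i. i < N \<Longrightarrow> norm (c (Suc i) - c i) \<le> L * \<tau>"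
    and pos: "0 < \<tau>" "0 \<le> L"
  obtains P where "\<And>i e. i < N \<Longrightarrow> (P (Suc i) - P i) \<bullet> e = F e i"
    "\<And>i. i < N \<Longrightarrow> norm (P (Suc i) - P i) \<le> K * L\<^sup>2 * \<tau>"
    "\<And>i. i \<le> N \<Longrightarrow> norm (P i) \<le> K * L\<^sup>2 * (N * \<tau>)"
proof
  define P where "P j = (\<Sum>b\<in>Basis. (\<Sum>i<j. F b i) *\<^sub>R b)" for j
  have P0: "P 0 = 0" by (simp add: P_def)
  show dP: "(P (Suc i) - P i) \<bullet> e = F e i" if "i < N" for i e
  proof -
    have lin: "linear (\<lambda>e. F e i)"
      using linear_compose_scale_right[OF lin'[OF cB[of i], of "c (Suc i) - c i" "c (Suc i) - c i"], of "1 / \<tau>"] that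
      by (simp add: F_def)
    show ?thesis
      by (simp add: linear_sum_basis[OF lin, of e] P_def inner_sum_left inner_commute[of e] mult.commute
          algebra_simps flip: sum_subtractf)
  qed
  show dPn: "norm (P (Suc i) - P i) \<le> K * L\<^sup>2 * \<tau>" if "i < N" for i
  proof (cases "P (Suc i) - P i = 0")
    case False
    \<comment> \<open>Testing the force with the increment of \<open>P\<close> itself turns the
      bound on the form into a bound on the norm.\<close>
    let ?e = "P (Suc i) - P i" and ?d = "c (Suc i) - c i"
    have "(norm ?e)\<^sup>2 = F ?e i" using dP[OF that, of ?e] by (simp add: power2_norm_eq_inner)
    also have "\<dots> \<le> K * norm ?e * norm ?d * norm ?d / \<tau>"
      unfolding F_def using bound'[OF cB[of i], of ?e ?d ?d] that pos by (intro divide_right_mono) auto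
    also have "\<dots> \<le> K * norm ?e * (L * \<tau>) * (L * \<tau>) / \<tau>"
      using n[OF that] pos K_pos by (intro divide_right_mono mult_mono) (auto intro!: mult_nonneg_nonneg)
    also have "\<dots> = norm ?e * (K * L\<^sup>2 * \<tau>)" using pos by (simp add: power2_eq_square)
    finally show ?thesis using False by (simp add: power2_eq_square)
  qed (use K_pos pos in simp)
  show "norm (P i) \<le> K * L\<^sup>2 * (N * \<tau>)" if "i \<le> N" for i
  proof -
    have "norm (P i) \<le> i * (K * L\<^sup>2 * \<tau>)"
      using norm_steps[of 0 i P] dPn that P0 by simp
    also have "\<dots> \<le> N * (K * L\<^sup>2 * \<tau>)" using that K_pos pos by (intro mult_right_mono) auto
    finally show ?thesis by (simp add: algebra_simps)
  qed
qed

text \<open>The test field \<open>\<eta>\<close> is the deviation of the polygon \<open>c\<close> from the integral of the velocity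
  \<open>w\<close> prescribed by the discrete momentum; the first variation at \<open>\<eta>\<close> is then a sum of squares.\<close>

lemma discrete_regularity:
  assumes "0 \<le> L" "0 < \<rho>" "0 < T"
  obtains Q W C \<tau>0 where "0 < \<tau>0" "0 \<le> Q"
    "\<And>N (\<tau>::real) c. 0 < N \<Longrightarrow> 0 < \<tau> \<Longrightarrow> \<tau> \<le> \<tau>0 \<Longrightarrow> N * \<tau> = T \<Longrightarrow>
      (\<And>i. i \<le> N \<Longrightarrow> cball (c i) \<rho> \<subseteq> B) \<Longrightarrow> (\<And>i. i < N \<Longrightarrow> norm (c (Suc i) - c i) \<le> L * \<tau>) \<Longrightarrow>
      (\<And>i. i < N \<Longrightarrow> D (c i) (c (Suc i)) = l * \<tau>) \<Longrightarrow> D (c 0) (c N) = l * T \<Longrightarrow>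
      \<exists>w. discrete_velocity Q W (T * sqrt (C * sqrt \<tau>)) N \<tau> c w"
proof -
  define KF where "KF = K * L\<^sup>2"
  \<comment> \<open>\<open>kb\<close> will bound the constant of integration \<open>k\<close>: the
    first factor bounds the endpoint defect \<open>y\<close> divided by \<open>T\<close>, the second
    is the reciprocal of the coercivity constant of \<open>M\<close> divided by
    \<open>T\<close>.\<close>
  define kb where "kb = (L + KF * T / (2 * lam)) * (2 * K\<^sup>2 / lam)"
  define W where "W = (KF * T + kb) / lam / 2"
  define Q where "Q = (K * L * (KF * T + kb) / lam\<^sup>2 + KF / lam) / 2"
  define L' where "L' = L + W"
  define \<Phi> where "\<Phi> = L' * T"
  define C1 where "C1 = K2 * ((L + L') ^ 3 + L ^ 3)"
  define C2 where "C2 = K * (\<Phi>\<^sup>2 * L\<^sup>2 + 2 * \<Phi> * L * L' + L'\<^sup>2)"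
  define C where "C = (C1 + C2) / (2 * lam)"
  \<comment> \<open>The two bounds make \<open>sqrt \<tau>\<close> an admissible size of \<epsilon>:
    at most 1, and small enough for the perturbed nodes to stay within distance \<rho> of the old
    ones. The \<open>+ 1\<close> avoids division by zero.\<close>
  define \<tau>0 where "\<tau>0 = min 1 ((\<rho> / (\<Phi> + 1))\<^sup>2)"
  have nn: "0 \<le> KF" "0 \<le> kb" "0 \<le> W" "0 \<le> Q" "0 \<le> L'" "0 \<le> \<Phi>" "0 \<le> C1" "0 \<le> C2"
  proof -
    show KF: "0 \<le> KF" using K_pos by (simp add: KF_def)
    show kb: "0 \<le> kb" using K_pos lam_pos assms KF by (simp add: kb_def)
    show W: "0 \<le> W" using K_pos lam_pos assms KF kb by (simp add: W_def)
    show "0 \<le> Q" using K_pos lam_pos assms KF kb by (simp add: Q_def)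
    show L': "0 \<le> L'" using W assms by (simp add: L'_def)
    show Phi: "0 \<le> \<Phi>" using L' assms by (simp add: \<Phi>_def)
    show "0 \<le> C1" using L' K2_nonneg assms by (simp add: C1_def)
    show "0 \<le> C2" using L' Phi K_pos assms by (simp add: C2_def)
  qed
  have \<tau>0: "0 < \<tau>0" using assms nn by (simp add: \<tau>0_def)
  show thesis
  proof (rule that[OF \<tau>0 \<open>0 \<le> Q\<close>])
    fix N :: nat and \<tau> :: real and c :: "nat \<Rightarrow> 'e"
    assume N: "0 < N" and \<tau>: "0 < \<tau>" "\<tau> \<le> \<tau>0" and T: "N * \<tau> = T"
      and in_B: "\<And>i. i \<le> N \<Longrightarrow> cball (c i) \<rho> \<subseteq> B"
      and n: "\<And>i. i < N \<Longrightarrow> norm (c (Suc i) - c i) \<le> L * \<tau>"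
      and len: "\<And>i. i < N \<Longrightarrow> D (c i) (c (Suc i)) = l * \<tau>" "D (c 0) (c N) = l * T"
    have cB: "c i \<in> B" if "i \<le> N" for i using in_B[OF that] \<open>0 < \<rho>\<close> by auto
    obtain P where dP: "\<And>i e. i < N \<Longrightarrow>
        (P (Suc i) - P i) \<bullet> e = h' (c i) e (c (Suc i) - c i) (c (Suc i) - c i) / \<tau>"
      and dPn: "\<And>i. i < N \<Longrightarrow> norm (P (Suc i) - P i) \<le> KF * \<tau>"
      and Pn: "\<And>i. i \<le> N \<Longrightarrow> norm (P i) \<le> KF * T"
      by (rule discrete_momentum[of N c L \<tau>, OF cB n \<tau>(1) assms(1), folded KF_def, unfolded T])
        (assumption, assumption, rule that)
    \<comment> \<open>The momentum is determined up to a constant \<open>k\<close>. Its velocity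
      field must lead from \<open>c 0\<close> to \<open>c N\<close>; this is the linear equation
      \<open>M k = y\<close>, where \<open>y\<close> is the endpoint defect that \<open>P\<close>
      alone leaves.\<close>
    define M where "M k = (\<Sum>i<N. (\<tau> / 2) *\<^sub>R hi (c i) k)" for k
    define y where "y = c N - c 0 - (\<Sum>i<N. (\<tau> / 2) *\<^sub>R hi (c i) (P (Suc i)))"
    have "linear M" unfolding M_def
      by (intro linear_compose_sum ballI linear_compose_scale_right linear_hi cB) auto
    moreover have "(T / 2) * (lam / K\<^sup>2) * (norm k)\<^sup>2 \<le> M k \<bullet> k" for k
    proof -
      have "(T / 2) * (lam / K\<^sup>2) * (norm k)\<^sup>2 = (\<Sum>i<N. (\<tau> / 2) * (lam / K\<^sup>2 * (norm k)\<^sup>2))"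
        by (simp flip: T)
      also have "\<dots> \<le> (\<Sum>i<N. (\<tau> / 2) * (hi (c i) k \<bullet> k))"
        using \<tau> by (intro sum_mono mult_left_mono hi_coercive cB) auto
      finally show ?thesis by (simp add: M_def inner_sum_left)
    qed
    ultimately obtain k where k: "M k = y" "norm k \<le> norm y / ((T / 2) * (lam / K\<^sup>2))"
      using coercive_surj[of M] assms lam_pos K_pos by (metis divide_pos_pos mult_pos_pos zero_less_numeral zero_less_power)
    have "norm (c N - c 0) \<le> N * (L * \<tau>)"
      using norm_steps[of 0 N c] n by simp
    moreover have "norm (\<Sum>i<N. (\<tau> / 2) *\<^sub>R hi (c i) (P (Suc i))) \<le> (\<Sum>i<N. (\<tau> / 2) * (KF * T / lam))"
    proof (rule sum_norm_le)
      fix i assume "i \<in> {..<N}"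
      then have "norm (hi (c i) (P (Suc i))) \<le> KF * T / lam"
        using norm_hi[of "c i" "P (Suc i)"] cB[of i] Pn[of "Suc i"] lam_pos
        by (meson Suc_leI divide_right_mono lessThan_iff less_imp_le order_trans)
      then have "(\<tau> / 2) * norm (hi (c i) (P (Suc i))) \<le> (\<tau> / 2) * (KF * T / lam)"
        using \<tau> by (intro mult_left_mono) auto
      then show "norm ((\<tau> / 2) *\<^sub>R hi (c i) (P (Suc i))) \<le> (\<tau> / 2) * (KF * T / lam)"
        using \<tau> by simp
    qed
    ultimately have "norm y \<le> N * (L * \<tau>) + N * ((\<tau> / 2) * (KF * T / lam))"
      unfolding y_def by (intro order_trans[OF norm_triangle_ineq4]) auto
    also have "\<dots> = T * (L + KF * T / (2 * lam))" by (simp flip: T add: field_simps)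
    finally have "norm k \<le> T * (L + KF * T / (2 * lam)) / ((T / 2) * (lam / K\<^sup>2))"
      using k(2) assms lam_pos by (meson divide_right_mono less_imp_le mult_nonneg_nonneg
          divide_nonneg_nonneg order_trans zero_le_numeral zero_le_power2)
    also have "\<dots> = kb" using assms lam_pos K_pos by (simp add: kb_def field_simps)
    finally have kn: "norm k \<le> kb" .
    have Pk: "norm (P (Suc i) + k) \<le> KF * T + kb" if "i < N" for i
      using norm_triangle_ineq[of "P (Suc i)" k] Pn[of "Suc i"] kn that by simp
    \<comment> \<open>The inverse Legendre transform: \<open>w i\<close> is the velocity whose
      momentum \<open>2 * h (c i) (w i)\<close> is \<open>P (Suc i) + k\<close>.\<close>
    define w where "w i = (1/2) *\<^sub>R hi (c i) (P (Suc i) + k)" for i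
    have w: "2 * h (c i) (w i) e = (P (Suc i) + k) \<bullet> e" if "i < N" for i e
      using that by (simp add: w_def h_simps cB h_hi)
    have wW: "norm (w i) \<le> W" if "i < N" for i
    proof -
      have "norm (hi (c i) (P (Suc i) + k)) \<le> (KF * T + kb) / lam"
        using norm_hi[of "c i" "P (Suc i) + k"] Pk[OF that] cB[of i] that lam_pos
        by (meson divide_right_mono less_imp_le order_trans)
      then have "norm (hi (c i) (P (Suc i) + k)) / 2 \<le> W"
        unfolding W_def by (intro divide_right_mono) auto
      then show ?thesis by (simp add: w_def)
    qed
    have wQ: "norm (w (Suc i) - w i) \<le> Q * \<tau>" if "Suc i < N" for i
    proof -
      let ?y' = "P (Suc (Suc i)) + k" and ?y = "P (Suc i) + k"
      have "hi (c (Suc i)) ?y' - hi (c i) ?y =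
        (hi (c (Suc i)) ?y' - hi (c i) ?y') + hi (c i) (P (Suc (Suc i)) - P (Suc i))"
        using linear_diff[OF linear_hi[OF cB[of i]], of ?y' ?y] that by simp
      then have "norm (hi (c (Suc i)) ?y' - hi (c i) ?y) \<le>
        norm (hi (c (Suc i)) ?y' - hi (c i) ?y') + norm (hi (c i) (P (Suc (Suc i)) - P (Suc i)))"
        by (metis norm_triangle_ineq)
      also have "\<dots> \<le> K * norm (c (Suc i) - c i) * norm ?y' / lam\<^sup>2 + norm (P (Suc (Suc i)) - P (Suc i)) / lam"
        using that by (intro add_mono hi_lip norm_hi cB) auto
      also have "\<dots> \<le> K * (L * \<tau>) * (KF * T + kb) / lam\<^sup>2 + KF * \<tau> / lam"
        using that n[of i] Pk[OF that] dPn[OF that] K_pos \<tau> assms lam_pos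
        by (intro add_mono divide_right_mono mult_mono) auto
      also have "\<dots> = 2 * (Q * \<tau>)" by (simp add: Q_def field_simps)
      finally have "norm (hi (c (Suc i)) ?y' - hi (c i) ?y) \<le> 2 * (Q * \<tau>)" .
      then show ?thesis unfolding w_def scaleR_diff_right[symmetric] by simp
    qed
    define \<eta> where "\<eta> i = c i - c 0 - \<tau> *\<^sub>R (\<Sum>j<i. w j)" for i
    have d\<eta>: "\<eta> (Suc i) - \<eta> i = c (Suc i) - c i - \<tau> *\<^sub>R w i" for i
      by (simp add: \<eta>_def algebra_simps)
    have \<eta>0: "\<eta> 0 = 0" by (simp add: \<eta>_def)
    have \<eta>N: "\<eta> N = 0"
    proof -
      have "\<tau> *\<^sub>R (\<Sum>j<N. w j) = (\<Sum>j<N. (\<tau> / 2) *\<^sub>R hi (c j) (P (Suc j)) + (\<tau> / 2) *\<^sub>R hi (c j) k)"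
        unfolding scaleR_sum_right w_def
        by (intro sum.cong refl) (simp add: linear_add[OF linear_hi] cB scaleR_add_right)
      also have "\<dots> = (c N - c 0 - y) + M k" by (simp add: sum.distrib y_def M_def)
      finally show ?thesis using k by (simp add: \<eta>_def)
    qed
    have d\<eta>n: "norm (\<eta> (Suc i) - \<eta> i) \<le> L' * \<tau>" if "i < N" for i
    proof -
      have "norm (\<tau> *\<^sub>R w i) \<le> \<tau> * W" using wW[OF that] \<tau> by simp
      then show ?thesis unfolding d\<eta> L'_def using n[OF that]
        by (intro order_trans[OF norm_triangle_ineq4]) (simp add: algebra_simps)
    qed
    have \<eta>n: "norm (\<eta> i) \<le> \<Phi>" if "i \<le> N" for i
    proof -
      have "norm (\<eta> i) \<le> i * (L' * \<tau>)" using norm_steps[of 0 i \<eta>] d\<eta>n that \<eta>0 by simp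
      also have "\<dots> \<le> N * (L' * \<tau>)" using that nn \<tau> by (intro mult_right_mono) auto
      also have "\<dots> = \<Phi>" by (simp add: \<Phi>_def algebra_simps flip: T)
      finally show ?thesis .
    qed
    define S where "S = (\<Sum>i<N. h' (c i) (\<eta> i) (c (Suc i) - c i) (c (Suc i) - c i)
                 + 2 * h (c i) (c (Suc i) - c i) (\<eta> (Suc i) - \<eta> i))"
    have sq: "sqrt \<tau> \<le> 1" "sqrt \<tau> * \<Phi> \<le> \<rho>"
    proof -
      show "sqrt \<tau> \<le> 1" using \<tau> by (simp add: \<tau>0_def)
      have "sqrt \<tau> \<le> \<rho> / (\<Phi> + 1)"
        by (rule real_le_lsqrt) (use \<tau> nn assms in \<open>auto simp: \<tau>0_def\<close>)
      then have "sqrt \<tau> * (\<Phi> + 1) \<le> \<rho>" using nn by (simp add: field_simps)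
      then show "sqrt \<tau> * \<Phi> \<le> \<rho>" using \<tau> by (simp add: distrib_left)
         (smt (verit) real_sqrt_ge_0_iff)
    qed
    \<comment> \<open>The negative sign of \<epsilon> turns the lower bound of
      \<open>discrete_variation\<close> into an upper bound for \<open>S\<close>; its size gives the
      errors \<open>C1 * \<tau>\<close> and \<open>C2 * \<epsilon>\<^sup>2\<close> the same
      order.\<close>
    have *: "- ((C1 * \<tau> + C2 * (- sqrt \<tau>)\<^sup>2) * (N * \<tau>\<^sup>2)) \<le> - sqrt \<tau> * S"
      unfolding C1_def C2_def S_def
      by (rule discrete_variation[where \<rho> = \<rho> and l = l and c = c and \<phi> = \<eta> and \<epsilon> = "- sqrt \<tau>"])
        (use in_B n d\<eta>n \<eta>n \<eta>0 \<eta>N sq \<tau> N nn assms len T in auto)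
    have "sqrt \<tau> * S \<le> sqrt \<tau> * ((C1 + C2) * sqrt \<tau> * (N * \<tau>\<^sup>2))"
    proof -
      have "(C1 * \<tau> + C2 * (- sqrt \<tau>)\<^sup>2) * (N * \<tau>\<^sup>2) = sqrt \<tau> * ((C1 + C2) * sqrt \<tau> * (N * \<tau>\<^sup>2))"
      proof -
        define r where "r = sqrt \<tau>"
        have r: "\<tau> = r\<^sup>2" using \<tau> by (simp add: r_def)
        show ?thesis unfolding r_def[symmetric] r by (simp add: power2_eq_square algebra_simps)
      qed
      then show ?thesis using * by linarith
    qed
    then have Sle: "S \<le> (C1 + C2) * sqrt \<tau> * (N * \<tau>\<^sup>2)" using \<tau> by simp
    \<comment> \<open>The force term is rewritten with \<open>P\<close> and summed by parts; the
      constant \<open>k\<close> may be added because the increments of \<eta> sum to zero. Combining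
      the momentum with the increment of \<open>c\<close> leaves the increment of \<eta> in both
      slots of \<open>h\<close>, hence a sum of squares.\<close>
    have "S = (\<Sum>i<N. \<tau> * ((P (Suc i) - P i) \<bullet> \<eta> i)) + (\<Sum>i<N. 2 * h (c i) (c (Suc i) - c i) (\<eta> (Suc i) - \<eta> i))"
      unfolding S_def sum.distrib[symmetric] using dP \<tau> by (intro sum.cong) auto
    also have "(\<Sum>i<N. \<tau> * ((P (Suc i) - P i) \<bullet> \<eta> i)) = - \<tau> * (\<Sum>i<N. P (Suc i) \<bullet> (\<eta> (Suc i) - \<eta> i))"
      unfolding sum_distrib_left[symmetric] abel_sum by (simp add: \<eta>0 \<eta>N)
    also have "(\<Sum>i<N. P (Suc i) \<bullet> (\<eta> (Suc i) - \<eta> i)) = (\<Sum>i<N. (P (Suc i) + k) \<bullet> (\<eta> (Suc i) - \<eta> i))"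
    proof -
      have "(\<Sum>i<N. k \<bullet> (\<eta> (Suc i) - \<eta> i)) = 0"
        unfolding inner_sum_right[symmetric] sum_lessThan_telescope by (simp add: \<eta>0 \<eta>N)
      then show ?thesis by (simp add: inner_add_left sum.distrib)
    qed
    also have "- \<tau> * (\<Sum>i<N. (P (Suc i) + k) \<bullet> (\<eta> (Suc i) - \<eta> i)) +
        (\<Sum>i<N. 2 * h (c i) (c (Suc i) - c i) (\<eta> (Suc i) - \<eta> i)) =
        (\<Sum>i<N. 2 * h (c i) (\<eta> (Suc i) - \<eta> i) (\<eta> (Suc i) - \<eta> i))"
      unfolding sum_distrib_left sum.distrib[symmetric]
    proof (intro sum.cong refl)
      fix i assume "i \<in> {..<N}"
      then have i: "i < N" by simp
      show "- \<tau> * ((P (Suc i) + k) \<bullet> (\<eta> (Suc i) - \<eta> i)) + 2 * h (c i) (c (Suc i) - c i) (\<eta> (Suc i) - \<eta> i) =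
        2 * h (c i) (\<eta> (Suc i) - \<eta> i) (\<eta> (Suc i) - \<eta> i)"
      proof -
        have "h (c i) (\<eta> (Suc i) - \<eta> i) (\<eta> (Suc i) - \<eta> i) =
          h (c i) (c (Suc i) - c i) (\<eta> (Suc i) - \<eta> i) - \<tau> * h (c i) (w i) (\<eta> (Suc i) - \<eta> i)"
          using d\<eta>[of i] bilinear_lsub[OF bil[OF cB[of i]], of "c (Suc i) - c i" "\<tau> *\<^sub>R w i"]
            bilinear_lmul[OF bil[OF cB[of i]], of \<tau> "w i"] i by simp
        moreover have "\<tau> * ((P (Suc i) + k) \<bullet> (\<eta> (Suc i) - \<eta> i)) = 2 * (\<tau> * h (c i) (w i) (\<eta> (Suc i) - \<eta> i))"
          by (simp flip: w[OF i])
        ultimately show ?thesis by linarith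
      qed
    qed
    finally have "S = (\<Sum>i<N. 2 * h (c i) (\<eta> (Suc i) - \<eta> i) (\<eta> (Suc i) - \<eta> i))" .
    moreover have "\<dots> \<ge> (\<Sum>i<N. 2 * (lam * (norm (\<eta> (Suc i) - \<eta> i))\<^sup>2))"
      by (intro sum_mono mult_left_mono coercive cB) auto
    ultimately have "2 * lam * (\<Sum>i<N. (norm (\<eta> (Suc i) - \<eta> i))\<^sup>2) \<le> (C1 + C2) * sqrt \<tau> * (N * \<tau>\<^sup>2)"
      using Sle by (simp add: sum_distrib_left mult.assoc)
    then have d\<eta>2: "(\<Sum>i<N. (norm (\<eta> (Suc i) - \<eta> i))\<^sup>2) \<le> C * sqrt \<tau> * (N * \<tau>\<^sup>2)"
      using lam_pos by (simp add: C_def field_simps)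
    have \<eta>fin: "norm (\<eta> i) \<le> T * sqrt (C * sqrt \<tau>)" if "i \<le> N" for i
    proof -
      \<comment> \<open>Cauchy-Schwarz passes from the squares to the sum of the norms; its factor
        \<open>N\<close> and the factor \<open>N * \<tau>\<^sup>2\<close> combine to
        \<open>T\<^sup>2\<close>, so only the vanishing \<open>C * sqrt \<tau>\<close> remains under
        the root.\<close>
      have "norm (\<eta> i) \<le> (\<Sum>j<i. norm (\<eta> (Suc j) - \<eta> j))"
        using norm_sum[of "\<lambda>j. \<eta> (Suc j) - \<eta> j" "{..<i}"] by (simp add: sum_lessThan_telescope \<eta>0)
      also have "\<dots> \<le> (\<Sum>j<N. norm (\<eta> (Suc j) - \<eta> j))" using that by (intro sum_mono2) auto
      finally have "(norm (\<eta> i))\<^sup>2 \<le> (\<Sum>j<N. norm (\<eta> (Suc j) - \<eta> j))\<^sup>2" by (intro power_mono) auto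
      also have "\<dots> \<le> N * (\<Sum>j<N. (norm (\<eta> (Suc j) - \<eta> j))\<^sup>2)" by (rule sum_power2_le)
      also have "\<dots> \<le> N * (C * sqrt \<tau> * (N * \<tau>\<^sup>2))" using d\<eta>2 by (intro mult_left_mono) auto
      also have "\<dots> = T\<^sup>2 * (C * sqrt \<tau>)" by (simp flip: T add: power2_eq_square)
      finally have "norm (\<eta> i) \<le> sqrt (T\<^sup>2 * (C * sqrt \<tau>))" by (rule real_le_rsqrt)
      then show ?thesis using assms by (simp add: real_sqrt_mult)
    qed
    have mom: "2 * h (c (N - 1)) (w (N - 1)) e - 2 * h (c 0) (w 0) e =
           (\<Sum>j\<in>{1..<N}. h' (c j) e (c (Suc j) - c j) (c (Suc j) - c j) / \<tau>)" for e
    proof -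
      have "2 * h (c (N - 1)) (w (N - 1)) e - 2 * h (c 0) (w 0) e = (P N - P 1) \<bullet> e"
        using w[of "N - 1" e] w[of 0 e] N by (simp add: inner_simps)
      also have "P N - P 1 = (\<Sum>j\<in>{1..<N}. P (Suc j) - P j)" using N by (subst sum_Suc_diff') auto
      also have "\<dots> \<bullet> e = (\<Sum>j\<in>{1..<N}. h' (c j) e (c (Suc j) - c j) (c (Suc j) - c j) / \<tau>)"
        unfolding inner_sum_left using dP by (intro sum.cong) auto
      finally show ?thesis .
    qed
    show "\<exists>w. discrete_velocity Q W (T * sqrt (C * sqrt \<tau>)) N \<tau> c w"
      using wW wQ \<eta>fin mom unfolding \<eta>_def discrete_velocity_def by blast
  qed
qed

end

section \<open>Regularity of minimizing curves\<close>

lemma quadratic_imp_has_vector_derivative: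
  fixes f :: "real \<Rightarrow> 'e::real_normed_vector"
  assumes "\<And>v. v \<in> S \<Longrightarrow> norm (f v - f u - (v - u) *\<^sub>R w) \<le> C * (v - u)\<^sup>2" "0 \<le> C"
  shows "(f has_vector_derivative w) (at u within S)"
  unfolding has_vector_derivative_def has_derivative_within_alt
proof (intro conjI bounded_linear_scaleR_left allI impI)
  fix e :: real assume e: "0 < e"
  show "\<exists>d>0. \<forall>y\<in>S. norm (y - u) < d \<longrightarrow> norm (f y - f u - (y - u) *\<^sub>R w) \<le> e * norm (y - u)"
  proof (intro exI[of _ "e / (C + 1)"] conjI ballI impI)
    show "0 < e / (C + 1)" using e assms(2) by simp
    fix y assume y: "y \<in> S" "norm (y - u) < e / (C + 1)"
    have "C * norm (y - u) \<le> (C + 1) * norm (y - u)" by (intro mult_right_mono) auto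
    also have "\<dots> \<le> e" using y(2) assms(2) by (simp add: field_simps)
    finally have "C * norm (y - u) * norm (y - u) \<le> e * norm (y - u)" by (intro mult_right_mono) auto
    then show "norm (f y - f u - (y - u) *\<^sub>R w) \<le> e * norm (y - u)"
      using assms(1)[OF y(1)] by (simp add: power2_eq_square mult.assoc)
  qed
qed

lemma quadratic_unique:
  fixes f :: "real \<Rightarrow> 'e::real_normed_vector"
  assumes "s < t" "u \<in> {s..t}"
    and "\<And>v. v \<in> {s..t} \<Longrightarrow> norm (f v - f u - (v - u) *\<^sub>R w) \<le> C * (v - u)\<^sup>2" "0 \<le> C"
    and "\<And>v. v \<in> {s..t} \<Longrightarrow> norm (f v - f u - (v - u) *\<^sub>R w') \<le> C' * (v - u)\<^sup>2" "0 \<le> C'"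
  shows "w = w'"
  using quadratic_imp_has_vector_derivative[where S = "{s..t}", OF assms(3,4)]
    quadratic_imp_has_vector_derivative[where S = "{s..t}", OF assms(5,6)]
    vector_derivative_unique_within_closed_interval[of s t u f w w'] assms(1,2)
  by simp

context metric_ball
begin

lemma ex_riesz_functional:
  assumes "x \<in> B" "linear f"
  obtains z where "\<And>e. h x z e = f e"
proof -
  obtain z where z: "\<And>e. h x z e = (\<Sum>b\<in>Basis. f b *\<^sub>R b) \<bullet> e" using ex_riesz[OF assms(1)] by blast
  have "f e = (\<Sum>b\<in>Basis. f b *\<^sub>R b) \<bullet> e" for e
    by (simp add: linear_sum_basis[OF assms(2), of e] inner_sum_left inner_commute[of e] mult.commute)
  then show ?thesis by (intro that[of z]) (metis z)
qed

lemma h'_diff: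
  assumes "x \<in> B" "y \<in> B" "norm p \<le> V" "norm q \<le> V"
  shows "\<bar>h' y e p p - h' x e q q\<bar> \<le> K * V * (V * norm (y - x) + 2 * norm (p - q)) * norm e"
proof -
  note b = bilinear_lsub[OF bil'[OF assms(1)]] bilinear_rsub[OF bil'[OF assms(1)]]
  have V: "0 \<le> V" using assms(3) norm_ge_zero order_trans by blast
  have "h' y e p p - h' x e q q = (h' y e p p - h' x e p p) + (h' x e p (p - q) + h' x e (p - q) q)"
    by (simp add: b)
  then have "\<bar>h' y e p p - h' x e q q\<bar> \<le>
     \<bar>h' y e p p - h' x e p p\<bar> + (\<bar>h' x e p (p - q)\<bar> + \<bar>h' x e (p - q) q\<bar>)" by linarith
  also have "\<dots> \<le> K * norm (y - x) * norm e * norm p * norm p +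
      (K * norm e * norm p * norm (p - q) + K * norm e * norm (p - q) * norm q)"
    by (intro add_mono lip' bound' assms)
  also have "\<dots> \<le> K * norm (y - x) * norm e * V * V +
      (K * norm e * V * norm (p - q) + K * norm e * norm (p - q) * V)"
    using K_pos V assms by (intro add_mono mult_mono) (auto intro!: mult_nonneg_nonneg)
  also have "\<dots> = K * V * (V * norm (y - x) + 2 * norm (p - q)) * norm e" by (simp add: algebra_simps)
  finally show ?thesis .
qed

end

text \<open>\<open>c\<close> is a minimizer in coordinates, known only to be Lipschitz;
  \<open>l\<close> is its speed with respect to \<open>D\<close>, and \<rho> is the room that the
  variation needs around every point.\<close>

locale minimizing_curve = metric_ball_dist B h h' lam K D K2
  for B :: "'e::euclidean_space set" and h h' lam K D K2 +
  fixes c :: "real \<Rightarrow> 'e" and a b L \<rho> l :: real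
  assumes ab: "a < b" and L_nonneg: "0 \<le> L" and \<rho>_pos: "0 < \<rho>"
    and room: "s \<in> {a..b} \<Longrightarrow> cball (c s) \<rho> \<subseteq> B"
    and c_lip: "s \<in> {a..b} \<Longrightarrow> t \<in> {a..b} \<Longrightarrow> norm (c t - c s) \<le> L * \<bar>t - s\<bar>"
    and minimizing: "s \<in> {a..b} \<Longrightarrow> t \<in> {a..b} \<Longrightarrow> s \<le> t \<Longrightarrow> D (c s) (c t) = l * (t - s)"
begin

lemma c_B: "s \<in> {a..b} \<Longrightarrow> c s \<in> B" using room \<rho>_pos by force

definition node :: "real \<Rightarrow> real \<Rightarrow> nat \<Rightarrow> nat \<Rightarrow> real" where
  "node s t N i = s + i * ((t - s) / N)"

lemma node_bounds: "s < t \<Longrightarrow> 0 < N \<Longrightarrow> i \<le> N \<Longrightarrow> node s t N i \<in> {s..t}"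
proof -
  assume "s < t" "0 < N" "i \<le> N"
  then have "i * ((t - s) / N) \<le> N * ((t - s) / N)" by (intro mult_right_mono) auto
  also have "\<dots> = t - s" using \<open>0 < N\<close> by simp
  finally show ?thesis using \<open>s < t\<close> by (simp add: node_def)
qed

lemma node_diff: "node s t N j - node s t N i = (real j - real i) * ((t - s) / N)"
  by (simp add: node_def algebra_simps add_divide_distrib diff_divide_distrib)

text \<open>An index within 1 of the exact real index gives a node within one mesh width of
  \<open>v\<close>.\<close>

lemma node_tendsto:
  assumes st: "s < t" and r: "filterlim r at_top sequentially" "\<And>n. 0 < r n"
    and i: "\<And>n. \<bar>real (i n) - (v - s) / (t - s) * r n\<bar> \<le> 1"
  shows "(\<lambda>n. node s t (r n) (i n)) \<longlonglongrightarrow> v"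
proof -
  have "norm (node s t (r n) (i n) - v) \<le> (t - s) / r n" for n
  proof -
    have "\<bar>real (i n) - (v - s) / (t - s) * r n\<bar> * ((t - s) / r n) \<le> 1 * ((t - s) / r n)"
      using st i by (intro mult_right_mono) auto
    moreover have "node s t (r n) (i n) - v = (real (i n) - (v - s) / (t - s) * r n) * ((t - s) / r n)"
      using st r(2)[of n] by (simp add: node_def field_simps)
    ultimately show ?thesis using st by (simp add: abs_mult)
  qed
  moreover have "(\<lambda>n. (t - s) / r n) \<longlonglongrightarrow> 0"
    by (rule filterlim_compose[OF lim_const_over_n[of "t - s"] r(1)])
  ultimately have "(\<lambda>n. node s t (r n) (i n) - v) \<longlonglongrightarrow> 0"
    by (intro Lim_null_comparison[of "\<lambda>n. node s t (r n) (i n) - v" "\<lambda>n. (t - s) / r n"]) auto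
  then show ?thesis by (simp add: LIM_zero_iff)
qed

text \<open>\<open>Q\<close> and \<open>W\<close> are the same for all \<open>N\<close>:
  \<open>W\<close> gives compactness of the discrete velocities under refinement, \<open>Q\<close>
  the remainder of the expansion in the limit.\<close>

lemma mesh:
  assumes st: "a \<le> s" "s < t" "t \<le> b"
  obtains Q W M \<delta> w where "0 \<le> Q" "0 < M" "\<delta> \<longlonglongrightarrow> 0"
    "\<And>N. M \<le> N \<Longrightarrow> discrete_velocity Q W (\<delta> N) N ((t - s) / N) (\<lambda>i. c (node s t N i)) (w N)"
proof -
  have st': "0 < t - s" using st by simp
  show thesis
  proof (rule discrete_regularity[of L \<rho> "t - s" l, OF L_nonneg \<rho>_pos st'])
    fix Q W C \<tau>0 :: real
    assume "0 < \<tau>0" "0 \<le> Q"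
      and disc: "\<And>N (\<tau>::real) c. 0 < N \<Longrightarrow> 0 < \<tau> \<Longrightarrow> \<tau> \<le> \<tau>0 \<Longrightarrow> N * \<tau> = t - s \<Longrightarrow>
      (\<And>i. i \<le> N \<Longrightarrow> cball (c i) \<rho> \<subseteq> B) \<Longrightarrow> (\<And>i. i < N \<Longrightarrow> norm (c (Suc i) - c i) \<le> L * \<tau>) \<Longrightarrow>
      (\<And>i. i < N \<Longrightarrow> D (c i) (c (Suc i)) = l * \<tau>) \<Longrightarrow> D (c 0) (c N) = l * (t - s) \<Longrightarrow>
      \<exists>w. discrete_velocity Q W ((t - s) * sqrt (C * sqrt \<tau>)) N \<tau> c w"
    \<comment> \<open>The ceiling makes the mesh width at most \<open>\<tau>0\<close>;
      \<open>Suc\<close> keeps \<open>N\<close> positive.\<close>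
    define M where "M = Suc (nat \<lceil>(t - s) / \<tau>0\<rceil>)"
    define \<delta> where "\<delta> N = (t - s) * sqrt (C * sqrt ((t - s) / real N))" for N :: nat
    have step: "node s t N (Suc i) - node s t N i = (t - s) / N" for N i
      by (simp add: node_def algebra_simps add_divide_distrib diff_divide_distrib)
    have "\<exists>w. discrete_velocity Q W (\<delta> N) N ((t - s) / N) (\<lambda>i. c (node s t N i)) w"
      if "M \<le> N" for N
      unfolding \<delta>_def
    proof (rule disc)
      show N: "0 < N" using that by (simp add: M_def)
      have "(t - s) / \<tau>0 \<le> N" using that unfolding M_def by linarith
      then show "(t - s) / N \<le> \<tau>0" using N \<open>0 < \<tau>0\<close> by (simp add: field_simps)
      show "0 < (t - s) / N" "real N * ((t - s) / N) = t - s" using N st by auto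
      have nd: "node s t N i \<in> {a..b}" if "i \<le> N" for i
        using node_bounds[OF st(2) N that] st by auto
      show "cball (c (node s t N i)) \<rho> \<subseteq> B" if "i \<le> N" for i using room nd that by blast
      show "norm (c (node s t N (Suc i)) - c (node s t N i)) \<le> L * ((t - s) / N)" if "i < N" for i
        using c_lip[OF nd[of i] nd[of "Suc i"]] that st(2) unfolding step by simp
      show "D (c (node s t N i)) (c (node s t N (Suc i))) = l * ((t - s) / N)" if "i < N" for i
      proof -
        have "0 \<le> (t - s) / N" using st(2) by simp
        then have "node s t N i \<le> node s t N (Suc i)" using step[of N i] by linarith
        then show ?thesis using minimizing[OF nd[of i] nd[of "Suc i"]] that by (simp add: step)
      qed
      have "node s t N 0 = s" "node s t N N = t" using N by (auto simp: node_def)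
      then show "D (c (node s t N 0)) (c (node s t N N)) = l * (t - s)"
        using minimizing[of s t] st by simp
    qed
    then have "\<forall>N. \<exists>w. M \<le> N \<longrightarrow>
        discrete_velocity Q W (\<delta> N) N ((t - s) / N) (\<lambda>i. c (node s t N i)) w" by blast
    then have "\<exists>w. \<forall>N. M \<le> N \<longrightarrow>
        discrete_velocity Q W (\<delta> N) N ((t - s) / N) (\<lambda>i. c (node s t N i)) (w N)" by (rule choice)
    then obtain w where w: "\<And>N. M \<le> N \<Longrightarrow>
        discrete_velocity Q W (\<delta> N) N ((t - s) / N) (\<lambda>i. c (node s t N i)) (w N)" by blast
    have "\<delta> \<longlonglongrightarrow> (t - s) * sqrt (C * sqrt 0)"
      unfolding \<delta>_def by (intro tendsto_intros)
    then have "\<delta> \<longlonglongrightarrow> 0" by simp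
    moreover have "0 < M" by (simp add: M_def)
    ultimately show thesis using w that[OF \<open>0 \<le> Q\<close>, of M \<delta> W w] by blast
  qed
qed

text \<open>Since \<open>w\<close> changes by at most \<open>Q\<close> times the mesh width per
  step, its sum between two nodes is the number of steps times the velocity at node
  \<open>i\<close>, up to a quadratic error. In the limit this is a first-order expansion of
  \<open>c\<close>, so every limit of discrete velocities at nodes tending to \<open>u\<close> is
  the derivative at \<open>u\<close>.\<close>

lemma mesh_limit:
  assumes st: "a \<le> s" "s < t" "t \<le> b" and Q: "0 \<le> Q" and M: "0 < M" and \<delta>: "\<delta> \<longlonglongrightarrow> 0"
    and w: "\<And>N. M \<le> N \<Longrightarrow>
      discrete_velocity Q W (\<delta> N) N ((t - s) / N) (\<lambda>i. c (node s t N i)) (w N)"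
    and r: "strict_mono r" "\<And>n. M \<le> r n"
    and i: "\<And>n. i n < r n" and u: "(\<lambda>n. node s t (r n) (i n)) \<longlonglongrightarrow> u"
    and \<omega>: "(\<lambda>n. w (r n) (i n)) \<longlonglongrightarrow> \<omega>" and v: "v \<in> {s..t}"
  shows "norm (c v - c u - (v - u) *\<^sub>R \<omega>) \<le> Q * (v - u)\<^sup>2"
proof -
  have wQ: "norm (w N (Suc i) - w N i) \<le> Q * ((t - s) / N)" if "M \<le> N" "Suc i < N" for N i
    using w[OF that(1)] that(2) by (simp add: discrete_velocity_def)
  have wc: "norm (c (node s t N i) - c s - ((t - s) / N) *\<^sub>R (\<Sum>j<i. w N j)) \<le> \<delta> N"
    if "M \<le> N" "i \<le> N" for N i
    using w[OF that(1)] that(2) by (simp add: discrete_velocity_def node_def[of s t N 0])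
  have step: "norm (c (node s t N j) - c (node s t N i) - (node s t N j - node s t N i) *\<^sub>R w N i)
      \<le> Q * (node s t N j - node s t N i)\<^sup>2 + 2 * \<delta> N" if N: "M \<le> N" and ij: "i < N" "j \<le> N" for N i j
  proof -
    define \<tau> where "\<tau> = (t - s) / N"
    have \<tau>: "0 \<le> \<tau>" using st by (simp add: \<tau>_def)
    have wabs: "norm (w N l - w N i) \<le> \<bar>real l - real i\<bar> * (Q * \<tau>)" if "l < N" for l
      using wQ[OF N] ij that unfolding \<tau>_def by (intro norm_steps) auto
    \<comment> \<open>With the constant velocity removed, each step of \<open>Y\<close> is a
      difference of velocities, and \<open>norm_steps\<close> adds these up whichever of
      \<open>i\<close> and \<open>j\<close> is larger.\<close>
    define Y where "Y k = (\<Sum>l<k. w N l) - real k *\<^sub>R w N i" for k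
    have "norm (Y j - Y i) \<le> \<bar>real j - real i\<bar> * (\<bar>real j - real i\<bar> * (Q * \<tau>))"
    proof (rule norm_steps)
      fix l assume l: "min i j \<le> l" "l < max i j"
      have "norm (Y (Suc l) - Y l) = norm (w N l - w N i)" by (simp add: Y_def algebra_simps)
      also have "\<dots> \<le> \<bar>real l - real i\<bar> * (Q * \<tau>)" using l ij by (intro wabs) auto
      also have "\<dots> \<le> \<bar>real j - real i\<bar> * (Q * \<tau>)" using l Q \<tau> by (intro mult_right_mono) auto
      finally show "norm (Y (Suc l) - Y l) \<le> \<bar>real j - real i\<bar> * (Q * \<tau>)" .
    qed
    also have "Y j - Y i = (\<Sum>l<j. w N l) - (\<Sum>l<i. w N l) - (real j - real i) *\<^sub>R w N i"
      by (simp add: Y_def algebra_simps)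
    finally have sums: "norm ((\<Sum>l<j. w N l) - (\<Sum>l<i. w N l) - (real j - real i) *\<^sub>R w N i) \<le>
        (real j - real i)\<^sup>2 * (Q * \<tau>)"
      by (simp add: power2_eq_square mult.assoc[symmetric])
    define X where "X k = c (node s t N k) - c s - \<tau> *\<^sub>R (\<Sum>l<k. w N l)" for k
    have X: "norm (X k) \<le> \<delta> N" if "k \<le> N" for k using wc[OF N that] by (simp add: X_def \<tau>_def)
    define Z where "Z = \<tau> *\<^sub>R ((\<Sum>l<j. w N l) - (\<Sum>l<i. w N l) - (real j - real i) *\<^sub>R w N i)"
    have "norm Z = \<tau> * norm ((\<Sum>l<j. w N l) - (\<Sum>l<i. w N l) - (real j - real i) *\<^sub>R w N i)"
      using \<tau> by (simp add: Z_def)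
    also have "\<dots> \<le> \<tau> * ((real j - real i)\<^sup>2 * (Q * \<tau>))" using sums \<tau> by (rule mult_left_mono)
    finally have Z: "norm Z \<le> \<tau> * ((real j - real i)\<^sup>2 * (Q * \<tau>))" .
    have "c (node s t N j) - c (node s t N i) - (node s t N j - node s t N i) *\<^sub>R w N i = X j - X i + Z"
      unfolding node_diff X_def Z_def \<tau>_def[symmetric] by (simp add: algebra_simps)
    also have "norm \<dots> \<le> norm (X j) + norm (X i) + norm Z" by norm
    also have "\<dots> \<le> \<delta> N + \<delta> N + \<tau> * ((real j - real i)\<^sup>2 * (Q * \<tau>))"
      using X[of i] X[of j] ij Z by (intro add_mono) auto
    finally show ?thesis unfolding node_diff \<tau>_def[symmetric] by (simp add: power2_eq_square algebra_simps)
  qed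
  define j where "j n = nat \<lfloor>(v - s) / (t - s) * r n\<rfloor>" for n
  have rinf: "filterlim r at_top sequentially" using r(1) by (rule filterlim_subseq)
  have rpos: "0 < r n" for n using r(2)[of n] M by simp
  have jle: "j n \<le> r n" for n
  proof -
    have "(v - s) / (t - s) * r n \<le> 1 * real (r n)" using v st by (intro mult_right_mono) auto
    then show ?thesis unfolding j_def by linarith
  qed
  have jv: "(\<lambda>n. node s t (r n) (j n)) \<longlonglongrightarrow> v"
  proof (rule node_tendsto[OF st(2) rinf rpos])
    fix n
    have "0 \<le> (v - s) / (t - s) * r n" using v st by simp
    then show "\<bar>real (j n) - (v - s) / (t - s) * r n\<bar> \<le> 1" unfolding j_def by linarith
  qed
  have cc: "(\<lambda>n. c (x n)) \<longlonglongrightarrow> c y" if "x \<longlonglongrightarrow> y" "\<And>n. x n \<in> {s..t}" for x y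
  proof -
    have "y \<in> {s..t}" using that closed_sequentially[OF closed_real_atLeastAtMost] by blast
    then have "norm (c (x n) - c y) \<le> L * \<bar>x n - y\<bar>" for n
      using c_lip[of y "x n"] that(2)[of n] st by auto
    moreover have "(\<lambda>n. L * \<bar>x n - y\<bar>) \<longlonglongrightarrow> L * \<bar>y - y\<bar>" by (intro tendsto_intros that)
    ultimately have "(\<lambda>n. c (x n) - c y) \<longlonglongrightarrow> 0"
      by (intro Lim_null_comparison[of "\<lambda>n. c (x n) - c y" "\<lambda>n. L * \<bar>x n - y\<bar>"]) auto
    then show ?thesis by (simp add: LIM_zero_iff)
  qed
  have ni: "node s t (r n) (i n) \<in> {s..t}" and nj: "node s t (r n) (j n) \<in> {s..t}" for n
    using node_bounds[OF st(2) rpos] i[of n] jle[of n] by auto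
  have \<delta>r: "(\<lambda>n. \<delta> (r n)) \<longlonglongrightarrow> 0" using filterlim_compose[OF \<delta> rinf] by simp
  have "(\<lambda>n. norm (c (node s t (r n) (j n)) - c (node s t (r n) (i n)) -
      (node s t (r n) (j n) - node s t (r n) (i n)) *\<^sub>R w (r n) (i n))) \<longlonglongrightarrow>
      norm (c v - c u - (v - u) *\<^sub>R \<omega>)"
    by (intro tendsto_intros cc jv u ni nj \<omega>)
  moreover have "(\<lambda>n. Q * (node s t (r n) (j n) - node s t (r n) (i n))\<^sup>2 + 2 * \<delta> (r n)) \<longlonglongrightarrow> Q * (v - u)\<^sup>2 + 2 * 0"
    by (intro tendsto_intros jv u \<delta>r)
  ultimately have "norm (c v - c u - (v - u) *\<^sub>R \<omega>) \<le> Q * (v - u)\<^sup>2 + 2 * 0"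
    by (rule LIMSEQ_le) (use step r(2) i jle in blast)
  then show ?thesis by simp
qed

text \<open>Bounded discrete velocities at nodes close to \<open>u\<close> have a limit point. The
  subsequence depends on \<open>u\<close>, the constant \<open>Q\<close> does not.\<close>

lemma ex_velocity:
  obtains Q where "0 \<le> Q" "\<And>u. u \<in> {a..b} \<Longrightarrow>
    \<exists>\<omega>. \<forall>v\<in>{a..b}. norm (c v - c u - (v - u) *\<^sub>R \<omega>) \<le> Q * (v - u)\<^sup>2"
proof -
  obtain Q W M \<delta> w where Q: "0 \<le> Q" and M: "0 < M" and \<delta>: "\<delta> \<longlonglongrightarrow> 0"
    and w: "\<And>N. M \<le> N \<Longrightarrow>
      discrete_velocity Q W (\<delta> N) N ((b - a) / N) (\<lambda>i. c (node a b N i)) (w N)"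
    by (rule mesh[OF order_refl ab order_refl]) (rule that)
  have wW: "norm (w N i) \<le> W" if "M \<le> N" "i < N" for N i
    using w[OF that(1)] that(2) by (simp add: discrete_velocity_def)
  show thesis
  proof (rule that[OF Q])
    fix u assume u: "u \<in> {a..b}"
    \<comment> \<open>Velocities exist for indices below \<open>N\<close> only; the minimum matters
      at \<open>u = b\<close>, where rounding gives \<open>N\<close>.\<close>
    define i where "i N = min (N - 1) (nat \<lfloor>(u - a) / (b - a) * real N\<rfloor>)" for N
    have iN: "i N < N" if "M \<le> N" for N using that M by (auto simp: i_def)
    have "\<forall>n. w (n + M) (i (n + M)) \<in> cball 0 W" using wW iN by simp
    then obtain \<omega> r where r: "strict_mono r" "((\<lambda>n. w (n + M) (i (n + M))) \<circ> r) \<longlonglongrightarrow> \<omega>"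
      by (rule seq_compactE[OF compact_imp_seq_compact[OF compact_cball]]) (rule that)
    define r' where "r' n = r n + M" for n
    have r': "strict_mono r'" "M \<le> r' n" for n using r(1) by (auto simp: r'_def strict_mono_def)
    have rpos: "0 < r' n" for n using r'(2)[of n] M by simp
    have lim: "(\<lambda>n. node a b (r' n) (i (r' n))) \<longlonglongrightarrow> u"
    proof (rule node_tendsto[OF ab filterlim_subseq[OF r'(1)] rpos])
      fix n
      let ?x = "(u - a) / (b - a) * r' n"
      have "?x \<le> 1 * real (r' n)" using u ab by (intro mult_right_mono) auto
      moreover have "0 \<le> ?x" using u ab by simp
      ultimately show "\<bar>real (i (r' n)) - ?x\<bar> \<le> 1" using rpos[of n] unfolding i_def by linarith
    qed
    show "\<exists>\<omega>. \<forall>v\<in>{a..b}. norm (c v - c u - (v - u) *\<^sub>R \<omega>) \<le> Q * (v - u)\<^sup>2"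
    proof (intro exI ballI)
      fix v assume v: "v \<in> {a..b}"
      show "norm (c v - c u - (v - u) *\<^sub>R \<omega>) \<le> Q * (v - u)\<^sup>2"
        by (rule mesh_limit[where s = a and t = b and M = M and \<delta> = \<delta> and w = w and r = r'
            and Q = Q and W = W and u = u and \<omega> = \<omega> and i = "\<lambda>n. i (r' n)",
            OF order_refl ab order_refl Q M \<delta> w r' iN[OF r'(2)] lim _ v])
          (assumption, use r(2) in \<open>simp add: r'_def o_def\<close>)
    qed
  qed
qed


text \<open>The constant of the quadratic remainder, uniform in the base point; the Lipschitz
  constant obtained for \<open>vel\<close> is twice this number.\<close>

definition "speed_lip = (SOME Q. 0 \<le> Q \<and> (\<forall>u\<in>{a..b}. \<exists>\<omega>. \<forall>v\<in>{a..b}.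
  norm (c v - c u - (v - u) *\<^sub>R \<omega>) \<le> Q * (v - u)\<^sup>2))"

definition "vel u = (SOME \<omega>. \<forall>v\<in>{a..b}. norm (c v - c u - (v - u) *\<^sub>R \<omega>) \<le> speed_lip * (v - u)\<^sup>2)"

lemma speed_lip_nonneg: "0 \<le> speed_lip"
  and vel: "u \<in> {a..b} \<Longrightarrow> v \<in> {a..b} \<Longrightarrow>
    norm (c v - c u - (v - u) *\<^sub>R vel u) \<le> speed_lip * (v - u)\<^sup>2"
proof -
  have "\<exists>Q. 0 \<le> Q \<and> (\<forall>u\<in>{a..b}. \<exists>\<omega>. \<forall>v\<in>{a..b}. norm (c v - c u - (v - u) *\<^sub>R \<omega>) \<le> Q * (v - u)\<^sup>2)"
    using ex_velocity by metis
  from someI_ex[OF this] have *: "0 \<le> speed_lip" "\<forall>u\<in>{a..b}. \<exists>\<omega>. \<forall>v\<in>{a..b}.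
      norm (c v - c u - (v - u) *\<^sub>R \<omega>) \<le> speed_lip * (v - u)\<^sup>2"
    unfolding speed_lip_def by blast+
  show "0 \<le> speed_lip" by fact
  assume "u \<in> {a..b}" "v \<in> {a..b}"
  then show "norm (c v - c u - (v - u) *\<^sub>R vel u) \<le> speed_lip * (v - u)\<^sup>2"
    using someI_ex[OF *(2)[rule_format, of u]] unfolding vel_def by blast
qed

text \<open>Adding the expansion of \<open>c\<close> at \<open>u\<close> and that at
  \<open>v\<close> leaves only the difference of the velocities. Here it matters that one remainder
  constant serves all base points.\<close>

lemma vel_lip:
  assumes "u \<in> {a..b}" "v \<in> {a..b}"
  shows "norm (vel v - vel u) \<le> 2 * speed_lip * \<bar>v - u\<bar>"
proof (cases "u = v")
  case False
  have "(v - u) *\<^sub>R (vel v - vel u) =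
    (c v - c u - (v - u) *\<^sub>R vel u) + (c u - c v - (u - v) *\<^sub>R vel v)"
    by (simp add: algebra_simps)
  then have "\<bar>v - u\<bar> * norm (vel v - vel u) \<le> norm (c v - c u - (v - u) *\<^sub>R vel u) + norm (c u - c v - (u - v) *\<^sub>R vel v)"
    by (metis norm_scaleR norm_triangle_ineq)
  also have "\<dots> \<le> speed_lip * (v - u)\<^sup>2 + speed_lip * (u - v)\<^sup>2"
    by (intro add_mono vel assms)
  also have "\<dots> = \<bar>v - u\<bar> * (2 * speed_lip * \<bar>v - u\<bar>)" 
  proof -
    define x where "x = \<bar>v - u\<bar>"
    have "(v - u)\<^sup>2 = x\<^sup>2" "(u - v)\<^sup>2 = x\<^sup>2" by (simp_all add: x_def power2_commute)
    then show ?thesis unfolding x_def[symmetric] by (simp add: power2_eq_square)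
  qed
  finally show ?thesis using False by simp
qed simp

lemma vel_bound:
  obtains V where "0 \<le> V" "\<And>u. u \<in> {a..b} \<Longrightarrow> norm (vel u) \<le> V"
proof -
  have "norm (vel u) \<le> norm (vel a) + 2 * speed_lip * (b - a)" if "u \<in> {a..b}" for u
  proof -
    have "norm (vel u - vel a) \<le> 2 * speed_lip * \<bar>u - a\<bar>" using vel_lip[of a u] that by simp
    also have "\<dots> \<le> 2 * speed_lip * (b - a)" using that speed_lip_nonneg by (intro mult_left_mono) auto
    finally show ?thesis by norm
  qed
  moreover have "0 \<le> norm (vel a) + 2 * speed_lip * (b - a)" using speed_lip_nonneg ab by simp
  ultimately show ?thesis using that by blast
qed

text \<open>The error is quadratic in \<open>t - s\<close>, so that the momentum is differentiable: this is the
  geodesic equation in integrated form.\<close>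

lemma momentum_growth:
  obtains C where "0 \<le> C" "\<And>s t e. a \<le> s \<Longrightarrow> s < t \<Longrightarrow> t \<le> b \<Longrightarrow>
     \<bar>2 * h (c t) (vel t) e - 2 * h (c s) (vel s) e - (t - s) * h' (c s) e (vel s) (vel s)\<bar>
       \<le> C * (t - s)\<^sup>2 * norm e"
proof -
  obtain V' where V': "0 \<le> V'" "\<And>u. u \<in> {a..b} \<Longrightarrow> norm (vel u) \<le> V'" using vel_bound by blast
  define V where "V = max L V'"
  have V: "0 \<le> V" "L \<le> V" "\<And>u. u \<in> {a..b} \<Longrightarrow> norm (vel u) \<le> V"
    using V' by (auto simp: V_def le_max_iff_disj)
  \<comment> \<open>The constant of \<open>h'_diff\<close> for points at distance at most
    \<open>L * (t - s)\<close> and vectors at distance at most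
    \<open>3 * speed_lip * (t - s)\<close>; a further factor \<open>t - s\<close> comes from the
    summation.\<close>
  define C where "C = K * V * (V * L + 2 * (3 * speed_lip))"
  have C: "0 \<le> C" using K_pos V L_nonneg speed_lip_nonneg by (simp add: C_def)
  show thesis
  proof (rule that[OF C])
    fix s t e assume st: "a \<le> s" "s < t" "t \<le> b"
    \<comment> \<open>The mesh of \<open>{s..t}\<close> has constants of its own; they disappear in
      the limit, so \<open>C\<close> is uniform in \<open>s\<close> and \<open>t\<close>.\<close>
    obtain Q W M \<delta> w where Q: "0 \<le> Q" and M: "0 < M" and \<delta>: "\<delta> \<longlonglongrightarrow> 0"
      and w: "\<And>N. M \<le> N \<Longrightarrow>
        discrete_velocity Q W (\<delta> N) N ((t - s) / N) (\<lambda>i. c (node s t N i)) (w N)"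
      by (rule mesh[OF st]) (rule that)
    have wW: "norm (w N i) \<le> W" if "M \<le> N" "i < N" for N i
      using w[OF that(1)] that(2) by (simp add: discrete_velocity_def)
    have mom: "2 * h (c (node s t N (N - 1))) (w N (N - 1)) e - 2 * h (c s) (w N 0) e =
         (\<Sum>j\<in>{1..<N}. h' (c (node s t N j)) e (c (node s t N (Suc j)) - c (node s t N j))
            (c (node s t N (Suc j)) - c (node s t N j)) / ((t - s) / N))" if "M \<le> N" for N
      using w[OF that] by (simp add: discrete_velocity_def node_def[of s t N 0])
    have "\<forall>n. (w (n + M) 0, w (n + M) (n + M - 1)) \<in> cball 0 W \<times> cball 0 W"
      using wW M by auto
    then obtain \<omega> r where r: "strict_mono r" "((\<lambda>n. (w (n + M) 0, w (n + M) (n + M - 1))) \<circ> r) \<longlonglongrightarrow> \<omega>"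
      by (rule seq_compactE[OF compact_imp_seq_compact[OF compact_Times[OF compact_cball compact_cball]]])
        (rule that)
    define r' where "r' n = r n + M" for n
    have r': "strict_mono r'" "\<And>n. M \<le> r' n" using r(1) by (auto simp: r'_def strict_mono_def)
    have rpos: "0 < r' n" for n using r'(2)[of n] M by simp
    have rinf: "filterlim r' at_top sequentially" by (rule filterlim_subseq) (rule r')
    have \<omega>0: "(\<lambda>n. w (r' n) 0) \<longlonglongrightarrow> fst \<omega>" and \<omega>1: "(\<lambda>n. w (r' n) (r' n - 1)) \<longlonglongrightarrow> snd \<omega>"
      using tendsto_fst[OF r(2)] tendsto_snd[OF r(2)] by (simp_all add: o_def r'_def)
    have \<tau>0: "(\<lambda>n. (t - s) / r' n) \<longlonglongrightarrow> 0"
      by (rule filterlim_compose[OF lim_const_over_n[of "t - s"] rinf])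
    have last: "node s t (r' n) (r' n - 1) = t - (t - s) / r' n" for n
      using rpos[of n] by (simp add: node_def of_nat_diff Suc_le_eq field_simps)
    have nt: "(\<lambda>n. node s t (r' n) (r' n - 1)) \<longlonglongrightarrow> t"
      unfolding last using tendsto_diff[OF tendsto_const[of t] \<tau>0] by simp
    have ns: "(\<lambda>n. node s t (r' n) 0) \<longlonglongrightarrow> s" by (simp add: node_def)
    have lt: "r' n - 1 < r' n" for n using rpos[of n] by simp
    have 0: "norm (c v - c s - (v - s) *\<^sub>R fst \<omega>) \<le> Q * (v - s)\<^sup>2" if "v \<in> {s..t}" for v
      by (rule mesh_limit[where s = s and t = t and M = M and \<delta> = \<delta> and w = w and r = r'
            and Q = Q and W = W and u = s and \<omega> = "fst \<omega>" and i = "\<lambda>n. 0",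
            OF st Q M \<delta> w r' rpos ns \<omega>0 that])
    have 1: "norm (c v - c t - (v - t) *\<^sub>R snd \<omega>) \<le> Q * (v - t)\<^sup>2" if "v \<in> {s..t}" for v
      by (rule mesh_limit[where s = s and t = t and M = M and \<delta> = \<delta> and w = w and r = r'
            and Q = Q and W = W and u = t and \<omega> = "snd \<omega>" and i = "\<lambda>n. r' n - 1",
            OF st Q M \<delta> w r' lt nt \<omega>1 that])
    \<comment> \<open>The limits of the first and the last discrete velocity have quadratic
      remainders on \<open>{s..t}\<close>, which identifies them with the one-sided derivatives at
      the ends.\<close>
    have fst: "fst \<omega> = vel s"
      by (rule quadratic_unique[OF st(2) _ 0 Q vel speed_lip_nonneg]) (use st in auto)
    have snd: "snd \<omega> = vel t"
      by (rule quadratic_unique[OF st(2) _ 1 Q vel speed_lip_nonneg]) (use st in auto)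
    define X where "X = h' (c s) e (vel s) (vel s)"
    \<comment> \<open>The force at node 0 is absent, so there are \<open>N - 1\<close> summands;
      their total weight, \<open>N - 1\<close> mesh widths, tends to \<open>t - s\<close>.\<close>
    have sumX: "\<bar>2 * h (c (node s t N (N - 1))) (w N (N - 1)) e - 2 * h (c s) (w N 0) e
        - (real N - 1) * ((t - s) / N) * X\<bar> \<le> C * (t - s)\<^sup>2 * norm e" if N: "M \<le> N" for N
    proof -
      define \<tau> where "\<tau> = (t - s) / N"
      have N0: "0 < N" using N M by simp
      have \<tau>: "0 < \<tau>" using st N0 by (simp add: \<tau>_def)
      have summand: "\<bar>h' (c (node s t N j)) e (c (node s t N (Suc j)) - c (node s t N j))
            (c (node s t N (Suc j)) - c (node s t N j)) / \<tau> - \<tau> * X\<bar> \<le> \<tau> * (C * (t - s) * norm e)"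
        if j: "j < N" for j
      proof -
        define x where "x = node s t N j"
        define y where "y = node s t N (Suc j)"
        have xy: "x \<in> {s..t}" "y \<in> {s..t}" using node_bounds[OF st(2) N0] j by (auto simp: x_def y_def)
        then have xy': "x \<in> {a..b}" "y \<in> {a..b}" "s \<in> {a..b}" using st by auto
        have yx: "y - x = \<tau>" unfolding x_def y_def node_diff \<tau>_def by simp
        \<comment> \<open>The difference quotient \<open>p\<close> is within
          \<open>speed_lip * \<tau>\<close> of \<open>vel x\<close>, and \<open>vel x\<close> within
          \<open>2 * speed_lip * (t - s)\<close> of \<open>vel s\<close>: together the factor
          3.\<close>
        define p where "p = (1 / \<tau>) *\<^sub>R (c y - c x)"
        have cp: "c y - c x = \<tau> *\<^sub>R p" using \<tau> by (simp add: p_def)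
        have "norm (c y - c x) \<le> L * \<tau>" using c_lip[OF xy'(1,2)] yx \<tau> by simp
        then have "norm p \<le> L" using \<tau> by (simp add: cp mult.commute)
        then have pV: "norm p \<le> V" using V by simp
        have "\<tau> * norm (p - vel x) = norm (\<tau> *\<^sub>R (p - vel x))" using \<tau> by simp
        also have "\<tau> *\<^sub>R (p - vel x) = c y - c x - (y - x) *\<^sub>R vel x" by (simp add: cp yx scaleR_diff_right)
        also have "norm \<dots> \<le> speed_lip * (y - x)\<^sup>2" by (rule vel[OF xy'(1,2)])
        also have "\<dots> = \<tau> * (speed_lip * \<tau>)" by (simp add: yx power2_eq_square)
        finally have "norm (p - vel x) \<le> speed_lip * \<tau>" using \<tau> by simp
        also have "\<dots> \<le> speed_lip * (t - s)"
          using yx xy speed_lip_nonneg by (intro mult_left_mono) auto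
        finally have 1: "norm (p - vel x) \<le> speed_lip * (t - s)" .
        have "norm (vel x - vel s) \<le> 2 * speed_lip * \<bar>x - s\<bar>" by (rule vel_lip[OF xy'(3,1)])
        also have "\<dots> \<le> 2 * speed_lip * (t - s)"
          using xy speed_lip_nonneg by (intro mult_left_mono) auto
        finally have "norm (vel x - vel s) \<le> 2 * speed_lip * (t - s)" .
        from norm_diff_triangle_le[OF 1 this]
        have pv: "norm (p - vel s) \<le> 3 * speed_lip * (t - s)" by (simp add: algebra_simps)
        have "norm (c x - c s) \<le> L * \<bar>x - s\<bar>" by (rule c_lip[OF xy'(3,1)])
        also have "\<dots> \<le> L * (t - s)" using xy L_nonneg by (intro mult_left_mono) auto
        finally have cx: "norm (c x - c s) \<le> L * (t - s)" .
        have "\<bar>h' (c x) e p p - X\<bar> \<le> K * V * (V * norm (c x - c s) + 2 * norm (p - vel s)) * norm e"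
          unfolding X_def using xy' pV V by (intro h'_diff c_B) auto
        also have "\<dots> \<le> K * V * (V * (L * (t - s)) + 2 * (3 * speed_lip * (t - s))) * norm e"
          using cx pv V K_pos by (intro mult_right_mono mult_left_mono add_mono) auto
        also have "\<dots> = C * (t - s) * norm e" by (simp add: C_def algebra_simps)
        finally have "\<tau> * \<bar>h' (c x) e p p - X\<bar> \<le> \<tau> * (C * (t - s) * norm e)"
          using \<tau> by (intro mult_left_mono) auto
        moreover have "h' (c x) e (c y - c x) (c y - c x) / \<tau> - \<tau> * X = \<tau> * (h' (c x) e p p - X)"
          using \<tau> xy' unfolding cp
          by (simp add: bilinear_lmul[OF bil'[OF c_B]] bilinear_rmul[OF bil'[OF c_B]] right_diff_distrib)
        ultimately show ?thesis using \<tau> by (simp add: abs_mult x_def y_def)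
      qed
      have "2 * h (c (node s t N (N - 1))) (w N (N - 1)) e - 2 * h (c s) (w N 0) e - (real N - 1) * \<tau> * X =
         (\<Sum>j\<in>{1..<N}. h' (c (node s t N j)) e (c (node s t N (Suc j)) - c (node s t N j))
            (c (node s t N (Suc j)) - c (node s t N j)) / \<tau> - \<tau> * X)"
        unfolding mom[OF N] \<tau>_def[symmetric] using N0 by (simp add: sum_subtractf of_nat_diff)
      also have "\<bar>\<dots>\<bar> \<le> (\<Sum>j\<in>{1..<N}. \<tau> * (C * (t - s) * norm e))"
        by (rule order_trans[OF sum_abs sum_mono]) (use summand in auto)
      also have "\<dots> = (real N - 1) * \<tau> * (C * (t - s) * norm e)" using N0 by (simp add: of_nat_diff)
      also have "\<dots> \<le> (t - s) * (C * (t - s) * norm e)"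
      proof (rule mult_right_mono)
        have "(real N - 1) * \<tau> \<le> real N * \<tau>" using \<tau> by simp
        also have "\<dots> = t - s" using N0 by (simp add: \<tau>_def)
        finally show "(real N - 1) * \<tau> \<le> t - s" .
      qed (use C st in simp)
      finally show ?thesis unfolding \<tau>_def by (simp add: power2_eq_square algebra_simps)
    qed
    have hlim: "(\<lambda>n. h (x n) (y n) e) \<longlonglongrightarrow> h x0 y0 e"
      if "x \<longlonglongrightarrow> x0" "y \<longlonglongrightarrow> y0" "\<And>n. x n \<in> B" "x0 \<in> B" for x :: "nat \<Rightarrow> 'e" and y x0 y0
    proof -
      have "norm (h (x n) (y n) e - h x0 y0 e) \<le>
          K * norm (x n - x0) * norm (y n) * norm e + K * norm (y n - y0) * norm e" for n
        using lip[OF that(4) that(3)[of n], of "y n" e] bound[OF that(4), of "y n - y0" e]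
        by (simp add: h_simps that(4))
      moreover have "(\<lambda>n. K * norm (x n - x0) * norm (y n) * norm e + K * norm (y n - y0) * norm e)
         \<longlonglongrightarrow> K * norm (x0 - x0) * norm y0 * norm e + K * norm (y0 - y0) * norm e"
        by (intro tendsto_intros that)
      ultimately have "(\<lambda>n. h (x n) (y n) e - h x0 y0 e) \<longlonglongrightarrow> 0"
        by (intro Lim_null_comparison[of "\<lambda>n. h (x n) (y n) e - h x0 y0 e"
           "\<lambda>n. K * norm (x n - x0) * norm (y n) * norm e + K * norm (y n - y0) * norm e"]) auto
      then show ?thesis by (simp add: LIM_zero_iff)
    qed
    have nodes: "node s t (r' n) (r' n - 1) \<in> {a..b}" for n
      using node_bounds[OF st(2) rpos, of "r' n - 1" n] st by auto
    have "(\<lambda>n. c (node s t (r' n) (r' n - 1)) - c t) \<longlonglongrightarrow> 0"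
    proof (rule Lim_null_comparison)
      show "\<forall>\<^sub>F n in sequentially. norm (c (node s t (r' n) (r' n - 1)) - c t) \<le> L * \<bar>node s t (r' n) (r' n - 1) - t\<bar>"
        using c_lip[OF _ nodes, of t] st by simp
      have "(\<lambda>n. L * \<bar>node s t (r' n) (r' n - 1) - t\<bar>) \<longlonglongrightarrow> L * \<bar>t - t\<bar>" by (intro tendsto_intros nt)
      then show "(\<lambda>n. L * \<bar>node s t (r' n) (r' n - 1) - t\<bar>) \<longlonglongrightarrow> 0" by simp
    qed
    then have ct: "(\<lambda>n. c (node s t (r' n) (r' n - 1))) \<longlonglongrightarrow> c t" by (simp add: LIM_zero_iff)
    have "(\<lambda>n. (real (r' n) - 1) * ((t - s) / r' n)) \<longlonglongrightarrow> t - s"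
    proof -
      have "(real (r' n) - 1) * ((t - s) / r' n) = (t - s) - (t - s) / r' n" for n
        using rpos[of n] by (simp add: field_simps)
      then show ?thesis using tendsto_diff[OF tendsto_const[of "t - s"] \<tau>0] by simp
    qed
    then have "(\<lambda>n. \<bar>2 * h (c (node s t (r' n) (r' n - 1))) (w (r' n) (r' n - 1)) e - 2 * h (c s) (w (r' n) 0) e
        - (real (r' n) - 1) * ((t - s) / r' n) * X\<bar>) \<longlonglongrightarrow> \<bar>2 * h (c t) (snd \<omega>) e - 2 * h (c s) (fst \<omega>) e - (t - s) * X\<bar>"
      by (intro tendsto_intros hlim \<omega>0 \<omega>1 ct tendsto_const) (use c_B nodes st in auto)
    then have "\<bar>2 * h (c t) (snd \<omega>) e - 2 * h (c s) (fst \<omega>) e - (t - s) * X\<bar> \<le> C * (t - s)\<^sup>2 * norm e"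
      by (rule LIMSEQ_le_const2) (use sumX r' in blast)
    then show "\<bar>2 * h (c t) (vel t) e - 2 * h (c s) (vel s) e - (t - s) * h' (c s) e (vel s) (vel s)\<bar>
       \<le> C * (t - s)\<^sup>2 * norm e"
      unfolding fst snd X_def .
  qed
qed

text \<open>The momentum \<open>2 * h (c u) (vel u)\<close> is differentiable by
  \<open>momentum_growth\<close>; expanding \<open>h\<close> along \<open>c\<close> separates off
  the derivative of the metric, and coercivity transfers differentiability to \<open>vel\<close>.
  The last equation is minus the Koszul formula with both arguments equal to the velocity.\<close>

theorem geodesic_equation:
  obtains vel acc where
    "\<And>u. u \<in> {a..b} \<Longrightarrow> (c has_vector_derivative vel u) (at u within {a..b})"
    "\<And>u. u \<in> {a..b} \<Longrightarrow> (vel has_vector_derivative acc u) (at u within {a..b})"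
    "\<And>u e. u \<in> {a..b} \<Longrightarrow>
       h (c u) (acc u) e = h' (c u) e (vel u) (vel u) / 2 - h' (c u) (vel u) (vel u) e"
proof -
  obtain V where V: "0 \<le> V" "\<And>u. u \<in> {a..b} \<Longrightarrow> norm (vel u) \<le> V" using vel_bound by blast
  obtain C where C: "0 \<le> C" "\<And>s t e. a \<le> s \<Longrightarrow> s < t \<Longrightarrow> t \<le> b \<Longrightarrow>
     \<bar>2 * h (c t) (vel t) e - 2 * h (c s) (vel s) e - (t - s) * h' (c s) e (vel s) (vel s)\<bar>
       \<le> C * (t - s)\<^sup>2 * norm e" by (rule momentum_growth) (rule that)
  \<comment> \<open>For \<open>v < u\<close> the growth estimate has its force at \<open>v\<close>;
    \<open>C'\<close> is the cost of moving it to \<open>u\<close>.\<close>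
  define C' where "C' = K * V * (V * L + 2 * (2 * speed_lip))"
  have C': "0 \<le> C'" using K_pos V L_nonneg speed_lip_nonneg by (simp add: C'_def)
  have mom: "\<bar>2 * h (c v) (vel v) e - 2 * h (c u) (vel u) e - (v - u) * h' (c u) e (vel u) (vel u)\<bar>
       \<le> (C + C') * (v - u)\<^sup>2 * norm e" if uv: "u \<in> {a..b}" "v \<in> {a..b}" for u v e
  proof (cases u v rule: linorder_cases)
    case less
    have "C * (v - u)\<^sup>2 * norm e \<le> (C + C') * (v - u)\<^sup>2 * norm e"
      using C' by (intro mult_right_mono) auto
    moreover have "\<bar>2 * h (c v) (vel v) e - 2 * h (c u) (vel u) e - (v - u) * h' (c u) e (vel u) (vel u)\<bar>
       \<le> C * (v - u)\<^sup>2 * norm e" using C(2)[of u v e] less uv by simp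
    ultimately show ?thesis by linarith
  next
    case greater
    define d where "d = h' (c v) e (vel v) (vel v) - h' (c u) e (vel u) (vel u)"
    have "\<bar>d\<bar> \<le> K * V * (V * norm (c v - c u) + 2 * norm (vel v - vel u)) * norm e"
      unfolding d_def using uv V by (intro h'_diff c_B) auto
    also have "\<dots> \<le> K * V * (V * (L * \<bar>v - u\<bar>) + 2 * (2 * speed_lip * \<bar>v - u\<bar>)) * norm e"
      using V K_pos uv by (intro mult_right_mono mult_left_mono add_mono c_lip vel_lip) auto
    also have "\<dots> = C' * \<bar>v - u\<bar> * norm e" by (simp add: C'_def algebra_simps)
    finally have "\<bar>v - u\<bar> * \<bar>d\<bar> \<le> \<bar>v - u\<bar> * (C' * \<bar>v - u\<bar> * norm e)" by (intro mult_left_mono) auto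
    then have "\<bar>(v - u) * d\<bar> \<le> C' * (v - u)\<^sup>2 * norm e"
      by (simp add: abs_mult power2_eq_square algebra_simps flip: abs_mult)
    moreover have "2 * h (c v) (vel v) e - 2 * h (c u) (vel u) e - (v - u) * h' (c u) e (vel u) (vel u) =
      - (2 * h (c u) (vel u) e - 2 * h (c v) (vel v) e - (u - v) * h' (c v) e (vel v) (vel v)) + (v - u) * d"
      by (simp add: d_def algebra_simps)
    moreover have "\<bar>2 * h (c u) (vel u) e - 2 * h (c v) (vel v) e - (u - v) * h' (c v) e (vel v) (vel v)\<bar>
       \<le> C * (v - u)\<^sup>2 * norm e"
      using C(2)[of v u e] greater uv by (simp add: power2_commute)
    ultimately show ?thesis unfolding distrib_right by linarith
  qed simp
  \<comment> \<open>The right side is linear in \<open>e\<close>, so a vector represents it: the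
    candidate for the acceleration.\<close>
  have "\<exists>z. \<forall>e. h (c u) z e = h' (c u) e (vel u) (vel u) / 2 - h' (c u) (vel u) (vel u) e"
    if "u \<in> {a..b}" for u
  proof -
    have uB: "c u \<in> B" by (rule c_B[OF that])
    have "linear (\<lambda>e. h' (c u) (vel u) (vel u) e)" using bil'[OF uB] by (simp add: bilinear_def)
    then have "linear (\<lambda>e. (1 / 2) *\<^sub>R h' (c u) e (vel u) (vel u) - h' (c u) (vel u) (vel u) e)"
      by (intro linear_compose_sub linear_compose_scale_right lin' uB)
    then obtain z where "\<And>e. h (c u) z e = (1 / 2) *\<^sub>R h' (c u) e (vel u) (vel u) - h' (c u) (vel u) (vel u) e"
      by (rule ex_riesz_functional[OF uB]) (rule that)
    then show ?thesis by auto
  qed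
  then obtain acc where acc: "\<And>u e. u \<in> {a..b} \<Longrightarrow>
      h (c u) (acc u) e = h' (c u) e (vel u) (vel u) / 2 - h' (c u) (vel u) (vel u) e" by metis
  define C3 where "C3 = (C + C') / 2 + (K * L\<^sup>2 * V + K * speed_lip * V + K * V * (2 * speed_lip))"
  have C3: "0 \<le> C3" using C C' K_pos V speed_lip_nonneg by (simp add: C3_def)
  have acc2: "norm (vel v - vel u - (v - u) *\<^sub>R acc u) \<le> C3 / lam * (v - u)\<^sup>2"
    if uv: "u \<in> {a..b}" "v \<in> {a..b}" for u v
  proof -
    define d where "d = (v - u)\<^sup>2"
    have uB: "c u \<in> B" and vB: "c v \<in> B" using c_B uv by auto
    note b' = bilinear_radd[OF bil'[OF uB]] bilinear_rsub[OF bil'[OF uB]] bilinear_lsub[OF bil'[OF uB]]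
    have "norm (vel v - vel u - (v - u) *\<^sub>R acc u) \<le> (C3 * d) / lam"
    proof (rule norm_leI[OF uB])
      fix e
      \<comment> \<open>\<open>A1\<close> is the Taylor remainder of the metric, \<open>A2\<close>
        replaces the increment of \<open>c\<close> by \<open>(v - u) *\<^sub>R vel u\<close>, and
        \<open>A3\<close> replaces \<open>vel v\<close> by \<open>vel u\<close>. Together they are
        the error in replacing the change of the metric by its derivative along
        \<open>vel u\<close>.\<close>
      define A1 where "A1 = h (c v) (vel v) e - h (c u) (vel v) e - h' (c u) (c v - c u) (vel v) e"
      define A2 where "A2 = h' (c u) (c v - c u - (v - u) *\<^sub>R vel u) (vel v) e"
      define A3 where "A3 = (v - u) * h' (c u) (vel u) (vel v - vel u) e"
      have A1: "\<bar>A1\<bar> \<le> K * L\<^sup>2 * V * d * norm e"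
      proof -
        have "\<bar>A1\<bar> \<le> K * (norm (c v - c u))\<^sup>2 * norm (vel v) * norm e"
          unfolding A1_def by (rule taylor[OF uB vB])
        also have "\<dots> \<le> K * (L * \<bar>v - u\<bar>)\<^sup>2 * V * norm e"
          using K_pos V uv c_lip by (intro mult_right_mono mult_mono mult_left_mono power_mono) auto
        finally show ?thesis by (simp add: d_def power_mult_distrib algebra_simps)
      qed
      have A2: "\<bar>A2\<bar> \<le> K * speed_lip * V * d * norm e"
      proof -
        have "\<bar>A2\<bar> \<le> K * norm (c v - c u - (v - u) *\<^sub>R vel u) * norm (vel v) * norm e"
          unfolding A2_def by (rule bound'[OF uB])
        also have "\<dots> \<le> K * (speed_lip * d) * V * norm e"
          unfolding d_def using K_pos V uv vel speed_lip_nonneg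
          by (intro mult_right_mono mult_mono mult_left_mono) auto
        finally show ?thesis by (simp add: mult.commute mult.left_commute)
      qed
      have A3: "\<bar>A3\<bar> \<le> K * V * (2 * speed_lip) * d * norm e"
      proof -
        have "\<bar>A3\<bar> \<le> \<bar>v - u\<bar> * (K * norm (vel u) * norm (vel v - vel u) * norm e)"
          unfolding A3_def abs_mult by (intro mult_left_mono bound'[OF uB]) auto
        also have "\<dots> \<le> \<bar>v - u\<bar> * (K * V * (2 * speed_lip * \<bar>v - u\<bar>) * norm e)"
          using K_pos V uv vel_lip by (intro mult_right_mono mult_mono mult_left_mono) auto
        also have "\<dots> = K * V * (2 * speed_lip) * (\<bar>v - u\<bar> * \<bar>v - u\<bar>) * norm e" by (simp only: ac_simps)
        finally show ?thesis by (simp add: d_def power2_eq_square)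
      qed
      have e1: "A1 + A2 + A3 = h (c v) (vel v) e - h (c u) (vel v) e - (v - u) * h' (c u) (vel u) (vel u) e"
        unfolding A1_def A2_def A3_def
        using linear_diff[OF lin'[OF uB, of "vel v" e], of "c v - c u" "(v - u) *\<^sub>R vel u"]
          linear_cmul[OF lin'[OF uB, of "vel v" e], of "v - u" "vel u"]
        by (simp add: b' right_diff_distrib)
      have e2: "h (c u) (vel v - vel u - (v - u) *\<^sub>R acc u) e =
        (2 * h (c v) (vel v) e - 2 * h (c u) (vel u) e - (v - u) * h' (c u) e (vel u) (vel u)) / 2
        - (A1 + A2 + A3)"
      proof -
        have "h (c u) (vel v - vel u - (v - u) *\<^sub>R acc u) e = h (c u) (vel v) e - h (c u) (vel u) e -
           (v - u) * (h' (c u) e (vel u) (vel u) / 2 - h' (c u) (vel u) (vel u) e)"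
          using uB by (simp add: h_simps acc[OF uv(1)])
        then show ?thesis unfolding e1 by (simp add: algebra_simps diff_divide_distrib add_divide_distrib)
      qed
      define R where "R = 2 * h (c v) (vel v) e - 2 * h (c u) (vel u) e - (v - u) * h' (c u) e (vel u) (vel u)"
      have R: "\<bar>R\<bar> \<le> (C + C') * d * norm e" using mom[OF uv, of e] unfolding d_def R_def .
      have "h (c u) (vel v - vel u - (v - u) *\<^sub>R acc u) e \<le>
        (C + C') * d * norm e / 2 + (K * L\<^sup>2 * V * d * norm e + K * speed_lip * V * d * norm e
          + K * V * (2 * speed_lip) * d * norm e)"
        unfolding e2 R_def[symmetric]
        using abs_le_D2[OF A1] abs_le_D2[OF A2] abs_le_D2[OF A3] abs_le_D1[OF R] by linarith
      also have "\<dots> = C3 * d * norm e" by (simp add: C3_def algebra_simps add_divide_distrib)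
      finally show "h (c u) (vel v - vel u - (v - u) *\<^sub>R acc u) e \<le> C3 * d * norm e" .
    qed (use C3 in \<open>simp add: d_def\<close>)
    then show ?thesis by (simp add: d_def)
  qed
  show thesis
  proof (rule that[of vel acc])
    fix u assume u: "u \<in> {a..b}"
    show "(c has_vector_derivative vel u) (at u within {a..b})"
      by (rule quadratic_imp_has_vector_derivative[OF vel[OF u] speed_lip_nonneg])
    show "(vel has_vector_derivative acc u) (at u within {a..b})"
      by (rule quadratic_imp_has_vector_derivative[OF acc2[OF u]]) (use C3 lam_pos in auto)
  qed (rule acc)
qed

end

section \<open>Minimizing curves in proper length spaces\<close>

text \<open>Hopf--Rinow in the form of Cohn-Vossen: the supremum of the radii of compact balls around a
  point cannot be finite.\<close>

lemma (in Metric_space) length_space_proper: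
  assumes comp: mcomplete
    and lc: "\<And>x. x \<in> M \<Longrightarrow> \<exists>r>0. compactin mtopology (mcball x r)"
    and len: "\<And>x y r s. x \<in> M \<Longrightarrow> y \<in> M \<Longrightarrow> 0 < r \<Longrightarrow> 0 < s \<Longrightarrow> d x y < r + s \<Longrightarrow>
      \<exists>z\<in>M. d x z \<le> r \<and> d z y < s"
    and x: "x \<in> M"
  shows "compactin mtopology (mcball x R)"
proof (rule ccontr)
  assume R: "\<not> compactin mtopology (mcball x R)"
  define I where "I = {r. compactin mtopology (mcball x r)}"
  have down: "r' \<in> I" if "r \<in> I" "r' \<le> r" for r r'
  proof -
    have "mcball x r' \<subseteq> mcball x r" using that by auto
    then show ?thesis using that unfolding I_def by (metis closed_compactin closedin_mcball mem_Collect_eq)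
  qed
  have bdd: "bdd_above I" using down R by (intro bdd_aboveI[of _ R]) (metis I_def linear mem_Collect_eq)
  obtain r0 where r0: "0 < r0" "r0 \<in> I" using lc[OF x] by (auto simp: I_def)
  define S where "S = Sup I"
  have S: "0 < S" using cSup_upper[OF r0(2) bdd] r0(1) by (simp add: S_def)
  have less: "r \<in> I" if "r < S" for r
  proof -
    have "I \<noteq> {}" using r0 by blast
    then have "\<exists>r'\<in>I. r < r'" using that unfolding S_def by (rule less_cSupD)
    then obtain r' where "r' \<in> I" "r < r'" ..
    then show ?thesis using down[of r' r] by simp
  qed
  \<comment> \<open>The ball at the supremum itself is compact: by the length property its points
    are within \<open>e\<close> of a slightly smaller compact ball, and completeness turns total
    boundedness into compactness.\<close>
  have "mtotally_bounded (mcball x S)" unfolding mtotally_bounded_def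
  proof (intro allI impI)
    fix \<epsilon> :: real assume \<epsilon>: "0 < \<epsilon>"
    define e where "e = min (\<epsilon> / 2) (S / 2)"
    have e: "0 < e" "e \<le> \<epsilon> / 2" "e < S" using \<epsilon> S by (auto simp: e_def)
    have "mtotally_bounded (mcball x (S - e / 2))"
      using less[of "S - e / 2"] e compactin_imp_mtotally_bounded by (simp add: I_def)
    then obtain K where K: "finite K" "K \<subseteq> mcball x (S - e / 2)" "mcball x (S - e / 2) \<subseteq> (\<Union>k\<in>K. mball k e)"
      unfolding mtotally_bounded_def using e(1) by meson
    have "mcball x S \<subseteq> (\<Union>k\<in>K. mball k \<epsilon>)"
    proof
      fix y assume "y \<in> mcball x S"
      then have y: "y \<in> M" "d x y \<le> S" by auto
      then obtain z where z: "z \<in> M" "d x z \<le> S - e / 2" "d z y < e"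
        using len[of x y "S - e / 2" e] x e by auto
      then obtain k where k: "k \<in> K" "z \<in> mball k e" using K(3) x by auto
      have "d k y \<le> d k z + d z y" using k y z by (intro triangle) auto
      then have "d k y < \<epsilon>" using k z e by auto
      then show "y \<in> (\<Union>k\<in>K. mball k \<epsilon>)" using k y by auto
    qed
    moreover have "K \<subseteq> mcball x S" using K(2) e by force
    ultimately show "\<exists>K. finite K \<and> K \<subseteq> mcball x S \<and> mcball x S \<subseteq> (\<Union>x\<in>K. mball x \<epsilon>)"
      using K(1) by blast
  qed
  then have "compactin mtopology (mtopology closure_of (mcball x S))"
    using mtotally_bounded_eq_compact_closure_of[OF comp] by blast
  then have SI: "compactin mtopology (mcball x S)" by (simp add: closure_of_closedin)
  define \<rho> where "\<rho> y = (SOME r. 0 < r \<and> compactin mtopology (mcball y r))" for y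
  have \<rho>: "0 < \<rho> y" "compactin mtopology (mcball y (\<rho> y))" if "y \<in> M" for y
    using someI_ex[OF lc[OF that, unfolded]] unfolding \<rho>_def by auto
  have "mcball x S \<subseteq> \<Union> ((\<lambda>y. mball y (\<rho> y / 2)) ` mcball x S)"
    using \<rho>(1) by auto
  then obtain F where F: "finite F" "F \<subseteq> (\<lambda>y. mball y (\<rho> y / 2)) ` mcball x S" "mcball x S \<subseteq> \<Union>F"
    using SI[unfolded compactin_def, THEN conjunct2, rule_format,
        of "(\<lambda>y. mball y (\<rho> y / 2)) ` mcball x S"] by auto
  then obtain Y where Y: "finite Y" "Y \<subseteq> mcball x S" "mcball x S \<subseteq> (\<Union>y\<in>Y. mball y (\<rho> y / 2))"
    by (metis (no_types, lifting) finite_subset_image)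
  have YM: "Y \<subseteq> M" using Y by auto
  have "x \<in> mcball x S" using x S by simp
  then have "Y \<noteq> {}" using Y(3) by blast
  \<comment> \<open>Covering with half radii leaves a margin \<delta> common to the finite cover, so
    the compact balls of full radius cover the ball of radius
    \<open>S + \<delta> / 2\<close>.\<close>
  define \<delta> where "\<delta> = Min ((\<lambda>y. \<rho> y / 2) ` Y)"
  have \<delta>: "0 < \<delta>" using Y(1) \<open>Y \<noteq> {}\<close> \<rho>(1) YM by (auto simp: \<delta>_def subset_iff)
  have \<delta>': "\<delta> \<le> \<rho> y / 2" if "y \<in> Y" for y using Y(1) that unfolding \<delta>_def by (intro Min_le) auto
  have "mcball x (S + \<delta> / 2) \<subseteq> (\<Union>y\<in>Y. mcball y (\<rho> y))"
  proof
    fix w assume "w \<in> mcball x (S + \<delta> / 2)"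
    then have w: "w \<in> M" "d x w \<le> S + \<delta> / 2" by auto
    then obtain z where z: "z \<in> M" "d x z \<le> S" "d z w < \<delta>"
      using len[of x w S \<delta>] x S \<delta> by auto
    then have "z \<in> mcball x S" using x by simp
    then obtain y where y: "y \<in> Y" "y \<in> M" "d y z < \<rho> y / 2" using Y(3) by auto
    have "d y w \<le> d y z + d z w" using y w z by (intro triangle) auto
    then have "d y w \<le> \<rho> y" using y z \<delta>'[OF y(1)] by simp
    then show "w \<in> (\<Union>y\<in>Y. mcball y (\<rho> y))" using y w by auto
  qed
  moreover have "compactin mtopology (\<Union>y\<in>Y. mcball y (\<rho> y))"
    using Y(1) YM \<rho>(2) by (intro compactin_Union) auto
  ultimately have "S + \<delta> / 2 \<in> I"
    unfolding I_def by (metis closed_compactin closedin_mcball mem_Collect_eq)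
  then have "S + \<delta> / 2 \<le> S" unfolding S_def by (rule cSup_upper[OF _ bdd])
  then show False using \<delta> by simp
qed

text \<open>By Tychonoff, the almost minimizing curves with values in a compact ball have a common limit
  point in the product topology.\<close>

lemma minimizing_curve_exists:
  fixes d :: "'a::t2_space \<Rightarrow> 'a \<Rightarrow> real"
  assumes "Metric_space UNIV d"
    and cont: "continuous_on UNIV (\<lambda>(x, y). d x y)"
    and K: "compact {z. d p z \<le> d p q + 1}"
    and near: "\<And>\<epsilon>. 0 < \<epsilon> \<Longrightarrow> \<exists>\<sigma>. \<sigma> 0 = p \<and> \<sigma> 1 = q \<and>
      (\<forall>s\<in>{0..1}. \<forall>t\<in>{0..1}. d (\<sigma> s) (\<sigma> t) \<le> (d p q + \<epsilon>) * \<bar>s - t\<bar>)"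
  shows "\<exists>\<sigma>. \<sigma> 0 = p \<and> \<sigma> 1 = q \<and>
    (\<forall>s\<in>{0..1::real}. \<forall>t\<in>{0..1}. s \<le> t \<longrightarrow> d (\<sigma> s) (\<sigma> t) = d p q * (t - s))"
proof -
  interpret Metric_space UNIV d by fact
  define L where "L = d p q"
  define K' where "K' = {z. d p z \<le> L + 1}"
  define P where "P = (PiE UNIV (\<lambda>_::real. K'))"
  \<comment> \<open>Each condition concerns at most two coordinates of \<sigma>, so it is closed in
    the product topology.\<close>
  define F where "F n = {\<sigma>. \<sigma> 0 = p \<and> \<sigma> 1 = q \<and>
      (\<forall>s\<in>{0..1}. \<forall>t\<in>{0..1}. d (\<sigma> s) (\<sigma> t) \<le> (L + 1 / Suc n) * \<bar>s - t\<bar>)}" for n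
  have "compactin (product_topology (\<lambda>_::real. euclidean) UNIV) P"
    unfolding P_def compactin_PiE using K by (simp add: K'_def L_def)
  then have P: "compact P" by (simp add: euclidean_product_topology)
  have cF: "closed (F n)" for n
  proof -
    have "F n = {\<sigma>. \<sigma> 0 = p} \<inter> {\<sigma>. \<sigma> 1 = q} \<inter>
      (\<Inter>s\<in>{0..1}. \<Inter>t\<in>{0..1}. {\<sigma>. d (\<sigma> s) (\<sigma> t) \<le> (L + 1 / Suc n) * \<bar>s - t\<bar>})"
      by (auto simp: F_def)
    moreover have "continuous_on UNIV (\<lambda>\<sigma>::real \<Rightarrow> 'a. d (\<sigma> s) (\<sigma> t))" for s t
      using continuous_on_compose2[OF cont continuous_on_Pair[OF
          continuous_on_product_coordinates[of s] continuous_on_product_coordinates[of t]]]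
      by simp
    ultimately show ?thesis
      by (auto intro!: closed_Int closed_INT closed_Collect_eq closed_Collect_le
          continuous_on_const continuous_on_product_coordinates)
  qed
  have anti: "F n \<subseteq> F m" if "m \<le> n" for m n
  proof
    fix \<sigma> assume \<sigma>: "\<sigma> \<in> F n"
    have "(L + 1 / Suc n) * \<bar>s - t\<bar> \<le> (L + 1 / Suc m) * \<bar>s - t\<bar>" for s t :: real
      using that by (intro mult_right_mono add_left_mono divide_left_mono) auto
    then have "d (\<sigma> s) (\<sigma> t) \<le> (L + 1 / Suc m) * \<bar>s - t\<bar>" if "s \<in> {0..1}" "t \<in> {0..1}" for s t
      using \<sigma> that unfolding F_def by (blast intro: order_trans)
    then show "\<sigma> \<in> F m" using \<sigma> unfolding F_def by blast
  qed
  have ne: "P \<inter> F n \<noteq> {}" for n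
  proof -
    obtain \<sigma> where \<sigma>: "\<sigma> 0 = p" "\<sigma> 1 = q"
      "\<And>s t. s \<in> {0..1} \<Longrightarrow> t \<in> {0..1} \<Longrightarrow> d (\<sigma> s) (\<sigma> t) \<le> (L + 1 / Suc n) * \<bar>s - t\<bar>"
      using near[of "1 / Suc n"] by (auto simp: L_def)
    \<comment> \<open>Membership in \<open>P\<close> concerns all real parameters, so the curve is
      frozen outside \<open>{0..1}\<close>.\<close>
    define \<sigma>' where "\<sigma>' s = \<sigma> (max 0 (min 1 s))" for s
    have L0: "0 \<le> L" by (simp add: L_def)
    have "\<sigma>' s \<in> K'" for s
    proof -
      let ?s = "max 0 (min 1 s)"
      have "d p (\<sigma> ?s) \<le> (L + 1 / Suc n) * \<bar>0 - ?s\<bar>" using \<sigma>(3)[of 0 ?s] \<sigma>(1) by simp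
      also have "\<dots> \<le> (L + 1) * 1" using L0 by (intro mult_mono add_mono) auto
      finally show ?thesis by (simp add: \<sigma>'_def K'_def)
    qed
    then have "\<sigma>' \<in> P" by (simp add: P_def PiE_UNIV_domain)
    moreover have "\<sigma>' \<in> F n" using \<sigma> by (auto simp: F_def \<sigma>'_def)
    ultimately show ?thesis by blast
  qed
  have "P \<inter> \<Inter> (range F) \<noteq> {}"
  proof (rule compact_imp_fip[OF P])
    fix F' assume F': "finite F'" "F' \<subseteq> range F"
    then obtain N where N: "finite N" "F' = F ` N" by (meson finite_subset_image)
    have "F (Max (insert 0 N)) \<subseteq> F n" if "n \<in> N" for n
      using N(1) that by (intro anti Max_ge) auto
    then have "F (Max (insert 0 N)) \<subseteq> \<Inter> F'" using N by blast
    then show "P \<inter> \<Inter> F' \<noteq> {}" using ne by blast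
  qed (use cF in auto)
  then obtain \<sigma> where \<sigma>: "\<And>n. \<sigma> \<in> F n" by auto
  have ends: "\<sigma> 0 = p" "\<sigma> 1 = q" using \<sigma>[of 0] by (auto simp: F_def)
  have le: "d (\<sigma> s) (\<sigma> t) \<le> L * (t - s)" if "s \<in> {0..1}" "t \<in> {0..1}" "s \<le> t" for s t
  proof (rule LIMSEQ_le_const)
    have "d (\<sigma> s) (\<sigma> t) \<le> (L + 1 / Suc n) * \<bar>s - t\<bar>" for n
      using \<sigma>[of n] that unfolding F_def by blast
    moreover have "\<bar>s - t\<bar> = t - s" using that by simp
    ultimately show "\<exists>N. \<forall>n\<ge>N. d (\<sigma> s) (\<sigma> t) \<le> (L + 1 / Suc n) * (t - s)" by simp
    have "(\<lambda>n. 1 / real (Suc n)) \<longlonglongrightarrow> 0" by (rule LIMSEQ_Suc[OF lim_1_over_n])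
    then have "(\<lambda>n. (L + 1 / Suc n) * (t - s)) \<longlonglongrightarrow> (L + 0) * (t - s)" by (intro tendsto_intros)
    then show "(\<lambda>n. (L + 1 / Suc n) * (t - s)) \<longlonglongrightarrow> L * (t - s)" by simp
  qed
  have "d (\<sigma> s) (\<sigma> t) = L * (t - s)" if st: "s \<in> {0..1}" "t \<in> {0..1}" "s \<le> t" for s t
  proof -
    \<comment> \<open>If the piece from \<open>s\<close> to \<open>t\<close> were shorter than its
      share, the way through \<open>\<sigma> s\<close> and \<open>\<sigma> t\<close> would be
      shorter than the distance of the ends.\<close>
    have "L \<le> d p (\<sigma> s) + d (\<sigma> s) (\<sigma> t) + d (\<sigma> t) q"
      using triangle[of p "\<sigma> s" q] triangle[of "\<sigma> s" "\<sigma> t" q] by (simp add: L_def)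
    also have "\<dots> \<le> L * s + d (\<sigma> s) (\<sigma> t) + L * (1 - t)"
      using le[of 0 s] le[of t 1] st ends by (intro add_mono) auto
    finally show ?thesis using le[OF st] by (simp add: algebra_simps)
  qed
  then show ?thesis using ends unfolding L_def by blast
qed

section \<open>Metrics in coordinates\<close>

lemma linear_bound_basis:
  fixes f :: "'e::euclidean_space \<Rightarrow> real"
  assumes "linear f" "\<And>b. b \<in> Basis \<Longrightarrow> \<bar>f b\<bar> \<le> k b"
  shows "\<bar>f w\<bar> \<le> (\<Sum>b\<in>Basis. k b) * norm w"
proof -
  have "\<bar>f w\<bar> \<le> (\<Sum>b\<in>Basis. \<bar>(w \<bullet> b) * f b\<bar>)"
    unfolding linear_sum_basis[OF assms(1), of w] by (rule sum_abs)
  also have "\<dots> \<le> (\<Sum>b\<in>Basis. norm w * k b)"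
    unfolding abs_mult by (intro sum_mono mult_mono Basis_le_norm assms) auto
  finally show ?thesis by (simp add: sum_distrib_left mult.commute)
qed

lemma bilinear_bound_basis:
  fixes f :: "'e::euclidean_space \<Rightarrow> 'e \<Rightarrow> real"
  assumes "bilinear f" "\<And>i j. i \<in> Basis \<Longrightarrow> j \<in> Basis \<Longrightarrow> \<bar>f i j\<bar> \<le> k i j"
  shows "\<bar>f u v\<bar> \<le> (\<Sum>i\<in>Basis. \<Sum>j\<in>Basis. k i j) * norm u * norm v"
proof -
  have "linear (\<lambda>u. f u v)" "\<And>i. linear (f i)" using assms(1) by (auto simp: bilinear_def)
  then have "\<bar>f u v\<bar> \<le> (\<Sum>i\<in>Basis. (\<Sum>j\<in>Basis. k i j) * norm v) * norm u"
    by (intro linear_bound_basis assms(2))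
  then show ?thesis by (simp add: sum_distrib_left sum_distrib_right mult_ac)
qed

text \<open>\<open>Ck_on\<close> speaks of derivatives in fixed directions. Continuity on a compact
  set bounds them on the basis, hence the whole derivative, and convexity yields the Lipschitz
  bound.\<close>

lemma C1_constant:
  fixes f :: "'e::euclidean_space \<Rightarrow> real"
  assumes "Ck_on (Suc 0) V f" "C \<subseteq> V" "compact C" "convex C"
  obtains K where "0 \<le> K" "\<And>x w. x \<in> C \<Longrightarrow> \<bar>frechet_derivative f (at x) w\<bar> \<le> K * norm w"
    "\<And>x y. x \<in> C \<Longrightarrow> y \<in> C \<Longrightarrow> \<bar>f y - f x\<bar> \<le> K * norm (y - x)"
proof -
  have diff: "f differentiable (at x)" if "x \<in> C" for x using assms(1,2) that by auto
  have der: "(f has_derivative frechet_derivative f (at x)) (at x)" if "x \<in> C" for x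
    using diff[OF that] by (simp add: frechet_derivative_works)
  have "\<exists>k. 0 \<le> k \<and> (\<forall>x\<in>C. \<bar>frechet_derivative f (at x) b\<bar> \<le> k)" for b
  proof -
    have "continuous_on C (\<lambda>x. frechet_derivative f (at x) b)"
      using assms(1,2) by (auto intro: continuous_on_subset)
    then have "compact ((\<lambda>x. frechet_derivative f (at x) b) ` C)"
      by (rule compact_continuous_image[OF _ assms(3)])
    then obtain k where "\<forall>y\<in>(\<lambda>x. frechet_derivative f (at x) b) ` C. norm y \<le> k"
      using compact_imp_bounded bounded_iff by blast
    then show ?thesis by (intro exI[of _ "max 0 k"]) fastforce
  qed
  then obtain k where k: "\<And>b. 0 \<le> k b" "\<And>b x. x \<in> C \<Longrightarrow> \<bar>frechet_derivative f (at x) b\<bar> \<le> k b"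
    by metis
  define K where "K = (\<Sum>b\<in>Basis. k (b::'e))"
  have K: "0 \<le> K" unfolding K_def by (intro sum_nonneg k)
  have bd: "\<bar>frechet_derivative f (at x) w\<bar> \<le> K * norm w" if "x \<in> C" for x w
    unfolding K_def
    by (rule linear_bound_basis[OF linear_frechet_derivative[OF diff[OF that]] k(2)[OF that]])
  have "norm (f y - f x) \<le> K * norm (y - x)" if "x \<in> C" "y \<in> C" for x y
  proof (rule differentiable_bound[OF assms(4) _ _ that(2,1)])
    show "(f has_derivative frechet_derivative f (at z)) (at z within C)" if "z \<in> C" for z
      using der[OF that] by (rule has_derivative_at_withinI)
    show "onorm (frechet_derivative f (at z)) \<le> K" if "z \<in> C" for z
      by (rule onorm_bound[OF K]) (simp add: bd that)
  qed
  then show ?thesis using that K bd by simp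
qed

lemma C2_constant:
  fixes f :: "'e::euclidean_space \<Rightarrow> real"
  assumes C2: "Ck_on (Suc (Suc 0)) V f" and C: "C \<subseteq> V" "compact C" "convex C"
  obtains K where "0 \<le> K" "\<And>x. x \<in> C \<Longrightarrow> \<bar>f x\<bar> \<le> K"
    "\<And>x w. x \<in> C \<Longrightarrow> \<bar>frechet_derivative f (at x) w\<bar> \<le> K * norm w"
    "\<And>x y. x \<in> C \<Longrightarrow> y \<in> C \<Longrightarrow> \<bar>f y - f x\<bar> \<le> K * norm (y - x)"
    "\<And>x y w. x \<in> C \<Longrightarrow> y \<in> C \<Longrightarrow>
       \<bar>frechet_derivative f (at y) w - frechet_derivative f (at x) w\<bar> \<le> K * norm (y - x) * norm w"
    "\<And>x y. x \<in> C \<Longrightarrow> y \<in> C \<Longrightarrow>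
       \<bar>f y - f x - frechet_derivative f (at x) (y - x)\<bar> \<le> K * (norm (y - x))\<^sup>2"
proof -
  have diff: "f differentiable (at x)" if "x \<in> C" for x using C2 C(1) that by auto
  have "continuous_on V f"
    using C2 by (auto intro!: continuous_at_imp_continuous_on differentiable_imp_continuous_within)
  moreover have "continuous_on V (\<lambda>x. frechet_derivative f (at x) v)" for v
    using C2 by (auto intro!: continuous_at_imp_continuous_on differentiable_imp_continuous_within)
  ultimately have "Ck_on (Suc 0) V f" using C2 by simp
  then obtain K1 where K1: "0 \<le> K1" "\<And>x w. x \<in> C \<Longrightarrow> \<bar>frechet_derivative f (at x) w\<bar> \<le> K1 * norm w"
    "\<And>x y. x \<in> C \<Longrightarrow> y \<in> C \<Longrightarrow> \<bar>f y - f x\<bar> \<le> K1 * norm (y - x)"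
    by (rule C1_constant[OF _ C]) (rule that)
  have "\<exists>k. 0 \<le> k \<and> (\<forall>x\<in>C. \<forall>y\<in>C.
      \<bar>frechet_derivative f (at y) b - frechet_derivative f (at x) b\<bar> \<le> k * norm (y - x))" for b
  proof -
    have "Ck_on (Suc 0) V (\<lambda>x. frechet_derivative f (at x) b)" using C2 by simp
    from C1_constant[OF this C] show ?thesis by metis
  qed
  then obtain k where k: "\<And>b. 0 \<le> k b" "\<And>b x y. x \<in> C \<Longrightarrow> y \<in> C \<Longrightarrow>
      \<bar>frechet_derivative f (at y) b - frechet_derivative f (at x) b\<bar> \<le> k b * norm (y - x)"
    by metis
  define K2 where "K2 = (\<Sum>b\<in>Basis. k (b::'e))"
  have K2: "0 \<le> K2" unfolding K2_def by (intro sum_nonneg k)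
  have D2: "\<bar>frechet_derivative f (at y) w - frechet_derivative f (at x) w\<bar> \<le> K2 * norm (y - x) * norm w"
    if "x \<in> C" "y \<in> C" for x y w
  proof -
    have "\<bar>frechet_derivative f (at y) w - frechet_derivative f (at x) w\<bar> \<le>
        (\<Sum>b\<in>Basis. k b * norm (y - x)) * norm w"
      using that by (intro linear_bound_basis linear_compose_sub linear_frechet_derivative diff k)
    then show ?thesis by (simp add: K2_def sum_distrib_right)
  qed
  have T: "\<bar>f y - f x - frechet_derivative f (at x) (y - x)\<bar> \<le> K2 * (norm (y - x))\<^sup>2"
    if xy: "x \<in> C" "y \<in> C" for x y
  proof -
    \<comment> \<open>The mean value inequality is applied to \<open>f\<close> minus its linear part
      at \<open>x\<close>; on \<open>S\<close> the derivative of this difference is at most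
      \<open>K2 * norm (y - x)\<close>, which produces the square.\<close>
    define S where "S = C \<inter> cball x (norm (y - x))"
    let ?D = "frechet_derivative f (at x)"
    have lin: "linear ?D" by (rule linear_frechet_derivative[OF diff[OF xy(1)]])
    have "norm ((f y - ?D y) - (f x - ?D x)) \<le> (K2 * norm (y - x)) * norm (y - x)"
    proof (rule differentiable_bound)
      show "convex S" unfolding S_def using C by (intro convex_Int) auto
      show "y \<in> S" "x \<in> S" using xy by (auto simp: S_def dist_norm norm_minus_commute)
      fix z assume z: "z \<in> S"
      then have zC: "z \<in> C" and zx: "norm (z - x) \<le> norm (y - x)"
        by (auto simp: S_def dist_norm norm_minus_commute)
      show "((\<lambda>z. f z - ?D z) has_derivative (\<lambda>w. frechet_derivative f (at z) w - ?D w)) (at z within S)"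
      proof (rule has_derivative_diff)
        show "(f has_derivative frechet_derivative f (at z)) (at z within S)"
          using diff[OF zC] unfolding frechet_derivative_works by (rule has_derivative_at_withinI)
        show "(?D has_derivative ?D) (at z within S)" using lin by (rule linear_imp_has_derivative)
      qed
      show "onorm (\<lambda>w. frechet_derivative f (at z) w - ?D w) \<le> K2 * norm (y - x)"
      proof (rule onorm_bound)
        fix w :: 'e
        have "K2 * norm (z - x) * norm w \<le> K2 * norm (y - x) * norm w"
          using zx K2 by (intro mult_right_mono mult_left_mono) auto
        then show "norm (frechet_derivative f (at z) w - ?D w) \<le> K2 * norm (y - x) * norm w"
          using D2[OF xy(1) zC, of w] by simp
      qed (use K2 in simp)
    qed
    then show ?thesis by (simp add: linear_diff[OF lin] power2_eq_square algebra_simps)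
  qed
  have "compact (f ` C)"
    using \<open>continuous_on V f\<close> C by (intro compact_continuous_image) (auto intro: continuous_on_subset)
  then obtain K0 where K0: "\<forall>y\<in>f ` C. norm y \<le> K0" using compact_imp_bounded bounded_iff by blast
  define K where "K = K1 + K2 + \<bar>K0\<bar>"
  have KK: "0 \<le> K" "K1 \<le> K" "K2 \<le> K" "K0 \<le> K" using K1(1) K2 by (auto simp: K_def)
  show thesis
  proof (rule that[OF KK(1)])
    fix x assume x: "x \<in> C"
    show "\<bar>f x\<bar> \<le> K" using K0 x KK(4) by auto
    fix w
    show "\<bar>frechet_derivative f (at x) w\<bar> \<le> K * norm w"
      by (rule order_trans[OF K1(2)[OF x]]) (intro mult_right_mono KK norm_ge_zero)
    fix y assume y: "y \<in> C"
    show "\<bar>f y - f x\<bar> \<le> K * norm (y - x)"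
      by (rule order_trans[OF K1(3)[OF x y]]) (intro mult_right_mono KK norm_ge_zero)
    show "\<bar>frechet_derivative f (at y) w - frechet_derivative f (at x) w\<bar> \<le> K * norm (y - x) * norm w"
      by (rule order_trans[OF D2[OF x y]]) (intro mult_right_mono KK norm_ge_zero)
    show "\<bar>f y - f x - frechet_derivative f (at x) (y - x)\<bar> \<le> K * (norm (y - x))\<^sup>2"
      by (rule order_trans[OF T[OF x y]]) (intro mult_right_mono KK zero_le_power2)
  qed
qed

text \<open>Smoothness is given for each fixed pair of vectors; bounds for pairs of basis vectors
  extend bilinearly to all vectors with one constant. Positivity at \<open>x0\<close> becomes
  coercivity by compactness of the unit sphere and persists nearby with half the constant.\<close>

lemma ex_metric_ball:
  fixes h :: "'e::euclidean_space \<Rightarrow> 'e \<Rightarrow> 'e \<Rightarrow> real"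
  defines "h' \<equiv> \<lambda>x w u v. frechet_derivative (\<lambda>y. h y u v) (at x) w"
  assumes V: "open V" "x0 \<in> V"
    and bil: "\<And>x. x \<in> V \<Longrightarrow> bilinear (h x)"
    and sym: "\<And>x u v. x \<in> V \<Longrightarrow> h x u v = h x v u"
    and pos: "\<And>x u. x \<in> V \<Longrightarrow> u \<noteq> 0 \<Longrightarrow> 0 < h x u u"
    and smooth: "\<And>u v. Ck_on (Suc (Suc 0)) V (\<lambda>x. h x u v)"
  obtains r lam K where "0 < r" "cball x0 r \<subseteq> V" "metric_ball (cball x0 r) h h' lam K"
proof -
  obtain r0 where r0: "0 < r0" "cball x0 r0 \<subseteq> V" using V open_contains_cball by blast
  define P where "P i j K \<longleftrightarrow> 0 \<le> K \<and> (\<forall>x\<in>cball x0 r0. \<bar>h x i j\<bar> \<le> K) \<and>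
      (\<forall>x\<in>cball x0 r0. \<forall>w. \<bar>h' x w i j\<bar> \<le> K * norm w) \<and>
      (\<forall>x\<in>cball x0 r0. \<forall>y\<in>cball x0 r0. \<bar>h y i j - h x i j\<bar> \<le> K * norm (y - x)) \<and>
      (\<forall>x\<in>cball x0 r0. \<forall>y\<in>cball x0 r0. \<forall>w. \<bar>h' y w i j - h' x w i j\<bar> \<le> K * norm (y - x) * norm w) \<and>
      (\<forall>x\<in>cball x0 r0. \<forall>y\<in>cball x0 r0. \<bar>h y i j - h x i j - h' x (y - x) i j\<bar> \<le> K * (norm (y - x))\<^sup>2)" for i j K
  have "\<exists>K. P i j K" for i j
    unfolding P_def h'_def
    by (rule C2_constant[OF smooth r0(2) compact_cball convex_cball, of i j]) blast
  then obtain k where kk: "\<And>i j. P i j (k i j)" by metis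
  have k: "\<And>i j. 0 \<le> k i j" "\<And>i j x. x \<in> cball x0 r0 \<Longrightarrow> \<bar>h x i j\<bar> \<le> k i j"
    "\<And>i j x w. x \<in> cball x0 r0 \<Longrightarrow> \<bar>h' x w i j\<bar> \<le> k i j * norm w"
    "\<And>i j x y. x \<in> cball x0 r0 \<Longrightarrow> y \<in> cball x0 r0 \<Longrightarrow> \<bar>h y i j - h x i j\<bar> \<le> k i j * norm (y - x)"
    "\<And>i j x y w. x \<in> cball x0 r0 \<Longrightarrow> y \<in> cball x0 r0 \<Longrightarrow>
       \<bar>h' y w i j - h' x w i j\<bar> \<le> k i j * norm (y - x) * norm w"
    "\<And>i j x y. x \<in> cball x0 r0 \<Longrightarrow> y \<in> cball x0 r0 \<Longrightarrow>
       \<bar>h y i j - h x i j - h' x (y - x) i j\<bar> \<le> k i j * (norm (y - x))\<^sup>2"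
    using kk unfolding P_def by blast+
  \<comment> \<open>The summand 1 makes \<open>K\<close> strictly positive, as the locale
    demands.\<close>
  define K where "K = (\<Sum>i\<in>Basis. \<Sum>j\<in>Basis. k (i::'e) (j::'e)) + 1"
  have K: "0 < K" unfolding K_def by (intro add_nonneg_pos sum_nonneg k) auto
  have raise: "b \<le> K * norm u * norm v * c"
    if "b \<le> (\<Sum>i\<in>Basis. \<Sum>j\<in>Basis. k i j * c) * norm u * norm v" "0 \<le> c" for b c and u v :: 'e
  proof -
    have "b \<le> ((K - 1) * c) * norm u * norm v"
      using that(1) by (simp add: K_def sum_distrib_right)
    also have "\<dots> \<le> (K * c) * norm u * norm v" using that(2) by (intro mult_right_mono) auto
    finally show ?thesis by (simp add: mult_ac)
  qed
  have der: "((\<lambda>y. h y u v) has_derivative (\<lambda>w. h' x w u v)) (at x)" if "x \<in> V" for x u v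
    using smooth[of u v] that unfolding h'_def by (simp add: frechet_derivative_works)
  have eqder: "F = F'" if "(f has_derivative F) (at x)" "(f' has_derivative F') (at x)"
    "\<And>y. y \<in> V \<Longrightarrow> f y = f' y" "x \<in> V" for f f' F F' x
    using has_derivative_transform_within_open[OF that(1) V(1) that(4,3)] that(2) has_derivative_unique by blast
  note hs = bilinear_ladd[OF bil] bilinear_radd[OF bil] bilinear_lmul[OF bil] bilinear_rmul[OF bil]
  \<comment> \<open>The identities of bilinearity are differentiated in the base point: they hold on
    the open set \<open>V\<close>, and derivatives are unique.\<close>
  have bil': "bilinear (h' x w)" if x: "x \<in> V" for x w
  proof -
    have "h' x w (u + u') v = h' x w u v + h' x w u' v" for u u' v
      using eqder[OF der[OF x] has_derivative_add[OF der[OF x] der[OF x]] _ x, of "u + u'" v u v u' v] hs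
      by (metis (no_types, lifting))
    moreover have "h' x w u (v + v') = h' x w u v + h' x w u v'" for u v v'
      using eqder[OF der[OF x] has_derivative_add[OF der[OF x] der[OF x]] _ x, of u "v + v'" u v u v'] hs
      by (metis (no_types, lifting))
    moreover have "h' x w (r *\<^sub>R u) v = r * h' x w u v" for u v r
    proof -
      have "h y (r *\<^sub>R u) v = r * h y u v" if "y \<in> V" for y using that by (simp add: hs)
      from eqder[OF der[OF x] has_derivative_mult_right[OF der[OF x]] this x] show ?thesis by metis
    qed
    moreover have "h' x w u (r *\<^sub>R v) = r * h' x w u v" for u v r
    proof -
      have "h y u (r *\<^sub>R v) = r * h y u v" if "y \<in> V" for y using that by (simp add: hs)
      from eqder[OF der[OF x] has_derivative_mult_right[OF der[OF x]] this x] show ?thesis by metis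
    qed
    ultimately show ?thesis unfolding bilinear_def by (auto intro!: linearI)
  qed
  have bilb: "bilinear (\<lambda>u v. f u v - g u v)" if "bilinear f" "bilinear g" for f g :: "'e \<Rightarrow> 'e \<Rightarrow> real"
    using that unfolding bilinear_def by (auto intro: linear_compose_sub)
  have bd: "\<bar>h x u v\<bar> \<le> K * norm u * norm v" if x: "x \<in> cball x0 r0" for x u v
    using raise[of "\<bar>h x u v\<bar>" 1 u v] bilinear_bound_basis[OF bil, of x k u v] k(2)[OF x] x r0 by auto
  have lip: "\<bar>h y u v - h x u v\<bar> \<le> K * norm (y - x) * norm u * norm v"
    if xy: "x \<in> cball x0 r0" "y \<in> cball x0 r0" for x y u v
  proof -
    have "\<bar>h y u v - h x u v\<bar> \<le> (\<Sum>i\<in>Basis. \<Sum>j\<in>Basis. k i j * norm (y - x)) * norm u * norm v"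
      using xy r0 by (intro bilinear_bound_basis bilb bil k) auto
    from raise[OF this] show ?thesis by (simp add: mult_ac)
  qed
  have bd': "\<bar>h' x w u v\<bar> \<le> K * norm w * norm u * norm v" if x: "x \<in> cball x0 r0" for x u v w
  proof -
    have "\<bar>h' x w u v\<bar> \<le> (\<Sum>i\<in>Basis. \<Sum>j\<in>Basis. k i j * norm w) * norm u * norm v"
      using x r0 by (intro bilinear_bound_basis bil' k) auto
    from raise[OF this] show ?thesis by (simp add: mult_ac)
  qed
  have lip': "\<bar>h' y w u v - h' x w u v\<bar> \<le> K * norm (y - x) * norm w * norm u * norm v"
    if xy: "x \<in> cball x0 r0" "y \<in> cball x0 r0" for x y u v w
  proof -
    have "\<bar>h' y w u v - h' x w u v\<bar> \<le> (\<Sum>i\<in>Basis. \<Sum>j\<in>Basis. k i j * (norm (y - x) * norm w)) * norm u * norm v"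
      using xy r0 k(5) by (intro bilinear_bound_basis bilb bil') (auto simp: mult_ac)
    from raise[OF this] show ?thesis by (simp add: mult_ac)
  qed
  have taylor: "\<bar>h y u v - h x u v - h' x (y - x) u v\<bar> \<le> K * (norm (y - x))\<^sup>2 * norm u * norm v"
    if xy: "x \<in> cball x0 r0" "y \<in> cball x0 r0" for x y u v
  proof -
    have "\<bar>h y u v - h x u v - h' x (y - x) u v\<bar> \<le> (\<Sum>i\<in>Basis. \<Sum>j\<in>Basis. k i j * (norm (y - x))\<^sup>2) * norm u * norm v"
      using xy r0 by (intro bilinear_bound_basis bilb bil bil' k) auto
    from raise[OF this] show ?thesis by (simp add: mult_ac)
  qed
  have "\<exists>lam>0. \<forall>u. lam * (norm u)\<^sup>2 \<le> h x0 u u"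
  proof -
    have hb: "bounded_bilinear (h x0)" using bil[OF V(2)] by (simp add: bilinear_conv_bounded_bilinear)
    have c: "continuous_on (sphere 0 1) (\<lambda>u::'e. h x0 u u)"
      by (intro bounded_bilinear.continuous_on[OF hb] continuous_intros)
    obtain e :: 'e where "e \<in> Basis" using nonempty_Basis by blast
    then have ne: "sphere (0::'e) 1 \<noteq> {}" by (metis ex_in_conv mem_sphere_0 norm_Basis)
    obtain m where m: "m \<in> sphere 0 1" "\<And>u. u \<in> sphere 0 1 \<Longrightarrow> h x0 m m \<le> h x0 u u"
      using continuous_attains_inf[OF compact_sphere ne c] by blast
    have "h x0 m m * (norm u)\<^sup>2 \<le> h x0 u u" for u
    proof (cases "u = 0")
      case True
      then show ?thesis using bilinear_lzero[OF bil[OF V(2)]] by simp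
    next
      case False
      have "h x0 m m \<le> h x0 ((1 / norm u) *\<^sub>R u) ((1 / norm u) *\<^sub>R u)" using False by (intro m) simp
      also have "\<dots> = h x0 u u / (norm u)\<^sup>2" using V(2) by (simp add: hs power2_eq_square)
      finally show ?thesis using False by (simp add: field_simps)
    qed
    moreover have "0 < h x0 m m" using m(1) by (intro pos V) auto
    ultimately show ?thesis by blast
  qed
  then obtain lam where lam: "0 < lam" "\<And>u. lam * (norm u)\<^sup>2 \<le> h x0 u u" by blast
  \<comment> \<open>\<open>K * r \<le> lam / 2\<close> lets the metric lose at most half of its
    coercivity on the ball.\<close>
  define r where "r = min r0 (lam / (2 * K))"
  have r: "0 < r" "r \<le> r0" "K * r \<le> lam / 2"
  proof -
    have "K * r \<le> K * (lam / (2 * K))" using K by (intro mult_left_mono) (auto simp: r_def)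
    then show "K * r \<le> lam / 2" using K by simp
  qed (use r0 lam K in \<open>auto simp: r_def\<close>)
  have sub: "x \<in> cball x0 r0" "x \<in> V" if "x \<in> cball x0 r" for x using that r r0 by auto
  have "metric_ball (cball x0 r) h h' (lam / 2) K"
  proof (rule metric_ball.intro)
    show "0 < lam / 2" "0 < K" using lam K by auto
    fix x assume x: "x \<in> cball x0 r"
    show "bilinear (h x)" "bilinear (h' x w)" for w using bil bil' sub[OF x] by auto
    show "h x u v = h x v u" for u v using sym sub[OF x] by blast
    show "linear (\<lambda>w. h' x w u v)" for u v using der[OF sub(2)[OF x]] has_derivative_linear by blast
    show "\<bar>h x u v\<bar> \<le> K * norm u * norm v" for u v using bd sub[OF x] by blast
    show "\<bar>h' x w u v\<bar> \<le> K * norm w * norm u * norm v" for w u v using bd' sub[OF x] by blast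
    show "lam / 2 * (norm u)\<^sup>2 \<le> h x u u" for u
    proof -
      have "\<bar>h x u u - h x0 u u\<bar> \<le> K * norm (x - x0) * norm u * norm u"
        using lip[of x0 x u u] sub[OF x] r0 by simp
      also have "\<dots> \<le> K * r * norm u * norm u"
        using x K by (intro mult_right_mono mult_left_mono) (auto simp: dist_norm norm_minus_commute)
      also have "\<dots> \<le> lam / 2 * norm u * norm u" using r by (intro mult_right_mono) auto
      finally show ?thesis using lam(2)[of u] abs_le_D2 by (fastforce simp: power2_eq_square)
    qed
    fix y assume y: "y \<in> cball x0 r"
    show "\<bar>h y u v - h x u v\<bar> \<le> K * norm (y - x) * norm u * norm v" for u v
      using lip sub[OF x] sub[OF y] by blast
    show "\<bar>h' y w u v - h' x w u v\<bar> \<le> K * norm (y - x) * norm w * norm u * norm v" for u v w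
      using lip' sub[OF x] sub[OF y] by blast
    show "\<bar>h y u v - h x u v - h' x (y - x) u v\<bar> \<le> K * (norm (y - x))\<^sup>2 * norm u * norm v" for u v
      using taylor sub[OF x] sub[OF y] by blast
  qed
  moreover have "cball x0 r \<subseteq> V" using sub by blast
  ultimately show thesis using that r(1) by blast
qed

section \<open>Charts, transition maps and coordinate vectors\<close>

context smooth_manifold
begin

abbreviation "param \<kappa> \<equiv> inv_into (fst \<kappa>) (snd \<kappa>)"

abbreviation "dtransition \<kappa> \<kappa>' p \<equiv> frechet_derivative (transition \<kappa> \<kappa>') (at (snd \<kappa> p))"

lemma chart_facts:
  assumes "\<kappa> \<in> A"
  shows "open (fst \<kappa>)" "open (snd \<kappa> ` fst \<kappa>)" "inj_on (snd \<kappa>) (fst \<kappa>)"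
    "continuous_on (fst \<kappa>) (snd \<kappa>)" "continuous_on (snd \<kappa> ` fst \<kappa>) (param \<kappa>)"
    "\<And>p. p \<in> fst \<kappa> \<Longrightarrow> param \<kappa> (snd \<kappa> p) = p"
    "\<And>x. x \<in> snd \<kappa> ` fst \<kappa> \<Longrightarrow> snd \<kappa> (param \<kappa> x) = x"
    "\<And>x. x \<in> snd \<kappa> ` fst \<kappa> \<Longrightarrow> param \<kappa> x \<in> fst \<kappa>"
proof -
  have c: "open (fst \<kappa>) \<and> open (snd \<kappa> ` fst \<kappa>) \<and> homeomorphism (fst \<kappa>) (snd \<kappa> ` fst \<kappa>) (snd \<kappa>) (param \<kappa>)"
    using chart[of "fst \<kappa>" "snd \<kappa>"] assms by simp
  then show "open (fst \<kappa>)" "open (snd \<kappa> ` fst \<kappa>)" "continuous_on (fst \<kappa>) (snd \<kappa>)"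
    "continuous_on (snd \<kappa> ` fst \<kappa>) (param \<kappa>)" by (auto simp: homeomorphism_def)
  show "inj_on (snd \<kappa>) (fst \<kappa>)" by (metis c homeomorphism_def inj_on_inverseI)
  then show "p \<in> fst \<kappa> \<Longrightarrow> param \<kappa> (snd \<kappa> p) = p" for p by simp
  show "x \<in> snd \<kappa> ` fst \<kappa> \<Longrightarrow> snd \<kappa> (param \<kappa> x) = x" for x by (simp add: f_inv_into_f)
  show "x \<in> snd \<kappa> ` fst \<kappa> \<Longrightarrow> param \<kappa> x \<in> fst \<kappa>" for x by (simp add: inv_into_into)
qed

lemma param_image:
  assumes "\<kappa> \<in> A" "C \<subseteq> snd \<kappa> ` fst \<kappa>"
  shows "param \<kappa> ` C = fst \<kappa> \<inter> snd \<kappa> -` C"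
proof (intro equalityI subsetI)
  fix q assume "q \<in> param \<kappa> ` C"
  then show "q \<in> fst \<kappa> \<inter> snd \<kappa> -` C" using chart_facts(7,8)[OF assms(1)] assms(2) by auto
next
  fix q assume "q \<in> fst \<kappa> \<inter> snd \<kappa> -` C"
  then show "q \<in> param \<kappa> ` C" using chart_facts(6)[OF assms(1), of q]
    by (intro image_eqI[where x = "snd \<kappa> q"]) auto
qed

lemma charts_atD: "\<kappa> \<in> charts_at A p \<Longrightarrow> \<kappa> \<in> A" "\<kappa> \<in> charts_at A p \<Longrightarrow> p \<in> fst \<kappa>"
  by (auto simp: charts_at_def)

lemma ex_chart: "\<exists>\<kappa>. \<kappa> \<in> charts_at A p"
proof -
  have "p \<in> (\<Union>\<kappa>\<in>A. fst \<kappa>)" unfolding cover by simp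
  then show ?thesis unfolding charts_at_def by blast
qed

lemma open_chart_image:
  assumes "\<kappa> \<in> A" "open W"
  shows "open (snd \<kappa> ` (fst \<kappa> \<inter> W))"
proof -
  have "snd \<kappa> ` (fst \<kappa> \<inter> W) = snd \<kappa> ` fst \<kappa> \<inter> param \<kappa> -` W"
  proof (intro equalityI subsetI)
    fix x assume "x \<in> snd \<kappa> ` (fst \<kappa> \<inter> W)"
    then show "x \<in> snd \<kappa> ` fst \<kappa> \<inter> param \<kappa> -` W" using chart_facts(6)[OF assms(1)] by auto
  next
    fix x assume "x \<in> snd \<kappa> ` fst \<kappa> \<inter> param \<kappa> -` W"
    then show "x \<in> snd \<kappa> ` (fst \<kappa> \<inter> W)"
      using chart_facts(7,8)[OF assms(1), of x] by (intro image_eqI[where x = "param \<kappa> x"]) auto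
  qed
  then show ?thesis
    using chart_facts[OF assms(1)] assms(2) by (simp add: continuous_on_open_vimage continuous_open_preimage)
qed

lemma transition_has_derivative:
  assumes "\<kappa> \<in> charts_at A p" "\<kappa>' \<in> charts_at A p"
  shows "(transition \<kappa> \<kappa>' has_derivative dtransition \<kappa> \<kappa>' p) (at (snd \<kappa> p))"
proof -
  have "Ck_on (Suc 0) (snd \<kappa> ` (fst \<kappa> \<inter> fst \<kappa>')) (transition \<kappa> \<kappa>')"
    using compatible[of \<kappa> \<kappa>'] assms unfolding smooth_on_def charts_at_def by blast
  then have "transition \<kappa> \<kappa>' differentiable (at (snd \<kappa> p))" using assms by (auto simp: charts_at_def)
  then show ?thesis by (simp add: frechet_derivative_works)
qed

lemma linear_dtransition:
  "\<kappa> \<in> charts_at A p \<Longrightarrow> \<kappa>' \<in> charts_at A p \<Longrightarrow> linear (dtransition \<kappa> \<kappa>' p)"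
  using transition_has_derivative has_derivative_linear by blast

lemma continuous_dtransition:
  assumes "\<kappa> \<in> A" "\<kappa>' \<in> A"
  shows "continuous_on (snd \<kappa> ` (fst \<kappa> \<inter> fst \<kappa>')) (\<lambda>x. frechet_derivative (transition \<kappa> \<kappa>') (at x) v)"
proof -
  have "Ck_on (Suc 0) (snd \<kappa> ` (fst \<kappa> \<inter> fst \<kappa>')) (transition \<kappa> \<kappa>')"
    using compatible[OF assms] unfolding smooth_on_def by blast
  then show ?thesis by simp
qed

text \<open>The chain rule. Composed and direct transition maps are compared only on the image of
  the overlap of the first two charts, which is open and contains the point.\<close>

lemma dtransition_cocycle:
  assumes \<kappa>: "\<kappa> \<in> charts_at A p" "\<kappa>' \<in> charts_at A p" "\<kappa>'' \<in> charts_at A p"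
  shows "dtransition \<kappa> \<kappa>'' p u = dtransition \<kappa>' \<kappa>'' p (dtransition \<kappa> \<kappa>' p u)"
proof -
  have A: "\<kappa> \<in> A" "\<kappa>' \<in> A" and p: "p \<in> fst \<kappa>" "p \<in> fst \<kappa>'" using \<kappa> by (auto simp: charts_at_def)
  have tp: "transition \<kappa> \<kappa>' (snd \<kappa> p) = snd \<kappa>' p"
    using chart_facts(6)[OF A(1) p(1)] by (simp add: transition_def)
  have 1: "(transition \<kappa>' \<kappa>'' \<circ> transition \<kappa> \<kappa>' has_derivative dtransition \<kappa>' \<kappa>'' p \<circ> dtransition \<kappa> \<kappa>' p)
      (at (snd \<kappa> p))"
    using diff_chain_at[OF transition_has_derivative[OF \<kappa>(1,2)], of "transition \<kappa>' \<kappa>''" "dtransition \<kappa>' \<kappa>'' p"]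
      transition_has_derivative[OF \<kappa>(2,3)] unfolding tp by blast
  have "(transition \<kappa> \<kappa>'' has_derivative dtransition \<kappa>' \<kappa>'' p \<circ> dtransition \<kappa> \<kappa>' p) (at (snd \<kappa> p))"
  proof (rule has_derivative_transform_within_open[OF 1 open_chart_image[OF A(1) chart_facts(1)[OF A(2)]]])
    show "snd \<kappa> p \<in> snd \<kappa> ` (fst \<kappa> \<inter> fst \<kappa>')" using p by blast
    fix x assume "x \<in> snd \<kappa> ` (fst \<kappa> \<inter> fst \<kappa>')"
    then obtain q where "x = snd \<kappa> q" "q \<in> fst \<kappa>" "q \<in> fst \<kappa>'" by blast
    then show "(transition \<kappa>' \<kappa>'' \<circ> transition \<kappa> \<kappa>') x = transition \<kappa> \<kappa>'' x"
      using chart_facts(6)[OF A(1)] chart_facts(6)[OF A(2)] by (simp add: transition_def)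
  qed
  then have "dtransition \<kappa> \<kappa>'' p = dtransition \<kappa>' \<kappa>'' p \<circ> dtransition \<kappa> \<kappa>' p"
    using transition_has_derivative[OF \<kappa>(1,3)] has_derivative_unique by blast
  then show ?thesis by simp
qed

lemma dtransition_self:
  assumes "\<kappa> \<in> charts_at A p"
  shows "dtransition \<kappa> \<kappa> p u = u"
proof -
  have A: "\<kappa> \<in> A" and p: "p \<in> fst \<kappa>" using assms by (auto simp: charts_at_def)
  have "(transition \<kappa> \<kappa> has_derivative (\<lambda>u. u)) (at (snd \<kappa> p))"
    by (rule has_derivative_transform_within_open[OF has_derivative_ident chart_facts(2)[OF A]])
      (use p chart_facts(7)[OF A] in \<open>auto simp: transition_def\<close>)
  then have "dtransition \<kappa> \<kappa> p = (\<lambda>u. u)"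
    using transition_has_derivative[OF assms assms] has_derivative_unique by blast
  then show ?thesis by simp
qed

lemma coord_vector_in_tangent_space:
  assumes "\<kappa> \<in> charts_at A p"
  shows "coord_vector A \<kappa> p u \<in> tangent_space A p"
  unfolding tangent_space_def
proof (intro CollectI conjI ballI allI impI)
  fix \<kappa>' \<kappa>'' assume "\<kappa>' \<in> charts_at A p" "\<kappa>'' \<in> charts_at A p"
  then show "coord_vector A \<kappa> p u \<kappa>'' = dtransition \<kappa>' \<kappa>'' p (coord_vector A \<kappa> p u \<kappa>')"
    using dtransition_cocycle[OF assms, of \<kappa>' \<kappa>'' u] by (simp add: coord_vector_def)
qed (simp add: coord_vector_def)

lemma coord_vector_self: "\<kappa> \<in> charts_at A p \<Longrightarrow> coord_vector A \<kappa> p u \<kappa> = u"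
  by (simp add: coord_vector_def dtransition_self)

lemma coord_vector_add:
  "\<kappa> \<in> charts_at A p \<Longrightarrow> coord_vector A \<kappa> p (u + v) = (\<lambda>\<kappa>'. coord_vector A \<kappa> p u \<kappa>' + coord_vector A \<kappa> p v \<kappa>')"
  by (auto simp: coord_vector_def linear_add[OF linear_dtransition])

lemma coord_vector_scale:
  "\<kappa> \<in> charts_at A p \<Longrightarrow> coord_vector A \<kappa> p (r *\<^sub>R u) = (\<lambda>\<kappa>'. r *\<^sub>R coord_vector A \<kappa> p u \<kappa>')"
  by (auto simp: coord_vector_def linear_cmul[OF linear_dtransition])

text \<open>Near \<open>t\<close> the curve stays in the domain of \<open>\<kappa>\<close> by
  continuity, and there the second coordinate map is the transition map after the first; the chain
  rule does the rest.\<close>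

lemma has_vector_derivative_transition:
  assumes \<kappa>: "\<kappa> \<in> charts_at A (\<gamma> t)" "\<kappa>' \<in> charts_at A (\<gamma> t)"
    and \<gamma>: "continuous (at t within I) \<gamma>" "t \<in> I"
    and v: "((snd \<kappa> \<circ> \<gamma>) has_vector_derivative v) (at t within I)"
  shows "((snd \<kappa>' \<circ> \<gamma>) has_vector_derivative dtransition \<kappa> \<kappa>' (\<gamma> t) v) (at t within I)"
proof -
  have A: "\<kappa> \<in> A" "\<kappa>' \<in> A" and p: "\<gamma> t \<in> fst \<kappa>" using \<kappa> by (auto simp: charts_at_def)
  have "((transition \<kappa> \<kappa>' \<circ> (snd \<kappa> \<circ> \<gamma>)) has_derivative
      (dtransition \<kappa> \<kappa>' (\<gamma> t) \<circ> (\<lambda>s. s *\<^sub>R v))) (at t within I)"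
    by (rule diff_chain_within[OF v[unfolded has_vector_derivative_def]])
      (use transition_has_derivative[OF \<kappa>] in \<open>auto intro: has_derivative_at_withinI\<close>)
  then have *: "((transition \<kappa> \<kappa>' \<circ> (snd \<kappa> \<circ> \<gamma>)) has_vector_derivative dtransition \<kappa> \<kappa>' (\<gamma> t) v) (at t within I)"
    by (simp add: has_vector_derivative_def o_def linear_cmul[OF linear_dtransition[OF \<kappa>]])
  have "\<forall>\<^sub>F s in at t within I. \<gamma> s \<in> fst \<kappa>"
    using \<gamma>(1) chart_facts(1)[OF A(1)] p by (simp add: continuous_within topological_tendstoD)
  then obtain \<delta> where \<delta>: "0 < \<delta>" "\<And>s. s \<in> I \<Longrightarrow> s \<noteq> t \<Longrightarrow> dist s t < \<delta> \<Longrightarrow> \<gamma> s \<in> fst \<kappa>"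
    unfolding eventually_at by blast
  show ?thesis
  proof (rule has_vector_derivative_transform_within[OF * \<delta>(1) \<gamma>(2)])
    fix s assume "s \<in> I" "dist s t < \<delta>"
    then have "\<gamma> s \<in> fst \<kappa>" using \<delta>(2) p by (cases "s = t") auto
    then show "(transition \<kappa> \<kappa>' \<circ> (snd \<kappa> \<circ> \<gamma>)) s = (snd \<kappa>' \<circ> \<gamma>) s"
      using chart_facts(6)[OF A(1)] by (simp add: transition_def)
  qed
qed

text \<open>One chart determines the velocity in all charts, so it is a tangent vector to which the
  axioms of the metric apply.\<close>

lemma velocity_eq_coord_vector:
  assumes "\<kappa> \<in> charts_at A (\<gamma> t)" "continuous (at t within I) \<gamma>" "t \<in> I" "at t within I \<noteq> bot"
    and "((snd \<kappa> \<circ> \<gamma>) has_vector_derivative v) (at t within I)"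
  shows "velocity A \<gamma> I t = coord_vector A \<kappa> (\<gamma> t) v"
  using has_vector_derivative_transition[OF assms(1) _ assms(2,3,5)] assms(4)
  by (auto simp: velocity_def coord_vector_def vector_derivative_within)

end

section \<open>The metric in coordinates\<close>

context riemannian_manifold
begin

lemma chart_point:
  assumes "\<kappa> \<in> A" "x \<in> snd \<kappa> ` fst \<kappa>"
  shows "\<kappa> \<in> charts_at A (param \<kappa> x)"
  using assms chart_facts(8) by (simp add: charts_at_def)

lemma metric_coeff_coord:
  "\<kappa> \<in> charts_at A p \<Longrightarrow>
    metric_coeff A G \<kappa> (snd \<kappa> p) u v = G p (coord_vector A \<kappa> p u) (coord_vector A \<kappa> p v)"
  using chart_facts(6) by (simp add: metric_coeff_def Let_def charts_at_def)

lemma metric_coeff_param: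
  assumes "\<kappa> \<in> A" "x \<in> snd \<kappa> ` fst \<kappa>"
  shows "metric_coeff A G \<kappa> x u v =
    G (param \<kappa> x) (coord_vector A \<kappa> (param \<kappa> x) u) (coord_vector A \<kappa> (param \<kappa> x) v)"
  by (simp add: metric_coeff_def Let_def)

lemma metric_coeff_sym:
  assumes "\<kappa> \<in> A" "x \<in> snd \<kappa> ` fst \<kappa>"
  shows "metric_coeff A G \<kappa> x u v = metric_coeff A G \<kappa> x v u"
  unfolding metric_coeff_param[OF assms]
  by (intro metric_sym coord_vector_in_tangent_space chart_point assms)

lemma metric_coeff_bilinear:
  assumes x: "\<kappa> \<in> A" "x \<in> snd \<kappa> ` fst \<kappa>"
  shows "bilinear (metric_coeff A G \<kappa> x)"
proof -
  note c = chart_point[OF x]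
  have l: "linear (\<lambda>u. metric_coeff A G \<kappa> x u v)" for v
  proof (rule linearI)
    fix u u' :: 'e and r :: real
    show "metric_coeff A G \<kappa> x (u + u') v = metric_coeff A G \<kappa> x u v + metric_coeff A G \<kappa> x u' v"
      unfolding metric_coeff_param[OF x] coord_vector_add[OF c]
      by (intro metric_add coord_vector_in_tangent_space c)
    show "metric_coeff A G \<kappa> x (r *\<^sub>R u) v = r *\<^sub>R metric_coeff A G \<kappa> x u v"
      unfolding metric_coeff_param[OF x] coord_vector_scale[OF c] real_scaleR_def
      by (intro metric_scale coord_vector_in_tangent_space c)
  qed
  have "metric_coeff A G \<kappa> x u = (\<lambda>v. metric_coeff A G \<kappa> x v u)" for u
    using metric_coeff_sym[OF x] by blast
  then show ?thesis using l unfolding bilinear_def by metis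
qed

lemma metric_coeff_pos:
  assumes x: "\<kappa> \<in> A" "x \<in> snd \<kappa> ` fst \<kappa>" and "u \<noteq> 0"
  shows "0 < metric_coeff A G \<kappa> x u u"
  unfolding metric_coeff_param[OF x]
proof (rule metric_pos[OF coord_vector_in_tangent_space[OF chart_point[OF x]]])
  show "coord_vector A \<kappa> (param \<kappa> x) u \<noteq> (\<lambda>\<kappa>. 0)"
    using coord_vector_self[OF chart_point[OF x], of u] assms(3) by auto
qed

lemma metric_coeff_C2: "\<kappa> \<in> A \<Longrightarrow> Ck_on (Suc (Suc 0)) (snd \<kappa> ` fst \<kappa>) (\<lambda>x. metric_coeff A G \<kappa> x u v)"
  using metric_smooth[of \<kappa> u v] unfolding smooth_on_def by blast

lemma ex_chart_metric_ball:
  assumes "\<kappa> \<in> A" "x0 \<in> snd \<kappa> ` fst \<kappa>"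
  obtains r lam K where "0 < r" "cball x0 r \<subseteq> snd \<kappa> ` fst \<kappa>"
    "metric_ball (cball x0 r) (metric_coeff A G \<kappa>)
       (\<lambda>x w u v. frechet_derivative (\<lambda>y. metric_coeff A G \<kappa> y u v) (at x) w) lam K"
  by (rule ex_metric_ball[OF chart_facts(2)[OF assms(1)] assms(2) metric_coeff_bilinear[OF assms(1)]
        metric_coeff_sym[OF assms(1)] metric_coeff_pos[OF assms(1)] metric_coeff_C2[OF assms(1)]])
    (assumption, assumption, assumption, assumption, rule that)

text \<open>Smoothness is assumed for constant vectors; joint continuity comes from the Lipschitz
  bound of \<open>metric_ball\<close>, whose constant is the same for all vectors.\<close>

lemma continuous_metric_coeff:
  assumes \<kappa>: "\<kappa> \<in> A" and c: "(c \<longlongrightarrow> x) F" and x: "x \<in> snd \<kappa> ` fst \<kappa>" and v: "(v \<longlongrightarrow> w) F"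
  shows "((\<lambda>t. metric_coeff A G \<kappa> (c t) (v t) (v t)) \<longlongrightarrow> metric_coeff A G \<kappa> x w w) F"
proof -
  obtain r lam K where r: "0 < r" "cball x r \<subseteq> snd \<kappa> ` fst \<kappa>"
    and mb: "metric_ball (cball x r) (metric_coeff A G \<kappa>)
       (\<lambda>x w u v. frechet_derivative (\<lambda>y. metric_coeff A G \<kappa> y u v) (at x) w) lam K"
    by (rule ex_chart_metric_ball[OF \<kappa> x]) (rule that)
  interpret metric_ball "cball x r" "metric_coeff A G \<kappa>"
       "\<lambda>x w u v. frechet_derivative (\<lambda>y. metric_coeff A G \<kappa> y u v) (at x) w" lam K by (fact mb)
  have xB: "x \<in> cball x r" using r by simp
  have hb: "bounded_bilinear (metric_coeff A G \<kappa> x)"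
    using bil[OF xB] by (simp add: bilinear_conv_bounded_bilinear)
  have 1: "((\<lambda>t. metric_coeff A G \<kappa> x (v t) (v t)) \<longlongrightarrow> metric_coeff A G \<kappa> x w w) F"
    by (rule bounded_bilinear.tendsto[OF hb v v])
  have "((\<lambda>t. metric_coeff A G \<kappa> (c t) (v t) (v t) - metric_coeff A G \<kappa> x (v t) (v t)) \<longlongrightarrow> 0) F"
  proof (rule Lim_null_comparison)
    have "\<forall>\<^sub>F t in F. c t \<in> ball x r" using c r by (intro topological_tendstoD) auto
    then show "\<forall>\<^sub>F t in F. norm (metric_coeff A G \<kappa> (c t) (v t) (v t) - metric_coeff A G \<kappa> x (v t) (v t))
        \<le> K * norm (c t - x) * norm (v t) * norm (v t)"
      by eventually_elim (use lip[OF xB] in auto)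
    have "((\<lambda>t. K * norm (c t - x) * norm (v t) * norm (v t)) \<longlongrightarrow> K * norm (x - x) * norm w * norm w) F"
      by (intro tendsto_intros c v)
    then show "((\<lambda>t. K * norm (c t - x) * norm (v t) * norm (v t)) \<longlongrightarrow> 0) F" by simp
  qed
  from tendsto_add[OF this 1] show ?thesis by simp
qed

end

section \<open>Length of curves\<close>

lemma at_within_Icc_ne_bot: "(a::real) < b \<Longrightarrow> t \<in> {a..b} \<Longrightarrow> at t within {a..b} \<noteq> bot"
  using trivial_limit_within[of t "{a..b}"] by simp

lemma at_within_Icc_interior: "t \<in> {a<..<b} \<Longrightarrow> at t within {a..b} = at (t::real)"
  by (rule at_within_interior) (simp add: interior_atLeastAtMost_real)

lemma vector_derivative_cong_on:
  assumes "\<And>x. x \<in> S \<Longrightarrow> f x = g x" "t \<in> S"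
  shows "vector_derivative f (at t within S) = vector_derivative g (at t within S)"
  by (rule vector_derivative_cong_eq) (use assms in auto)

text \<open>The inductive form, on arbitrary intervals, lets properties of length be proved for one
  C1 piece and carried across a junction without bookkeeping of break points.\<close>

inductive piecewise_C1_on ::
  "('a::topological_space, 'e::euclidean_space) chart set \<Rightarrow> (real \<Rightarrow> 'a) \<Rightarrow> real \<Rightarrow> real \<Rightarrow> bool"
  for A \<gamma> where
  base: "a < b \<Longrightarrow> C1_curve A {a..b} \<gamma> \<Longrightarrow> piecewise_C1_on A \<gamma> a b"
| join: "piecewise_C1_on A \<gamma> a b \<Longrightarrow> piecewise_C1_on A \<gamma> b c \<Longrightarrow> piecewise_C1_on A \<gamma> a c"

lemma piecewise_C1_on_less: "piecewise_C1_on A \<gamma> a b \<Longrightarrow> a < b"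
  by (induction rule: piecewise_C1_on.induct) auto

lemma piecewise_C1_on_continuous: "piecewise_C1_on A \<gamma> a b \<Longrightarrow> continuous_on {a..b} \<gamma>"
proof (induction rule: piecewise_C1_on.induct)
  case (join a b c)
  have "continuous_on ({a..b} \<union> {b..c}) \<gamma>" using join by (intro continuous_on_closed_Un) auto
  moreover have "{a..b} \<union> {b..c} = {a..c}"
    using join piecewise_C1_on_less by (intro ivl_disj_un_two_touch) fastforce+
  ultimately show ?case by simp
qed (simp add: C1_curve_def)

lemma C1_curve_differentiable:
  assumes "C1_curve A I \<gamma>" "t \<in> I" "\<kappa> \<in> charts_at A (\<gamma> t)"
  shows "((snd \<kappa> \<circ> \<gamma>) has_vector_derivative vector_derivative (snd \<kappa> \<circ> \<gamma>) (at t within I)) (at t within I)"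
  using assms unfolding C1_curve_def by (blast intro: vector_derivative_works[THEN iffD1])

lemma C1_curve_cong:
  assumes "C1_curve A I \<gamma>" "\<And>t. t \<in> I \<Longrightarrow> \<gamma> t = \<gamma>' t"
  shows "C1_curve A I \<gamma>'"
proof -
  have vd: "vector_derivative (snd \<kappa> \<circ> \<gamma>) (at s within I) = vector_derivative (snd \<kappa> \<circ> \<gamma>') (at s within I)"
    if "s \<in> I" for s and \<kappa> :: "('a, 'b) chart"
    by (rule vector_derivative_cong_on) (use that assms(2) in auto)
  have "(snd \<kappa> \<circ> \<gamma>') differentiable (at t within I)" "continuous (at t within I) (\<lambda>s. vector_derivative (snd \<kappa> \<circ> \<gamma>') (at s within I))"
    if "t \<in> I" "\<kappa> \<in> charts_at A (\<gamma>' t)" for t \<kappa>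
  proof -
    have \<kappa>: "\<kappa> \<in> charts_at A (\<gamma> t)" using that assms(2) by simp
    show "(snd \<kappa> \<circ> \<gamma>') differentiable (at t within I)"
      using differentiable_transform_within[of "snd \<kappa> \<circ> \<gamma>" t I 1 "snd \<kappa> \<circ> \<gamma>'"] assms that \<kappa>
      by (auto simp: C1_curve_def)
    show "continuous (at t within I) (\<lambda>s. vector_derivative (snd \<kappa> \<circ> \<gamma>') (at s within I))"
      using continuous_transform_within[of t I "\<lambda>s. vector_derivative (snd \<kappa> \<circ> \<gamma>) (at s within I)" 1
          "\<lambda>s. vector_derivative (snd \<kappa> \<circ> \<gamma>') (at s within I)"] assms that \<kappa> vd
      by (auto simp: C1_curve_def)
  qed
  moreover have "continuous_on I \<gamma>'"
    using assms by (auto simp: C1_curve_def cong: continuous_on_cong)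
  ultimately show ?thesis unfolding C1_curve_def by blast
qed

lemma piecewise_C1_on_cong:
  "piecewise_C1_on A \<gamma> a b \<Longrightarrow> (\<And>t. t \<in> {a..b} \<Longrightarrow> \<gamma> t = \<gamma>' t) \<Longrightarrow> piecewise_C1_on A \<gamma>' a b"
proof (induction rule: piecewise_C1_on.induct)
  case (base a b)
  then show ?case by (intro piecewise_C1_on.base C1_curve_cong[of A "{a..b}" \<gamma> \<gamma>']) auto
next
  case (join a b c)
  have "a < b" "b < c" using join piecewise_C1_on_less by blast+
  then show ?case using join by (intro piecewise_C1_on.join[of A \<gamma>' a b c]) auto
qed

section \<open>Speed, length and affine reparametrization\<close>

context riemannian_manifold
begin

lemma eventually_in_chart:
  assumes "continuous_on I \<gamma>" "t \<in> I" "\<kappa> \<in> charts_at A (\<gamma> t)"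
  obtains \<delta> where "0 < \<delta>" "\<And>s. s \<in> I \<Longrightarrow> dist s t < \<delta> \<Longrightarrow> \<kappa> \<in> charts_at A (\<gamma> s)"
proof -
  have \<kappa>: "\<kappa> \<in> A" "\<gamma> t \<in> fst \<kappa>" using assms(3) by (auto simp: charts_at_def)
  have "(\<gamma> \<longlongrightarrow> \<gamma> t) (at t within I)" using assms(1,2) by (simp add: continuous_on_def)
  then have "\<forall>\<^sub>F s in at t within I. \<gamma> s \<in> fst \<kappa>"
    by (rule topological_tendstoD[OF _ chart_facts(1)[OF \<kappa>(1)] \<kappa>(2)])
  then obtain \<delta> where "0 < \<delta>" "\<And>s. s \<in> I \<Longrightarrow> s \<noteq> t \<Longrightarrow> dist s t < \<delta> \<Longrightarrow> \<gamma> s \<in> fst \<kappa>"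
    unfolding eventually_at by blast
  then show ?thesis using that[of \<delta>] \<kappa> by (metis (mono_tags, lifting) charts_at_def mem_Collect_eq)
qed

text \<open>One statement on affine parameter changes serves restriction, translation, scaling and,
  with \<open>m = -1\<close>, reversal.\<close>

lemma C1_curve_compose:
  assumes C1: "C1_curve A {a..b} \<gamma>" and ab: "a' < b'"
    and im: "(\<lambda>t. m * t + k) ` {a'..b'} \<subseteq> {a..b}"
  shows "C1_curve A {a'..b'} (\<lambda>t. \<gamma> (m * t + k))"
proof -
  let ?f = "\<lambda>t. m * t + k"
  have cont: "continuous_on {a'..b'} (\<lambda>t. \<gamma> (?f t))"
  proof (rule continuous_on_compose2[OF _ _ im])
    show "continuous_on {a..b} \<gamma>" using C1 by (simp add: C1_curve_def)
  qed (intro continuous_intros)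
  have vd: "((snd \<kappa> \<circ> (\<lambda>t. \<gamma> (?f t))) has_vector_derivative
      m *\<^sub>R vector_derivative (snd \<kappa> \<circ> \<gamma>) (at (?f t) within {a..b})) (at t within {a'..b'})"
    if t: "t \<in> {a'..b'}" and \<kappa>: "\<kappa> \<in> charts_at A (\<gamma> (?f t))" for t \<kappa>
  proof -
    have ft: "?f t \<in> {a..b}" using t im by blast
    have "(?f has_vector_derivative m) (at t within {a'..b'})"
      by (auto intro!: derivative_eq_intros)
    from vector_diff_chain_within[OF this
        has_vector_derivative_within_subset[OF C1_curve_differentiable[OF C1 ft \<kappa>] im]]
    show ?thesis by (simp add: o_def)
  qed
  have "(snd \<kappa> \<circ> (\<lambda>t. \<gamma> (?f t))) differentiable (at t within {a'..b'}) \<and>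
     continuous (at t within {a'..b'}) (\<lambda>s. vector_derivative (snd \<kappa> \<circ> (\<lambda>t. \<gamma> (?f t))) (at s within {a'..b'}))"
    if t: "t \<in> {a'..b'}" and \<kappa>: "\<kappa> \<in> charts_at A (\<gamma> (?f t))" for t \<kappa>
  proof
    show "(snd \<kappa> \<circ> (\<lambda>t. \<gamma> (?f t))) differentiable (at t within {a'..b'})"
      using vd[OF t \<kappa>] by (rule differentiableI_vector)
    have ft: "?f t \<in> {a..b}" using t im by blast
    obtain \<delta> where \<delta>: "0 < \<delta>" "\<And>s. s \<in> {a'..b'} \<Longrightarrow> dist s t < \<delta> \<Longrightarrow> \<kappa> \<in> charts_at A (\<gamma> (?f s))"
      using eventually_in_chart[OF cont t \<kappa>] by blast
    have "continuous (at (?f t) within {a..b}) (\<lambda>s. vector_derivative (snd \<kappa> \<circ> \<gamma>) (at s within {a..b}))"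
      using C1 ft \<kappa> unfolding C1_curve_def by blast
    from continuous_within_subset[OF this im] have "continuous (at t within {a'..b'}) ((\<lambda>s. vector_derivative (snd \<kappa> \<circ> \<gamma>) (at s within {a..b})) \<circ> ?f)"
      by (intro continuous_within_compose continuous_intros)
    then have "continuous (at t within {a'..b'}) (\<lambda>s. m *\<^sub>R vector_derivative (snd \<kappa> \<circ> \<gamma>) (at (?f s) within {a..b}))"
      by (intro continuous_intros) (simp add: o_def)
    then show "continuous (at t within {a'..b'}) (\<lambda>s. vector_derivative (snd \<kappa> \<circ> (\<lambda>t. \<gamma> (?f t))) (at s within {a'..b'}))"
    proof (rule continuous_transform_within[OF _ \<delta>(1) t])
      fix s assume s: "s \<in> {a'..b'}" "dist s t < \<delta>"
      show "m *\<^sub>R vector_derivative (snd \<kappa> \<circ> \<gamma>) (at (?f s) within {a..b}) =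
          vector_derivative (snd \<kappa> \<circ> (\<lambda>t. \<gamma> (?f t))) (at s within {a'..b'})"
        using vector_derivative_within[OF at_within_Icc_ne_bot[OF ab s(1)] vd[OF s(1) \<delta>(2)[OF s]]] by simp
    qed
  qed
  then show ?thesis using cont unfolding C1_curve_def by blast
qed

lemma C1_curve_subset:
  "C1_curve A {a..b} \<gamma> \<Longrightarrow> a \<le> s \<Longrightarrow> s < t \<Longrightarrow> t \<le> b \<Longrightarrow> C1_curve A {s..t} \<gamma>"
  using C1_curve_compose[of a b \<gamma> s t 1 0] by simp

lemma piecewise_C1_on_subset:
  "piecewise_C1_on A \<gamma> a b \<Longrightarrow> a \<le> s \<Longrightarrow> s < t \<Longrightarrow> t \<le> b \<Longrightarrow> piecewise_C1_on A \<gamma> s t"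
proof (induction arbitrary: s t rule: piecewise_C1_on.induct)
  case (base a b)
  then show ?case using C1_curve_subset[OF base(2), of s t] by (simp add: piecewise_C1_on.base)
next
  case (join a b c)
  consider "t \<le> b" | "b \<le> s" | "s < b" "b < t" by linarith
  then show ?case
  proof cases
    case 1
    then show ?thesis using join.IH(1) join.prems by blast
  next
    case 2
    then show ?thesis using join.IH(2) join.prems by blast
  next
    case 3
    have "piecewise_C1_on A \<gamma> s b" using 3 join.prems by (intro join.IH(1)) auto
    moreover have "piecewise_C1_on A \<gamma> b t" using 3 join.prems by (intro join.IH(2)) auto
    ultimately show ?thesis by (rule piecewise_C1_on.join)
  qed
qed

text \<open>The velocity is two-sided, so that the speed does not depend on the interval; this changes the
  integrand of the length at the endpoints only.\<close>

definition speed :: "(real \<Rightarrow> 'a) \<Rightarrow> real \<Rightarrow> real" where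
  "speed \<gamma> t = sqrt (G (\<gamma> t) (velocity A \<gamma> UNIV t) (velocity A \<gamma> UNIV t))"

lemma norm_velocity_eq:
  assumes "\<kappa> \<in> charts_at A (\<gamma> t)" "t \<in> {a..b}" "a < b" "continuous_on {a..b} \<gamma>"
    and "((snd \<kappa> \<circ> \<gamma>) has_vector_derivative v) (at t within {a..b})"
  shows "G (\<gamma> t) (velocity A \<gamma> {a..b} t) (velocity A \<gamma> {a..b} t) = metric_coeff A G \<kappa> (snd \<kappa> (\<gamma> t)) v v"
proof -
  have "velocity A \<gamma> {a..b} t = coord_vector A \<kappa> (\<gamma> t) v"
    by (rule velocity_eq_coord_vector[OF assms(1) _ assms(2) at_within_Icc_ne_bot[OF assms(3,2)] assms(5)])
      (use assms(2,4) in \<open>simp add: continuous_on_eq_continuous_within\<close>)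
  then show ?thesis using metric_coeff_coord[OF assms(1)] by simp
qed

lemma speed_eq_within:
  assumes "t \<in> {a<..<b}"
  shows "speed \<gamma> t = sqrt (G (\<gamma> t) (velocity A \<gamma> {a..b} t) (velocity A \<gamma> {a..b} t))"
  unfolding speed_def velocity_def at_within_Icc_interior[OF assms] ..

lemma speed_eq:
  assumes "\<kappa> \<in> charts_at A (\<gamma> t)" "t \<in> {a<..<b}" "continuous_on {a..b} \<gamma>"
    and "((snd \<kappa> \<circ> \<gamma>) has_vector_derivative v) (at t within {a..b})"
  shows "speed \<gamma> t = sqrt (metric_coeff A G \<kappa> (snd \<kappa> (\<gamma> t)) v v)"
  using norm_velocity_eq[OF assms(1) _ _ assms(3,4)] assms(2) by (simp add: speed_eq_within[of t a b])

lemma speed_cong: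
  assumes "\<And>s. s \<in> {a<..<b} \<Longrightarrow> \<gamma> s = \<gamma>' s" "t \<in> {a<..<b}"
  shows "speed \<gamma> t = speed \<gamma>' t"
proof -
  have "\<forall>\<^sub>F s in nhds t. s \<in> {a<..<b}" using assms(2) by (intro eventually_nhds_in_open) auto
  then have "\<forall>\<^sub>F s in nhds t. s \<in> UNIV \<longrightarrow> (snd \<kappa> \<circ> \<gamma>) s = (snd \<kappa> \<circ> \<gamma>') s" for \<kappa> :: "('a, 'e) chart"
    by eventually_elim (use assms(1) in auto)
  then have "vector_derivative (snd \<kappa> \<circ> \<gamma>) (at t) = vector_derivative (snd \<kappa> \<circ> \<gamma>') (at t)" for \<kappa> :: "('a, 'e) chart"
    by (rule vector_derivative_cong_eq) auto
  then have "velocity A \<gamma> UNIV t = velocity A \<gamma>' UNIV t"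
    using assms by (intro ext) (simp add: velocity_def)
  then show ?thesis using assms by (simp add: speed_def)
qed

text \<open>\<open>sqrt\<close> is negative at negative arguments, so the sign has to come from the
  positivity of the metric.\<close>

lemma speed_nonneg:
  assumes "continuous_on {a..b} \<gamma>" "C1_curve A {a..b} \<gamma>" "t \<in> {a<..<b}"
  shows "0 \<le> speed \<gamma> t"
proof -
  obtain \<kappa> where \<kappa>: "\<kappa> \<in> charts_at A (\<gamma> t)" using ex_chart by blast
  have t: "t \<in> {a..b}" using assms(3) by auto
  let ?v = "vector_derivative (snd \<kappa> \<circ> \<gamma>) (at t within {a..b})"
  have x: "\<kappa> \<in> A" "snd \<kappa> (\<gamma> t) \<in> snd \<kappa> ` fst \<kappa>" using \<kappa> by (auto simp: charts_at_def)
  have "0 \<le> metric_coeff A G \<kappa> (snd \<kappa> (\<gamma> t)) ?v ?v"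
    using metric_coeff_pos[OF x, of ?v] bilinear_lzero[OF metric_coeff_bilinear[OF x]] by (cases "?v = 0") auto
  then show ?thesis
    using speed_eq[OF \<kappa> assms(3,1) C1_curve_differentiable[OF assms(2) t \<kappa>]] by simp
qed

text \<open>The one-sided speed is continuous up to the ends, where the two-sided
  \<open>speed\<close> may take unrelated values; two points do not affect the integral.\<close>

lemma C1_speed_integrable:
  assumes ab: "a < b" and C1: "C1_curve A {a..b} \<gamma>"
  shows "speed \<gamma> integrable_on {a..b}"
proof -
  let ?sp = "\<lambda>t. sqrt (G (\<gamma> t) (velocity A \<gamma> {a..b} t) (velocity A \<gamma> {a..b} t))"
  have cont: "continuous_on {a..b} \<gamma>" using C1 by (simp add: C1_curve_def)
  have "continuous_on {a..b} ?sp"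
    unfolding continuous_on_def
  proof
    fix t assume t: "t \<in> {a..b}"
    obtain \<kappa> where \<kappa>: "\<kappa> \<in> charts_at A (\<gamma> t)" using ex_chart by blast
    obtain \<delta> where \<delta>: "0 < \<delta>" "\<And>s. s \<in> {a..b} \<Longrightarrow> dist s t < \<delta> \<Longrightarrow> \<kappa> \<in> charts_at A (\<gamma> s)"
      using eventually_in_chart[OF cont t \<kappa>] by blast
    have x: "\<kappa> \<in> A" "snd \<kappa> (\<gamma> t) \<in> snd \<kappa> ` fst \<kappa>" using \<kappa> by (auto simp: charts_at_def)
    let ?w = "\<lambda>s. vector_derivative (snd \<kappa> \<circ> \<gamma>) (at s within {a..b})"
    have eq: "?sp s = sqrt (metric_coeff A G \<kappa> (snd \<kappa> (\<gamma> s)) (?w s) (?w s))"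
      if "s \<in> {a..b}" "dist s t < \<delta>" for s
      using norm_velocity_eq[OF \<delta>(2)[OF that] that(1) ab cont C1_curve_differentiable[OF C1 that(1) \<delta>(2)[OF that]]]
      by simp
    have "((snd \<kappa> \<circ> \<gamma>) \<longlongrightarrow> (snd \<kappa> \<circ> \<gamma>) t) (at t within {a..b})"
      using has_vector_derivative_continuous[OF C1_curve_differentiable[OF C1 t \<kappa>]] by (simp add: continuous_within)
    moreover have "(?w \<longlongrightarrow> ?w t) (at t within {a..b})"
      using C1 t \<kappa> by (auto simp: C1_curve_def continuous_within)
    ultimately have "((\<lambda>s. sqrt (metric_coeff A G \<kappa> (snd \<kappa> (\<gamma> s)) (?w s) (?w s))) \<longlongrightarrow>
        sqrt (metric_coeff A G \<kappa> (snd \<kappa> (\<gamma> t)) (?w t) (?w t))) (at t within {a..b})"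
      by (intro tendsto_real_sqrt continuous_metric_coeff x) (auto simp: o_def)
    moreover have "\<forall>\<^sub>F s in at t within {a..b}. sqrt (metric_coeff A G \<kappa> (snd \<kappa> (\<gamma> s)) (?w s) (?w s)) = ?sp s"
      unfolding eventually_at using \<delta>(1) eq by force
    ultimately show "(?sp \<longlongrightarrow> ?sp t) (at t within {a..b})"
      using eq[OF t] \<delta>(1) by (auto intro: Lim_transform_eventually)
  qed
  then have "?sp integrable_on {a..b}" by (rule integrable_continuous_interval)
  then show ?thesis
    by (rule integrable_spike_finite[of "{a, b}", rotated 2]) (auto intro!: speed_eq_within)
qed

lemma speed_integrable: "piecewise_C1_on A \<gamma> a b \<Longrightarrow> speed \<gamma> integrable_on {a..b}"
proof (induction rule: piecewise_C1_on.induct)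
  case (join a b c)
  then show ?case using piecewise_C1_on_less[OF join(1)] piecewise_C1_on_less[OF join(2)]
    by (intro Henstock_Kurzweil_Integration.integrable_combine[of a b c]) auto
qed (rule C1_speed_integrable)

lemma length_split:
  "piecewise_C1_on A \<gamma> a b \<Longrightarrow> a \<le> c \<Longrightarrow> c \<le> b \<Longrightarrow>
    integral {a..b} (speed \<gamma>) = integral {a..c} (speed \<gamma>) + integral {c..b} (speed \<gamma>)"
  using Henstock_Kurzweil_Integration.integral_combine[of a c b "speed \<gamma>"] speed_integrable by simp

lemma length_nonneg: "piecewise_C1_on A \<gamma> a b \<Longrightarrow> 0 \<le> integral {a..b} (speed \<gamma>)"
proof (induction rule: piecewise_C1_on.induct)
  case (base a b)
  have "integral {a..b} (speed \<gamma>) = integral {a..b} (\<lambda>t. if t \<in> {a, b} then 0 else speed \<gamma> t)"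
    by (rule integral_spike[of "{a, b}"]) auto
  also have "0 \<le> \<dots>"
  proof (rule Henstock_Kurzweil_Integration.integral_nonneg)
    show "(\<lambda>t. if t \<in> {a, b} then 0 else speed \<gamma> t) integrable_on {a..b}"
      by (rule integrable_spike_finite[OF _ _ C1_speed_integrable[OF base], of "{a, b}"]) auto
    show "0 \<le> (if t \<in> {a, b} then 0 else speed \<gamma> t)" if "t \<in> {a..b}" for t
      using speed_nonneg[of a b \<gamma> t] base that by (auto simp: C1_curve_def)
  qed
  finally show ?case .
next
  case (join a b c)
  then show ?case using length_split[OF piecewise_C1_on.join[OF join(1,2)], of b]
      piecewise_C1_on_less[OF join(1)] piecewise_C1_on_less[OF join(2)] by simp
qed

lemma length_cong:
  assumes "\<And>t. t \<in> {a<..<b} \<Longrightarrow> \<gamma> t = \<gamma>' t"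
  shows "integral {a..b} (speed \<gamma>) = integral {a..b} (speed \<gamma>')"
  by (rule integral_spike[of "{a, b}"]) (auto intro!: speed_cong[of a b] simp: assms)

text \<open>Substitution in the integral; its factor \<open>\<bar>m\<bar>\<close> cancels against
  the homogeneity of the metric norm.\<close>

lemma C1_length_compose:
  assumes C1: "C1_curve A {a..b} \<gamma>" and ab: "a' < b'" "a < b" and m: "m \<noteq> 0"
    and im: "(\<lambda>t. m * t + k) ` {a'..b'} = {a..b}"
  shows "integral {a'..b'} (speed (\<lambda>t. \<gamma> (m * t + k))) = integral {a..b} (speed \<gamma>)"
proof -
  let ?f = "\<lambda>t. m * t + k"
  have cont: "continuous_on {a..b} \<gamma>" using C1 by (simp add: C1_curve_def)
  note C1' = C1_curve_compose[OF C1 ab(1) equalityD1[OF im]]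
  have cont': "continuous_on {a'..b'} (\<lambda>t. \<gamma> (?f t))" using C1' by (simp add: C1_curve_def)
  have "((\<lambda>x. x) \<circ> (\<lambda>x. (1 / m) *\<^sub>R x + - ((1 / m) *\<^sub>R k))) ` {a..b} = {a'..b'}"
    unfolding im[symmetric] using m by (force simp: field_simps image_iff)
  then have "((\<lambda>x. speed \<gamma> (m *\<^sub>R x + k)) has_integral (1 / \<bar>m\<bar>) *\<^sub>R integral {a..b} (speed \<gamma>)) {a'..b'}"
    using has_integral_affinity[of "speed \<gamma>" "integral {a..b} (speed \<gamma>)" a b m k] m
      integrable_integral[OF C1_speed_integrable[OF ab(2) C1]] by (simp add: o_def)
  from has_integral_mult_right[OF this, of "\<bar>m\<bar>"]
  have 1: "((\<lambda>x. \<bar>m\<bar> * speed \<gamma> (?f x)) has_integral integral {a..b} (speed \<gamma>)) {a'..b'}"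
    using m by simp
  have "(speed (\<lambda>t. \<gamma> (?f t)) has_integral integral {a..b} (speed \<gamma>)) {a'..b'}"
  proof (rule has_integral_spike_finite[OF _ _ 1, of "{a', b'}"])
    fix t assume "t \<in> {a'..b'} - {a', b'}"
    then have t: "t \<in> {a'<..<b'}" "t \<in> {a'..b'}" by auto
    have ft: "?f t \<in> {a..b}" using t im by blast
    have endp: "?f a' \<in> {a..b}" "?f b' \<in> {a..b}" using ab im by (metis atLeastAtMost_iff imageI less_imp_le order_refl)+
    have ft': "?f t \<in> {a<..<b}"
    proof (cases "0 < m")
      case True
      then have "?f a' < ?f t" "?f t < ?f b'" using t by auto
      then show ?thesis using endp by auto
    next
      case False
      then have "?f b' < ?f t" "?f t < ?f a'" using t m by auto
      then show ?thesis using endp by auto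
    qed
    obtain \<kappa> where \<kappa>: "\<kappa> \<in> charts_at A (\<gamma> (?f t))" using ex_chart by blast
    let ?w = "vector_derivative (snd \<kappa> \<circ> \<gamma>) (at (?f t) within {a..b})"
    have w: "((snd \<kappa> \<circ> \<gamma>) has_vector_derivative ?w) (at (?f t) within {a..b})"
      by (rule C1_curve_differentiable[OF C1 ft \<kappa>])
    have "(?f has_vector_derivative m) (at t within {a'..b'})"
      by (auto intro!: derivative_eq_intros)
    from vector_diff_chain_within[OF this, unfolded im, OF w]
    have w': "((snd \<kappa> \<circ> (\<lambda>t. \<gamma> (?f t))) has_vector_derivative m *\<^sub>R ?w) (at t within {a'..b'})"
      by (simp add: o_def)
    have x: "\<kappa> \<in> A" "snd \<kappa> (\<gamma> (?f t)) \<in> snd \<kappa> ` fst \<kappa>" using \<kappa> by (auto simp: charts_at_def)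
    have "speed (\<lambda>t. \<gamma> (?f t)) t = sqrt (metric_coeff A G \<kappa> (snd \<kappa> (\<gamma> (?f t))) (m *\<^sub>R ?w) (m *\<^sub>R ?w))"
      by (rule speed_eq[OF _ t(1) cont' w']) (rule \<kappa>)
    also have "\<dots> = sqrt (m\<^sup>2 * metric_coeff A G \<kappa> (snd \<kappa> (\<gamma> (?f t))) ?w ?w)"
      using metric_coeff_bilinear[OF x] by (simp add: bilinear_lmul bilinear_rmul power2_eq_square mult.assoc)
    also have "\<dots> = \<bar>m\<bar> * speed \<gamma> (?f t)"
      using speed_eq[OF \<kappa> ft' cont w] by (simp add: real_sqrt_mult)
    finally show "speed (\<lambda>t. \<gamma> (?f t)) t = \<bar>m\<bar> * speed \<gamma> (?f t)" .
  qed simp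
  then show ?thesis by (rule integral_unique)
qed

lemma piecewise_C1_on_scale:
  assumes "piecewise_C1_on A \<gamma> a b" "0 < m"
  shows "piecewise_C1_on A (\<lambda>t. \<gamma> (m * t + k)) ((a - k) / m) ((b - k) / m) \<and>
    integral {(a - k) / m..(b - k) / m} (speed (\<lambda>t. \<gamma> (m * t + k))) = integral {a..b} (speed \<gamma>)"
  using assms(1)
proof (induction rule: piecewise_C1_on.induct)
  case (base a b)
  have ab: "(a - k) / m < (b - k) / m" using base assms by (simp add: divide_strict_right_mono)
  have im: "(\<lambda>t. m * t + k) ` {(a - k) / m..(b - k) / m} = {a..b}"
    using assms ab base by (simp add: image_affinity_atLeastAtMost)
  show ?case
    using C1_curve_compose[OF base(2) ab equalityD1[OF im]] C1_length_compose[OF base(2) ab base(1) _ im] ab assms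
    by (auto intro: piecewise_C1_on.base)
next
  case (join a b c)
  have l: "a < b" "b < c" using join(1,2) piecewise_C1_on_less by blast+
  have l': "(a - k) / m \<le> (b - k) / m" "(b - k) / m \<le> (c - k) / m"
    using l assms by (auto intro!: divide_right_mono)
  have p: "piecewise_C1_on A (\<lambda>t. \<gamma> (m * t + k)) ((a - k) / m) ((c - k) / m)"
    using join by (blast intro: piecewise_C1_on.join)
  show ?case
    using p length_split[OF p l'] length_split[OF piecewise_C1_on.join[OF join(1,2)], of b] l join by simp
qed

lemma piecewise_C1_on_reverse:
  assumes "piecewise_C1_on A \<gamma> a b"
  shows "piecewise_C1_on A (\<lambda>t. \<gamma> (- t)) (- b) (- a) \<and>
    integral {- b..- a} (speed (\<lambda>t. \<gamma> (- t))) = integral {a..b} (speed \<gamma>)"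
  using assms
proof (induction rule: piecewise_C1_on.induct)
  case (base a b)
  have im: "(\<lambda>t. (- 1) * t + 0) ` {- b..- a} = {a..b}" by simp
  show ?case
    using C1_curve_compose[OF base(2) _ equalityD1[OF im]] C1_length_compose[OF base(2) _ base(1) _ im] base(1)
    by (auto intro: piecewise_C1_on.base)
next
  case (join a b c)
  have l: "a < b" "b < c" using join(1,2) piecewise_C1_on_less by blast+
  have p: "piecewise_C1_on A (\<lambda>t. \<gamma> (- t)) (- c) (- a)"
    using join by (blast intro: piecewise_C1_on.join)
  show ?case
    using p length_split[OF p, of "- b"] length_split[OF piecewise_C1_on.join[OF join(1,2)], of b] l join by simp
qed

lemma piecewise_C1_on_append:
  assumes "piecewise_C1_on A \<gamma> a b" "piecewise_C1_on A \<gamma>' b c" "\<gamma> b = \<gamma>' b"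
  defines "\<beta> \<equiv> \<lambda>t. if t \<le> b then \<gamma> t else \<gamma>' t"
  shows "piecewise_C1_on A \<beta> a c"
    "integral {a..c} (speed \<beta>) = integral {a..b} (speed \<gamma>) + integral {b..c} (speed \<gamma>')"
proof -
  have p: "piecewise_C1_on A \<beta> a b" "piecewise_C1_on A \<beta> b c"
    using assms(3) by (auto intro!: piecewise_C1_on_cong[OF assms(1)] piecewise_C1_on_cong[OF assms(2)] simp: \<beta>_def)
  then show 1: "piecewise_C1_on A \<beta> a c" by (rule piecewise_C1_on.join)
  have "integral {a..b} (speed \<gamma>) = integral {a..b} (speed \<beta>)" "integral {b..c} (speed \<gamma>') = integral {b..c} (speed \<beta>)"
    by (auto intro!: length_cong simp: \<beta>_def)
  then show "integral {a..c} (speed \<beta>) = integral {a..b} (speed \<gamma>) + integral {b..c} (speed \<gamma>')"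
    using length_split[OF 1, of b] p[THEN piecewise_C1_on_less] by simp
qed

end

section \<open>Comparison of length with coordinates\<close>

lemma piecewise_C1_on_partition:
  "piecewise_C1_on A \<gamma> a b \<Longrightarrow> \<exists>S. finite S \<and> {a, b} \<subseteq> S \<and> S \<subseteq> {a..b} \<and>
     (\<forall>x\<in>S. \<forall>y\<in>S. x < y \<and> {x<..<y} \<inter> S = {} \<longrightarrow> C1_curve A {x..y} \<gamma>)"
proof (induction rule: piecewise_C1_on.induct)
  case (base a b)
  then show ?case by (intro exI[of _ "{a, b}"]) auto
next
  case (join a b c)
  have l: "a < b" "b < c" using join(1,2) piecewise_C1_on_less by blast+
  obtain S where S: "finite S" "{a, b} \<subseteq> S" "S \<subseteq> {a..b}"
    "\<And>x y. x \<in> S \<Longrightarrow> y \<in> S \<Longrightarrow> x < y \<Longrightarrow> {x<..<y} \<inter> S = {} \<Longrightarrow> C1_curve A {x..y} \<gamma>"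
    using join.IH(1) by metis
  obtain S' where S': "finite S'" "{b, c} \<subseteq> S'" "S' \<subseteq> {b..c}"
    "\<And>x y. x \<in> S' \<Longrightarrow> y \<in> S' \<Longrightarrow> x < y \<Longrightarrow> {x<..<y} \<inter> S' = {} \<Longrightarrow> C1_curve A {x..y} \<gamma>"
    using join.IH(2) by metis
  show ?case
  proof (intro exI[of _ "S \<union> S'"] conjI ballI impI)
    fix x y assume xy: "x \<in> S \<union> S'" "y \<in> S \<union> S'" "x < y \<and> {x<..<y} \<inter> (S \<union> S') = {}"
    have "b \<in> S \<union> S'" using S by blast
    then have "b \<notin> {x<..<y}" using xy(3) by blast
    then consider "y \<le> b" | "b \<le> x" by fastforce
    then show "C1_curve A {x..y} \<gamma>"
    proof cases
      case 1
      then have "x \<in> S" "y \<in> S" using xy S(2,3) S'(3) by fastforce+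
      then show ?thesis using S(4) xy(3) by blast
    next
      case 2
      then have "x \<in> S'" "y \<in> S'" using xy S'(2,3) S(3) by fastforce+
      then show ?thesis using S'(4) xy(3) by blast
    qed
  qed (use S S' l in auto)
qed

text \<open>Induction on the number of break points, cutting at one in the interior.\<close>

lemma partition_piecewise_C1_on:
  assumes "finite S" "a < b" "{a, b} \<subseteq> S" "S \<subseteq> {a..b}"
    "\<And>x y. x \<in> S \<Longrightarrow> y \<in> S \<Longrightarrow> x < y \<Longrightarrow> {x<..<y} \<inter> S = {} \<Longrightarrow> C1_curve A {x..y} \<gamma>"
  shows "piecewise_C1_on A \<gamma> a b"
  using assms
proof (induction "card S" arbitrary: S a b rule: less_induct)
  case less
  show ?case
  proof (cases "{a<..<b} \<inter> S = {}")
    case True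
    then show ?thesis using less.prems by (intro piecewise_C1_on.base) auto
  next
    case False
    then obtain c where c: "c \<in> S" "a < c" "c < b" by auto
    have "piecewise_C1_on A \<gamma> a c"
    proof (rule less.hyps[of "S \<inter> {a..c}"])
      have "b \<in> S - {a..c}" using less.prems(3) c by simp
      then have "S \<inter> {a..c} \<subset> S" by blast
      then show "card (S \<inter> {a..c}) < card S" by (rule psubset_card_mono[OF less.prems(1)])
      fix x y assume xy: "x \<in> S \<inter> {a..c}" "y \<in> S \<inter> {a..c}" "x < y" "{x<..<y} \<inter> (S \<inter> {a..c}) = {}"
      then have "{x<..<y} \<inter> S = {}" by fastforce
      then show "C1_curve A {x..y} \<gamma>" using less.prems(5) xy by blast
    qed (use less.prems c in auto)
    moreover have "piecewise_C1_on A \<gamma> c b"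
    proof (rule less.hyps[of "S \<inter> {c..b}"])
      have "a \<in> S - {c..b}" using less.prems(3) c by simp
      then have "S \<inter> {c..b} \<subset> S" by blast
      then show "card (S \<inter> {c..b}) < card S" by (rule psubset_card_mono[OF less.prems(1)])
      fix x y assume xy: "x \<in> S \<inter> {c..b}" "y \<in> S \<inter> {c..b}" "x < y" "{x<..<y} \<inter> (S \<inter> {c..b}) = {}"
      then have "{x<..<y} \<inter> S = {}" by fastforce
      then show "C1_curve A {x..y} \<gamma>" using less.prems(5) xy by blast
    qed (use less.prems c in auto)
    ultimately show ?thesis by (rule piecewise_C1_on.join)
  qed
qed

lemma piecewise_C1_curve_iff: "piecewise_C1_curve A \<gamma> \<longleftrightarrow> piecewise_C1_on A \<gamma> 0 1"
proof
  assume "piecewise_C1_curve A \<gamma>"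
  then obtain S where "finite S \<and> {0, 1} \<subseteq> S \<and> S \<subseteq> {0..1} \<and>
      (\<forall>x\<in>S. \<forall>y\<in>S. x < y \<and> {x<..<y} \<inter> S = {} \<longrightarrow> C1_curve A {x..y} \<gamma>)"
    unfolding piecewise_C1_curve_def by blast
  then show "piecewise_C1_on A \<gamma> 0 1"
    by (intro partition_piecewise_C1_on[of S]) simp_all
next
  assume *: "piecewise_C1_on A \<gamma> 0 1"
  show "piecewise_C1_curve A \<gamma>"
    unfolding piecewise_C1_curve_def
    using piecewise_C1_on_continuous[OF *] piecewise_C1_on_partition[OF *] by blast
qed

section \<open>Curves between two points and their length in a chart\<close>

context riemannian_manifold
begin

lemma curve_length_eq: "curve_length A G \<gamma> = integral {0..1} (speed \<gamma>)"
  unfolding curve_length_def by (rule integral_spike[of "{0, 1}"]) (auto intro!: speed_eq_within)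

text \<open>The parameter interval is free, so concatenation and reversal need no normalization;
  affine scaling shows that the lengths are the same as those over \<open>{0..1}\<close>.\<close>

definition curve_from :: "'a \<Rightarrow> 'a \<Rightarrow> real \<Rightarrow> bool" where
  "curve_from p q l \<longleftrightarrow> (\<exists>\<gamma> a b. piecewise_C1_on A \<gamma> a b \<and> \<gamma> a = p \<and> \<gamma> b = q \<and> integral {a..b} (speed \<gamma>) = l)"

lemma curve_from_unit:
  assumes "curve_from p q l"
  obtains \<gamma> where "piecewise_C1_on A \<gamma> 0 1" "\<gamma> 0 = p" "\<gamma> 1 = q" "integral {0..1} (speed \<gamma>) = l"
proof -
  obtain \<gamma> a b where \<gamma>: "piecewise_C1_on A \<gamma> a b" "\<gamma> a = p" "\<gamma> b = q" "integral {a..b} (speed \<gamma>) = l"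
    using assms unfolding curve_from_def by blast
  have "a < b" using \<gamma>(1) by (rule piecewise_C1_on_less)
  then show ?thesis
    using piecewise_C1_on_scale[OF \<gamma>(1), of "b - a" a] \<gamma> by (intro that[of "\<lambda>t. \<gamma> ((b - a) * t + a)"]) auto
qed

lemma curve_from_sym: "curve_from p q l \<Longrightarrow> curve_from q p l"
proof -
  assume "curve_from p q l"
  then obtain \<gamma> a b where \<gamma>: "piecewise_C1_on A \<gamma> a b" "\<gamma> a = p" "\<gamma> b = q" "integral {a..b} (speed \<gamma>) = l"
    unfolding curve_from_def by blast
  show ?thesis unfolding curve_from_def
    using piecewise_C1_on_reverse[OF \<gamma>(1)] \<gamma>
    by (intro exI[of _ "\<lambda>t. \<gamma> (- t)"] exI[of _ "- b"] exI[of _ "- a"]) auto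
qed

lemma curve_from_trans: "curve_from p q l \<Longrightarrow> curve_from q r l' \<Longrightarrow> curve_from p r (l + l')"
proof -
  assume "curve_from p q l" "curve_from q r l'"
  then obtain \<gamma> a b \<gamma>' a' b' where \<gamma>: "piecewise_C1_on A \<gamma> a b" "\<gamma> a = p" "\<gamma> b = q" "integral {a..b} (speed \<gamma>) = l"
    and \<gamma>': "piecewise_C1_on A \<gamma>' a' b'" "\<gamma>' a' = q" "\<gamma>' b' = r" "integral {a'..b'} (speed \<gamma>') = l'"
    unfolding curve_from_def by blast
  \<comment> \<open>The second curve is translated to start at the parameter
    \<open>b\<close>.\<close>
  define \<beta>' where "\<beta>' t = \<gamma>' (1 * t + (a' - b))" for t
  have \<beta>': "piecewise_C1_on A \<beta>' b (b' - a' + b)" "integral {b..b' - a' + b} (speed \<beta>') = l'"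
    using piecewise_C1_on_scale[OF \<gamma>'(1), of 1 "a' - b"] \<gamma>'(4) unfolding \<beta>'_def by (simp_all add: algebra_simps)
  have e: "\<gamma> b = \<beta>' b" by (simp add: \<beta>'_def \<gamma> \<gamma>')
  have l: "a < b" "a' < b'" using \<gamma>(1) \<gamma>'(1) piecewise_C1_on_less by blast+
  define \<beta> where "\<beta> t = (if t \<le> b then \<gamma> t else \<beta>' t)" for t
  have "piecewise_C1_on A \<beta> a (b' - a' + b) \<and> \<beta> a = p \<and> \<beta> (b' - a' + b) = r \<and>
      integral {a..b' - a' + b} (speed \<beta>) = l + l'"
  proof (intro conjI)
    have "\<beta> = (\<lambda>t. if t \<le> b then \<gamma> t else \<beta>' t)" by (rule ext) (rule \<beta>_def)
    note * = piecewise_C1_on_append[OF \<gamma>(1) \<beta>'(1) e, folded this]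
    show "piecewise_C1_on A \<beta> a (b' - a' + b)" by (rule *(1))
    show "integral {a..b' - a' + b} (speed \<beta>) = l + l'" using *(2) \<gamma>(4) \<beta>'(2) by simp
  qed (use \<gamma> \<gamma>' l in \<open>auto simp: \<beta>_def \<beta>'_def\<close>)
  then show ?thesis unfolding curve_from_def by blast
qed

lemma curve_from_nonneg: "curve_from p q l \<Longrightarrow> 0 \<le> l"
  unfolding curve_from_def using length_nonneg by blast

lemma riemannian_dist_eq: "riemannian_dist A G p q = Inf {l. curve_from p q l}"
proof -
  have "{curve_length A G \<gamma> | \<gamma>. piecewise_C1_curve A \<gamma> \<and> \<gamma> 0 = p \<and> \<gamma> 1 = q} = {l. curve_from p q l}"
    (is "?L = ?R")
  proof (intro equalityI subsetI)
    show "l \<in> ?R" if "l \<in> ?L" for l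
      using that unfolding curve_length_eq piecewise_C1_curve_iff curve_from_def by blast
    show "l \<in> ?L" if "l \<in> ?R" for l
    proof -
      have "curve_from p q l" using that by simp
      from curve_from_unit[OF this] show ?thesis
        unfolding curve_length_eq piecewise_C1_curve_iff by blast
    qed
  qed
  then show ?thesis unfolding riemannian_dist_def by simp
qed

lemma riemannian_dist_le: "curve_from p q l \<Longrightarrow> riemannian_dist A G p q \<le> l"
  unfolding riemannian_dist_eq by (rule cInf_lower) (auto intro: bdd_belowI[of _ 0] curve_from_nonneg)

text \<open>In \<open>\<kappa>\<close> the derivative of the curve is constant; any other chart sees
  its image under the derivative of the transition map, which is continuous.\<close>

lemma segment_curve:
  assumes \<kappa>: "\<kappa> \<in> A" and C: "convex C" "C \<subseteq> snd \<kappa> ` fst \<kappa>" "x \<in> C" "y \<in> C"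
  defines "\<gamma> \<equiv> \<lambda>t. param \<kappa> (x + t *\<^sub>R (y - x))"
  shows "C1_curve A {0..1} \<gamma>"
    "\<And>t. t \<in> {0<..<1} \<Longrightarrow> speed \<gamma> t = sqrt (metric_coeff A G \<kappa> (x + t *\<^sub>R (y - x)) (y - x) (y - x))"
proof -
  define c where "c t = x + t *\<^sub>R (y - x)" for t
  have cC: "c t \<in> C" if "t \<in> {0..1}" for t
    using convexD_alt[OF C(1,3,4), of t] that by (simp add: c_def algebra_simps)
  then have cV: "c t \<in> snd \<kappa> ` fst \<kappa>" if "t \<in> {0..1}" for t using C(2) that by blast
  have \<gamma>: "\<gamma> t = param \<kappa> (c t)" for t by (simp add: \<gamma>_def c_def)
  have cc: "continuous_on {0..1} c" unfolding c_def by (intro continuous_intros)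
  have cont: "continuous_on {0..1} \<gamma>"
    unfolding \<gamma> by (rule continuous_on_compose2[OF chart_facts(5)[OF \<kappa>] cc]) (use cV in blast)
  have \<kappa>\<gamma>: "\<kappa> \<in> charts_at A (\<gamma> t)" if "t \<in> {0..1}" for t
    unfolding \<gamma> using chart_point[OF \<kappa> cV[OF that]] .
  have \<phi>\<gamma>: "snd \<kappa> (\<gamma> t) = c t" if "t \<in> {0..1}" for t unfolding \<gamma> using chart_facts(7)[OF \<kappa> cV[OF that]] .
  have "(c has_vector_derivative (y - x)) (at t within {0..1})" for t
    unfolding c_def by (auto intro!: derivative_eq_intros)
  then have vd: "((snd \<kappa> \<circ> \<gamma>) has_vector_derivative (y - x)) (at t within {0..1})" if "t \<in> {0..1}" for t
    by (rule has_vector_derivative_transform_within[of _ _ _ _ 1]) (use that \<phi>\<gamma> in auto)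
  have vd': "((snd \<kappa>' \<circ> \<gamma>) has_vector_derivative frechet_derivative (transition \<kappa> \<kappa>') (at (c t)) (y - x)) (at t within {0..1})"
    if "t \<in> {0..1}" "\<kappa>' \<in> charts_at A (\<gamma> t)" for t \<kappa>'
    using has_vector_derivative_transition[OF \<kappa>\<gamma>[OF that(1)] that(2) _ that(1) vd[OF that(1)]] cont that \<phi>\<gamma>
    by (simp add: continuous_on_eq_continuous_within)
  have "(snd \<kappa>' \<circ> \<gamma>) differentiable (at t within {0..1}) \<and>
     continuous (at t within {0..1}) (\<lambda>s. vector_derivative (snd \<kappa>' \<circ> \<gamma>) (at s within {0..1}))"
    if t: "t \<in> {0..1}" and \<kappa>': "\<kappa>' \<in> charts_at A (\<gamma> t)" for t \<kappa>'
  proof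
    show "(snd \<kappa>' \<circ> \<gamma>) differentiable (at t within {0..1})" using vd'[OF t \<kappa>'] by (rule differentiableI_vector)
    obtain \<delta> where \<delta>: "0 < \<delta>" "\<And>s. s \<in> {0..1} \<Longrightarrow> dist s t < \<delta> \<Longrightarrow> \<kappa>' \<in> charts_at A (\<gamma> s)"
      using eventually_in_chart[OF cont t \<kappa>'] by blast
    have A': "\<kappa>' \<in> A" using \<kappa>' by (simp add: charts_at_def)
    let ?W = "snd \<kappa> ` (fst \<kappa> \<inter> fst \<kappa>')"
    have ct: "c t \<in> ?W" using \<kappa>\<gamma>[OF t] \<kappa>' \<phi>\<gamma>[OF t] by (metis IntI charts_atD(2) image_eqI)
    have "open ?W" by (rule open_chart_image[OF \<kappa> chart_facts(1)[OF A']])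
    have "isCont (\<lambda>z. frechet_derivative (transition \<kappa> \<kappa>') (at z) (y - x)) (c t)"
      using continuous_dtransition[OF \<kappa> A', of "y - x"] ct
      unfolding continuous_on_eq_continuous_at[OF \<open>open ?W\<close>] by blast
    moreover have "continuous (at t within {0..1}) c" using cc t by (simp add: continuous_on_eq_continuous_within)
    ultimately have "continuous (at t within {0..1}) (\<lambda>s. frechet_derivative (transition \<kappa> \<kappa>') (at (c s)) (y - x))"
      by (rule continuous_within_compose3)
    then show "continuous (at t within {0..1}) (\<lambda>s. vector_derivative (snd \<kappa>' \<circ> \<gamma>) (at s within {0..1}))"
    proof (rule continuous_transform_within[OF _ \<delta>(1) t])
      fix s assume s: "s \<in> {0..1}" "dist s t < \<delta>"
      show "frechet_derivative (transition \<kappa> \<kappa>') (at (c s)) (y - x) = vector_derivative (snd \<kappa>' \<circ> \<gamma>) (at s within {0..1})"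
        using vector_derivative_within[OF at_within_Icc_ne_bot[OF zero_less_one s(1)] vd'[OF s(1) \<delta>(2)[OF s]]] by simp
    qed
  qed
  then show "C1_curve A {0..1} \<gamma>" using cont unfolding C1_curve_def by blast
  fix t :: real assume t: "t \<in> {0<..<1}"
  then have t': "t \<in> {0..1}" by auto
  show "speed \<gamma> t = sqrt (metric_coeff A G \<kappa> (x + t *\<^sub>R (y - x)) (y - x) (y - x))"
    using speed_eq[OF \<kappa>\<gamma>[OF t'] t cont vd[OF t']] \<phi>\<gamma>[OF t'] by (simp add: c_def)
qed

text \<open>The metric is bounded only at points no farther from \<open>x\<close> than
  \<open>y\<close> is; this is what later gives an upper bound of the squared distance with cubic
  error.\<close>

lemma riemannian_dist_segment_le:
  assumes \<kappa>: "\<kappa> \<in> A" and C: "convex C" "C \<subseteq> snd \<kappa> ` fst \<kappa>" "x \<in> C" "y \<in> C"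
    and b: "\<And>z. z \<in> C \<Longrightarrow> norm (z - x) \<le> norm (y - x) \<Longrightarrow> metric_coeff A G \<kappa> z (y - x) (y - x) \<le> b\<^sup>2" and "0 \<le> b"
  obtains l where "curve_from (param \<kappa> x) (param \<kappa> y) l" "l \<le> b"
proof -
  let ?\<gamma> = "\<lambda>t. param \<kappa> (x + t *\<^sub>R (y - x))"
  note sc = segment_curve[OF \<kappa> C]
  have p: "piecewise_C1_on A ?\<gamma> 0 1" by (rule piecewise_C1_on.base[OF zero_less_one sc(1)])
  have "integral {0..1} (speed ?\<gamma>) = integral {0..1} (\<lambda>t. if t \<in> {0, 1} then 0 else speed ?\<gamma> t)"
    by (rule integral_spike[of "{0, 1}"]) auto
  also have "\<dots> \<le> integral {0..1} (\<lambda>t::real. b)"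
  proof (rule integral_le)
    show "(\<lambda>t. if t \<in> {0, 1} then 0 else speed ?\<gamma> t) integrable_on {0..1}"
      by (rule integrable_spike_finite[OF _ _ speed_integrable[OF p], of "{0, 1}"]) auto
    fix t :: real assume t: "t \<in> {0..1}"
    show "(if t \<in> {0, 1} then 0 else speed ?\<gamma> t) \<le> b"
    proof (cases "t \<in> {0, 1}")
      case False
      then have t': "t \<in> {0<..<1}" using t by auto
      have "x + t *\<^sub>R (y - x) \<in> C" using convexD_alt[OF C(1,3,4), of t] t by (simp add: algebra_simps)
      moreover have "norm (x + t *\<^sub>R (y - x) - x) \<le> norm (y - x)"
        using t by (simp add: mult_left_le_one_le)
      ultimately have "sqrt (metric_coeff A G \<kappa> (x + t *\<^sub>R (y - x)) (y - x) (y - x)) \<le> b"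
        using b \<open>0 \<le> b\<close> by (intro real_le_lsqrt) auto
      then show ?thesis using False sc(2)[OF t'] by simp
    qed (use \<open>0 \<le> b\<close> in auto)
  qed auto
  finally have "integral {0..1} (speed ?\<gamma>) \<le> b" by simp
  moreover have "curve_from (param \<kappa> x) (param \<kappa> y) (integral {0..1} (speed ?\<gamma>))"
    unfolding curve_from_def using p by (intro exI[of _ ?\<gamma>] exI[of _ 0] exI[of _ 1]) auto
  ultimately show ?thesis using that by blast
qed

text \<open>A calibration argument: a constant linear form dominated by the metric norm is
  integrated along the curve, and the fundamental theorem of calculus leaves its value at the
  difference of the end points.\<close>

lemma length_lower_chart:
  assumes "piecewise_C1_on A \<gamma> a b" and \<kappa>: "\<kappa> \<in> A"
    and "\<And>t. t \<in> {a..b} \<Longrightarrow> \<gamma> t \<in> fst \<kappa> \<and> snd \<kappa> (\<gamma> t) \<in> C"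
    and l: "linear l" "\<And>z u. z \<in> C \<Longrightarrow> l u \<le> sqrt (metric_coeff A G \<kappa> z u u)"
  shows "l (snd \<kappa> (\<gamma> b) - snd \<kappa> (\<gamma> a)) \<le> integral {a..b} (speed \<gamma>)"
  using assms(1,3)
proof (induction rule: piecewise_C1_on.induct)
  case (base a b)
  have cont: "continuous_on {a..b} \<gamma>" using base by (simp add: C1_curve_def)
  let ?w = "\<lambda>t. vector_derivative (snd \<kappa> \<circ> \<gamma>) (at t within {a..b})"
  have \<kappa>\<gamma>: "\<kappa> \<in> charts_at A (\<gamma> t)" if "t \<in> {a..b}" for t using base(3)[OF that] \<kappa> by (simp add: charts_at_def)
  have w: "((snd \<kappa> \<circ> \<gamma>) has_vector_derivative ?w t) (at t within {a..b})" if "t \<in> {a..b}" for t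
    by (rule C1_curve_differentiable[OF base(2) that \<kappa>\<gamma>[OF that]])
  have bl: "bounded_linear l" using l(1) by (simp add: linear_conv_bounded_linear)
  have "((\<lambda>t. l (?w t)) has_integral l (snd \<kappa> (\<gamma> b)) - l (snd \<kappa> (\<gamma> a))) {a..b}"
    using fundamental_theorem_of_calculus[of a b "\<lambda>t. l ((snd \<kappa> \<circ> \<gamma>) t)" "\<lambda>t. l (?w t)"]
      bounded_linear.has_vector_derivative[OF bl w] base(1) by simp
  moreover have "((\<lambda>t. if t \<in> {a, b} then l (?w t) else speed \<gamma> t) has_integral integral {a..b} (speed \<gamma>)) {a..b}"
    by (rule has_integral_spike_finite[OF _ _ integrable_integral[OF C1_speed_integrable[OF base(1,2)]], of "{a, b}"]) auto
  ultimately have "l (snd \<kappa> (\<gamma> b)) - l (snd \<kappa> (\<gamma> a)) \<le> integral {a..b} (speed \<gamma>)"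
  proof (rule has_integral_le)
    fix t assume t: "t \<in> {a..b}"
    show "l (?w t) \<le> (if t \<in> {a, b} then l (?w t) else speed \<gamma> t)"
    proof (cases "t \<in> {a, b}")
      case False
      then have t': "t \<in> {a<..<b}" using t by auto
      show ?thesis using False speed_eq[OF \<kappa>\<gamma>[OF t] t' cont w[OF t]] l(2)[of "snd \<kappa> (\<gamma> t)" "?w t"] base(3)[OF t] by simp
    qed simp
  qed
  then show ?case by (simp add: linear_diff[OF l(1)])
next
  case (join a b c)
  have "a < b" "b < c" using join(1,2) piecewise_C1_on_less by blast+
  then have "l (snd \<kappa> (\<gamma> b) - snd \<kappa> (\<gamma> a)) + l (snd \<kappa> (\<gamma> c) - snd \<kappa> (\<gamma> b)) \<le>
     integral {a..b} (speed \<gamma>) + integral {b..c} (speed \<gamma>)"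
    using join by (intro add_mono join.IH) auto
  then show ?case using length_split[OF piecewise_C1_on.join[OF join(1,2)], of b] \<open>a < b\<close> \<open>b < c\<close>
    by (simp add: linear_diff[OF l(1)])
qed

text \<open>A curve starting at the centre of a coordinate ball either stays inside or first reaches the
  boundary sphere, and is then at least as long as the radius.\<close>

lemma length_lower:
  assumes \<gamma>: "piecewise_C1_on A \<gamma> a b" "\<gamma> a = param \<kappa> x" and \<kappa>: "\<kappa> \<in> A"
    and C: "cball x \<rho> \<subseteq> snd \<kappa> ` fst \<kappa>" "0 < \<rho>"
    and s: "0 \<le> s" "\<And>z u. z \<in> cball x \<rho> \<Longrightarrow> s * norm u \<le> sqrt (metric_coeff A G \<kappa> z u u)"
    and l: "linear l" "\<And>z u. z \<in> cball x \<rho> \<Longrightarrow> l u \<le> sqrt (metric_coeff A G \<kappa> z u u)"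
  shows "s * \<rho> \<le> integral {a..b} (speed \<gamma>) \<or>
    \<gamma> b \<in> fst \<kappa> \<and> snd \<kappa> (\<gamma> b) \<in> ball x \<rho> \<and> l (snd \<kappa> (\<gamma> b) - x) \<le> integral {a..b} (speed \<gamma>)"
proof -
  define W where "W = param \<kappa> ` ball x \<rho>"
  define Q where "Q = param \<kappa> ` cball x \<rho>"
  have ab: "a < b" using \<gamma>(1) by (rule piecewise_C1_on_less)
  have cont: "continuous_on {a..b} \<gamma>" using \<gamma>(1) by (rule piecewise_C1_on_continuous)
  have x: "x \<in> snd \<kappa> ` fst \<kappa>" using C by auto
  have Weq: "W = fst \<kappa> \<inter> snd \<kappa> -` ball x \<rho>"
    unfolding W_def by (rule param_image[OF \<kappa>]) (use C ball_subset_cball in blast)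
  have Qeq: "Q = fst \<kappa> \<inter> snd \<kappa> -` cball x \<rho>" unfolding Q_def by (rule param_image[OF \<kappa> C(1)])
  have oW: "open W" unfolding Weq
    using chart_facts(4)[OF \<kappa>] chart_facts(1)[OF \<kappa>] by (intro continuous_open_preimage) auto
  have "compact Q" unfolding Q_def
    by (intro compact_continuous_image continuous_on_subset[OF chart_facts(5)[OF \<kappa>] C(1)]) auto
  then have cQ: "closed Q" by (rule compact_imp_closed)
  have stay: ?thesis if in_W: "\<And>t. t \<in> {a..b} \<Longrightarrow> \<gamma> t \<in> W"
  proof -
    have "l (snd \<kappa> (\<gamma> b) - snd \<kappa> (\<gamma> a)) \<le> integral {a..b} (speed \<gamma>)"
    proof (rule length_lower_chart[OF \<gamma>(1) \<kappa> _ l])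
      show "\<gamma> t \<in> fst \<kappa> \<and> snd \<kappa> (\<gamma> t) \<in> cball x \<rho>" if "t \<in> {a..b}" for t
        using in_W[OF that] unfolding Weq by auto
    qed auto
    moreover have "\<gamma> b \<in> W" using in_W ab by simp
    ultimately show ?thesis unfolding Weq \<gamma>(2) chart_facts(7)[OF \<kappa> x] by auto
  qed
  show ?thesis
  proof (cases "\<forall>t\<in>{a..b}. \<gamma> t \<in> W")
    case True
    then show ?thesis using stay by blast
  next
    case False
    define T where "T = {a..b} \<inter> \<gamma> -` (- W)"
    have T: "T \<noteq> {}" "closed T" using False cont oW
      unfolding T_def by (auto intro!: continuous_closed_preimage)
    have bT: "bdd_below T" unfolding T_def by (intro bdd_belowI[of _ a]) auto
    \<comment> \<open>The first time outside the open coordinate ball; up to then the calibration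
      applies.\<close>
    define t1 where "t1 = Inf T"
    have t1: "t1 \<in> T" unfolding t1_def by (rule closed_contains_Inf[OF T(1) bT T(2)])
    have before: "\<gamma> t \<in> W" if "a \<le> t" "t < t1" for t
    proof (rule ccontr)
      assume "\<gamma> t \<notin> W"
      then have "t \<in> T" using that t1 by (auto simp: T_def)
      then show False using cInf_lower[OF _ bT] that by (fastforce simp: t1_def)
    qed
    have "\<gamma> a \<in> W" unfolding \<gamma>(2) W_def using C(2) by simp
    then have at1: "a < t1" using t1 by (cases "a = t1") (auto simp: T_def)
    have t1b: "t1 \<le> b" "\<gamma> t1 \<notin> W" using t1 by (auto simp: T_def)
    \<comment> \<open>Continuity puts the exit point into the image of the closed ball, which is
      compact and hence closed; not being in \<open>W\<close>, the point lies on the sphere.\<close>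
    have "\<gamma> t1 \<in> Q"
    proof -
      have "W \<subseteq> Q" by (auto simp: Weq Qeq)
      then have "\<forall>t\<in>{a..<t1}. \<gamma> t \<in> Q" using before by auto
      moreover have "continuous_on (closure {a..<t1}) \<gamma>"
        using at1 t1b by (auto intro: continuous_on_subset[OF cont])
      ultimately show ?thesis
        using continuous_on_closure_sequentially image_closure_subset[of "{a..<t1}" \<gamma> Q] cQ at1 by fastforce
    qed
    then have t1Q: "\<gamma> t1 \<in> fst \<kappa>" "norm (snd \<kappa> (\<gamma> t1) - x) = \<rho>"
      using t1b(2) by (auto simp: Weq Qeq dist_norm norm_minus_commute)
    have p1: "piecewise_C1_on A \<gamma> a t1" by (rule piecewise_C1_on_subset[OF \<gamma>(1) order_refl at1 t1b(1)])
    \<comment> \<open>With \<open>e\<close> the direction of the exit point, the form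
      \<open>u \<mapsto> s * (u \<bullet> e)\<close> is dominated by the metric norm and takes the
      value \<open>s * \<rho>\<close> at the displacement.\<close>
    define e where "e = (1 / \<rho>) *\<^sub>R (snd \<kappa> (\<gamma> t1) - x)"
    have e: "norm e = 1" using t1Q C(2) by (simp add: e_def)
    have "(\<lambda>u. s * (u \<bullet> e)) (snd \<kappa> (\<gamma> t1) - snd \<kappa> (\<gamma> a)) \<le> integral {a..t1} (speed \<gamma>)"
    proof (rule length_lower_chart[OF p1 \<kappa>])
      show "\<gamma> t \<in> fst \<kappa> \<and> snd \<kappa> (\<gamma> t) \<in> cball x \<rho>" if "t \<in> {a..t1}" for t
        using that before[of t] \<open>\<gamma> t1 \<in> Q\<close> unfolding Weq Qeq by (cases "t = t1") auto
      show "linear (\<lambda>u. s * (u \<bullet> e))" by (rule linearI) (auto simp: algebra_simps inner_simps)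
      fix z u assume z: "z \<in> cball x \<rho>"
      have "s * (u \<bullet> e) \<le> s * norm u"
        using s(1) Cauchy_Schwarz_ineq2[of u e] e by (intro mult_left_mono) auto
      then show "s * (u \<bullet> e) \<le> sqrt (metric_coeff A G \<kappa> z u u)" using s(2)[OF z, of u] by linarith
    qed
    also have "(\<lambda>u. s * (u \<bullet> e)) (snd \<kappa> (\<gamma> t1) - snd \<kappa> (\<gamma> a)) = s * \<rho>"
      unfolding \<gamma>(2) chart_facts(7)[OF \<kappa> x] using t1Q(2) C(2)
      by (simp add: e_def dot_square_norm power2_eq_square)
    finally have "s * \<rho> \<le> integral {a..t1} (speed \<gamma>)" .
    also have "\<dots> \<le> integral {a..b} (speed \<gamma>)"
    proof (cases "t1 = b")
      case False
      then have "piecewise_C1_on A \<gamma> t1 b" using piecewise_C1_on_subset[OF \<gamma>(1), of t1 b] at1 t1b by simp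
      from length_nonneg[OF this] show ?thesis using length_split[OF \<gamma>(1), of t1] at1 t1b by simp
    qed simp
    finally show ?thesis by simp
  qed
qed

end

section \<open>The Riemannian distance\<close>

context metric_ball
begin

lemma sqrt_coercive: "x \<in> B \<Longrightarrow> sqrt lam * norm u \<le> sqrt (h x u u)"
  using coercive[of x u] lam_pos by (intro real_le_rsqrt) (simp add: power_mult_distrib)

lemma bound_square:
  assumes "x \<in> B"
  shows "h x u u \<le> (sqrt K * norm u)\<^sup>2"
proof -
  have "(sqrt K * norm u)\<^sup>2 = K * norm u * norm u"
    using K_pos by (simp add: power_mult_distrib power2_eq_square[of "norm u"])
  then show ?thesis using bound[OF assms, of u u] by simp
qed

end

context riemannian_manifold
begin

abbreviation metric_coeff_deriv :: "('a, 'e) chart \<Rightarrow> 'e \<Rightarrow> 'e \<Rightarrow> 'e \<Rightarrow> 'e \<Rightarrow> real" where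
  "metric_coeff_deriv \<kappa> x w u v \<equiv> frechet_derivative (\<lambda>y. metric_coeff A G \<kappa> y u v) (at x) w"

abbreviation chart_ball :: "('a, 'e) chart \<Rightarrow> 'e set \<Rightarrow> real \<Rightarrow> real \<Rightarrow> bool" where
  "chart_ball \<kappa> B lam K \<equiv> metric_ball B (metric_coeff A G \<kappa>) (metric_coeff_deriv \<kappa>) lam K"

lemma curve_in_chart_ball:
  assumes \<kappa>: "\<kappa> \<in> A" and r: "cball x r \<subseteq> snd \<kappa> ` fst \<kappa>" "chart_ball \<kappa> (cball x r) lam K"
    and yz: "y \<in> cball x r" "z \<in> cball x r"
  shows "\<exists>l. curve_from (param \<kappa> y) (param \<kappa> z) l \<and> l \<le> sqrt K * norm (z - y)"
proof -
  interpret metric_ball "cball x r" "metric_coeff A G \<kappa>" "metric_coeff_deriv \<kappa>" lam K by (fact r(2))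
  show ?thesis
    by (rule riemannian_dist_segment_le[OF \<kappa> convex_cball r(1) yz, of "sqrt K * norm (z - y)"])
      (use bound_square K_pos in auto)
qed

lemma Ck_on_subset: "Ck_on k S f \<Longrightarrow> T \<subseteq> S \<Longrightarrow> Ck_on k T f"
  by (induction k arbitrary: f) (auto intro: continuous_on_subset)

lemma chart_preimage_open:
  assumes "\<kappa> \<in> A" "open W"
  shows "open (fst \<kappa> \<inter> snd \<kappa> -` W)"
  using chart_facts(4)[OF assms(1)] chart_facts(1)[OF assms(1)] assms(2)
  by (intro continuous_open_preimage) auto

end

text \<open>Connectedness makes the set of lengths between any two points nonempty, so that the
  infimum in \<open>riemannian_dist\<close> is meaningful.\<close>

locale connected_riemannian_manifold = riemannian_manifold A G
  for A :: "('a::{t2_space, second_countable_topology}, 'e::euclidean_space) chart set" and G +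
  assumes connected_UNIV: "connected (UNIV :: 'a set)"
begin

abbreviation "rdist \<equiv> riemannian_dist A G"

text \<open>Being joined by a curve is an equivalence relation, and by segments in charts each point
  is related to a whole neighbourhood.\<close>

lemma ex_curve_from: "\<exists>l. curve_from p q l"
proof (rule connected_equivalence_relation[OF connected_UNIV, of p q "\<lambda>p q. \<exists>l. curve_from p q l"])
  fix p :: 'a
  obtain \<kappa> where "\<kappa> \<in> charts_at A p" using ex_chart by blast
  then have \<kappa>: "\<kappa> \<in> A" "p \<in> fst \<kappa>" by (auto simp: charts_at_def)
  obtain r lam K where r: "0 < r" "cball (snd \<kappa> p) r \<subseteq> snd \<kappa> ` fst \<kappa>" "chart_ball \<kappa> (cball (snd \<kappa> p) r) lam K"
    by (rule ex_chart_metric_ball[OF \<kappa>(1), of "snd \<kappa> p"]) (use \<kappa> that in auto)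
  let ?T = "fst \<kappa> \<inter> snd \<kappa> -` ball (snd \<kappa> p) r"
  have "\<exists>l. curve_from p q l" if q: "q \<in> ?T" for q
    using curve_in_chart_ball[OF \<kappa>(1) r(2,3), of "snd \<kappa> p" "snd \<kappa> q"] q r(1)
      chart_facts(6)[OF \<kappa>(1)] \<kappa>(2) by auto
  moreover have "open ?T" by (rule chart_preimage_open[OF \<kappa>(1)]) simp
  ultimately show "\<exists>T. openin (top_of_set UNIV) T \<and> p \<in> T \<and> (\<forall>q\<in>T. \<exists>l. curve_from p q l)"
    using \<kappa>(2) r(1) by (intro exI[of _ ?T]) auto
qed (use curve_from_sym curve_from_trans in blast)+

lemma rdist_approx:
  assumes "0 < \<epsilon>"
  obtains l where "curve_from p q l" "l < rdist p q + \<epsilon>"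
proof -
  have "Inf {l. curve_from p q l} < rdist p q + \<epsilon>" using assms by (simp add: riemannian_dist_eq)
  moreover have "{l. curve_from p q l} \<noteq> {}" using ex_curve_from by blast
  ultimately obtain l where "l \<in> {l. curve_from p q l}" "l < rdist p q + \<epsilon>" by (meson cInf_lessD)
  then show ?thesis using that by blast
qed

lemma rdist_greatest: "(\<And>l. curve_from p q l \<Longrightarrow> b \<le> l) \<Longrightarrow> b \<le> rdist p q"
  unfolding riemannian_dist_eq using ex_curve_from by (intro cInf_greatest) auto

text \<open>The alternative for single curves passes to the infimum: whether \<open>q\<close> lies
  in the coordinate ball does not depend on the curve, and if it does, every length is at least the
  smaller of the two bounds.\<close>

lemma rdist_lower:
  assumes \<kappa>: "\<kappa> \<in> A" and C: "cball x \<rho> \<subseteq> snd \<kappa> ` fst \<kappa>" "0 < \<rho>"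
    and s: "0 \<le> s" "\<And>z u. z \<in> cball x \<rho> \<Longrightarrow> s * norm u \<le> sqrt (metric_coeff A G \<kappa> z u u)"
    and l: "linear l" "\<And>z u. z \<in> cball x \<rho> \<Longrightarrow> l u \<le> sqrt (metric_coeff A G \<kappa> z u u)"
  shows "s * \<rho> \<le> rdist (param \<kappa> x) q \<or>
    q \<in> fst \<kappa> \<and> snd \<kappa> q \<in> ball x \<rho> \<and> l (snd \<kappa> q - x) \<le> rdist (param \<kappa> x) q"
proof -
  have *: "s * \<rho> \<le> L \<or> q \<in> fst \<kappa> \<and> snd \<kappa> q \<in> ball x \<rho> \<and> l (snd \<kappa> q - x) \<le> L"
    if L: "curve_from (param \<kappa> x) q L" for L
  proof -
    obtain \<gamma> a b where \<gamma>: "piecewise_C1_on A \<gamma> a b" "\<gamma> a = param \<kappa> x" "\<gamma> b = q" "integral {a..b} (speed \<gamma>) = L"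
      using L unfolding curve_from_def by blast
    show ?thesis using length_lower[OF \<gamma>(1,2) \<kappa> C s l] \<gamma>(3,4) by simp
  qed
  show ?thesis
  proof (cases "q \<in> fst \<kappa> \<and> snd \<kappa> q \<in> ball x \<rho>")
    case True
    have "min (s * \<rho>) (l (snd \<kappa> q - x)) \<le> rdist (param \<kappa> x) q"
      using * by (intro rdist_greatest) (auto simp: min_le_iff_disj)
    then show ?thesis using True by (auto simp: min_le_iff_disj)
  next
    case False
    then have "s * \<rho> \<le> rdist (param \<kappa> x) q" using * by (intro rdist_greatest) blast
    then show ?thesis by blast
  qed
qed

lemma rdist_lower_norm:
  assumes \<kappa>: "\<kappa> \<in> A" and C: "cball x \<rho> \<subseteq> snd \<kappa> ` fst \<kappa>" "0 < \<rho>" and mb: "chart_ball \<kappa> (cball x \<rho>) lam K"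
  shows "sqrt lam * \<rho> \<le> rdist (param \<kappa> x) q \<or>
    q \<in> fst \<kappa> \<and> snd \<kappa> q \<in> ball x \<rho> \<and> sqrt lam * norm (snd \<kappa> q - x) \<le> rdist (param \<kappa> x) q"
proof -
  interpret metric_ball "cball x \<rho>" "metric_coeff A G \<kappa>" "metric_coeff_deriv \<kappa>" lam K by (fact mb)
  define v where "v = snd \<kappa> q - x"
  \<comment> \<open>\<open>sqrt lam\<close> times the projection to \<open>e\<close> is dominated by
    the metric norm and measures the coordinate distance of \<open>q\<close>. If
    \<open>v = 0\<close>, division by zero gives \<open>e = 0\<close>, which is harmless.\<close>
  define e where "e = (1 / norm v) *\<^sub>R v"
  have e: "norm e \<le> 1" by (simp add: e_def)
  have ev: "v \<bullet> e = norm v" by (cases "v = 0") (simp_all add: e_def dot_square_norm power2_eq_square)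
  have "sqrt lam * (u \<bullet> e) \<le> sqrt (metric_coeff A G \<kappa> z u u)" if "z \<in> cball x \<rho>" for z u
  proof -
    have "u \<bullet> e \<le> norm u * norm e" by (rule norm_cauchy_schwarz)
    also have "\<dots> \<le> norm u * 1" using e by (intro mult_left_mono) auto
    finally have "sqrt lam * (u \<bullet> e) \<le> sqrt lam * norm u" using lam_pos by simp
    then show ?thesis using sqrt_coercive[OF that, of u] by linarith
  qed
  moreover have "linear (\<lambda>u. sqrt lam * (u \<bullet> e))" by (rule linearI) (auto simp: algebra_simps inner_simps)
  ultimately show ?thesis
    using rdist_lower[OF \<kappa> C, of "sqrt lam" "\<lambda>u. sqrt lam * (u \<bullet> e)" q] sqrt_coercive lam_pos ev
    unfolding v_def by simp
qed

section \<open>The distance and the topology of the manifold\<close>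

lemma ex_ball_at:
  assumes "open W" "p \<in> W"
  obtains \<kappa> r lam K where "\<kappa> \<in> A" "p \<in> fst \<kappa>" "0 < r" "cball (snd \<kappa> p) r \<subseteq> snd \<kappa> ` (fst \<kappa> \<inter> W)"
    "chart_ball \<kappa> (cball (snd \<kappa> p) r) lam K"
proof -
  obtain \<kappa> where "\<kappa> \<in> charts_at A p" using ex_chart by blast
  then have \<kappa>: "\<kappa> \<in> A" "p \<in> fst \<kappa>" by (auto simp: charts_at_def)
  let ?V = "snd \<kappa> ` (fst \<kappa> \<inter> W)"
  have sub: "?V \<subseteq> snd \<kappa> ` fst \<kappa>" by blast
  have "open ?V" by (rule open_chart_image[OF \<kappa>(1) assms(1)])
  moreover have "snd \<kappa> p \<in> ?V" using \<kappa>(2) assms(2) by blast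
  ultimately obtain r lam K where "0 < r" "cball (snd \<kappa> p) r \<subseteq> ?V" "chart_ball \<kappa> (cball (snd \<kappa> p) r) lam K"
    by (rule ex_metric_ball[OF _ _ metric_coeff_bilinear[OF \<kappa>(1) subsetD[OF sub]]
          metric_coeff_sym[OF \<kappa>(1) subsetD[OF sub]] metric_coeff_pos[OF \<kappa>(1) subsetD[OF sub]]
          Ck_on_subset[OF metric_coeff_C2[OF \<kappa>(1)] sub]])
      (assumption, assumption, assumption, assumption, rule that)
  then show ?thesis using that \<kappa> by blast
qed

lemma rdist_self: "rdist p p = 0"
proof -
  obtain \<kappa> r lam K where \<kappa>: "\<kappa> \<in> A" "p \<in> fst \<kappa>" and r: "0 < r" "cball (snd \<kappa> p) r \<subseteq> snd \<kappa> ` (fst \<kappa> \<inter> UNIV)"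
    and mb: "chart_ball \<kappa> (cball (snd \<kappa> p) r) lam K" by (rule ex_ball_at[OF open_UNIV UNIV_I]) (rule that)
  have "\<exists>l. curve_from p p l \<and> l \<le> sqrt K * norm (snd \<kappa> p - snd \<kappa> p)"
    using curve_in_chart_ball[OF \<kappa>(1) _ mb, of "snd \<kappa> p" "snd \<kappa> p"] r chart_facts(6)[OF \<kappa>] by simp
  then have "rdist p p \<le> 0" using riemannian_dist_le by fastforce
  moreover have "0 \<le> rdist p p" by (rule rdist_greatest) (rule curve_from_nonneg)
  ultimately show ?thesis by simp
qed

text \<open>Leaving a coordinate ball of radius \<open>r\<close> inside \<open>W\<close> costs at
  least \<open>sqrt lam * r\<close>.\<close>

lemma rdist_small_imp_in_open:
  assumes "open W" "p \<in> W"
  obtains \<epsilon> where "0 < \<epsilon>" "\<And>q. rdist p q < \<epsilon> \<Longrightarrow> q \<in> W"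
proof -
  obtain \<kappa> r lam K where \<kappa>: "\<kappa> \<in> A" "p \<in> fst \<kappa>" and r: "0 < r" "cball (snd \<kappa> p) r \<subseteq> snd \<kappa> ` (fst \<kappa> \<inter> W)"
    and mb: "chart_ball \<kappa> (cball (snd \<kappa> p) r) lam K" by (rule ex_ball_at[OF assms]) (rule that)
  have r': "cball (snd \<kappa> p) r \<subseteq> snd \<kappa> ` fst \<kappa>" using r by blast
  have "q \<in> W" if "rdist p q < sqrt lam * r" for q
  proof -
    have "q \<in> fst \<kappa>" "snd \<kappa> q \<in> ball (snd \<kappa> p) r"
      using rdist_lower_norm[OF \<kappa>(1) r' r(1) mb, of q] that chart_facts(6)[OF \<kappa>] by auto
    then have "snd \<kappa> q \<in> snd \<kappa> ` (fst \<kappa> \<inter> W)" using r(2) ball_subset_cball by blast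
    then show ?thesis using \<open>q \<in> fst \<kappa>\<close> chart_facts(3)[OF \<kappa>(1)] by (auto dest: inj_onD)
  qed
  moreover have "0 < sqrt lam * r" using r(1) metric_ball.lam_pos[OF mb] by simp
  ultimately show ?thesis using that by blast
qed

text \<open>Segments in a chart ball are at most \<open>sqrt K\<close> times as long as in
  coordinates.\<close>

lemma open_imp_rdist_small:
  assumes "0 < \<epsilon>"
  obtains W where "open W" "p \<in> W" "\<And>q. q \<in> W \<Longrightarrow> rdist p q < \<epsilon>"
proof -
  obtain \<kappa> r lam K where \<kappa>: "\<kappa> \<in> A" "p \<in> fst \<kappa>" and r: "0 < r" "cball (snd \<kappa> p) r \<subseteq> snd \<kappa> ` (fst \<kappa> \<inter> UNIV)"
    and mb: "chart_ball \<kappa> (cball (snd \<kappa> p) r) lam K" by (rule ex_ball_at[OF open_UNIV UNIV_I]) (rule that)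
  have K: "0 < K" by (rule metric_ball.K_pos[OF mb])
  define r' where "r' = min r (\<epsilon> / sqrt K)"
  let ?W = "fst \<kappa> \<inter> snd \<kappa> -` ball (snd \<kappa> p) r'"
  have r': "0 < r'" "r' \<le> r" "sqrt K * r' \<le> \<epsilon>"
  proof -
    have "sqrt K * r' \<le> sqrt K * (\<epsilon> / sqrt K)" using K by (intro mult_left_mono) (auto simp: r'_def)
    then show "sqrt K * r' \<le> \<epsilon>" using K by simp
  qed (use r K assms in \<open>auto simp: r'_def\<close>)
  show ?thesis
  proof (rule that[of ?W])
    show "open ?W" by (rule chart_preimage_open[OF \<kappa>(1)]) simp
    show "p \<in> ?W" using \<kappa> r' by simp
    fix q assume q: "q \<in> ?W"
    then have "snd \<kappa> q \<in> cball (snd \<kappa> p) r" using r' by auto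
    then obtain l where "curve_from p q l" "l \<le> sqrt K * norm (snd \<kappa> q - snd \<kappa> p)"
      using curve_in_chart_ball[OF \<kappa>(1) _ mb, of "snd \<kappa> p" "snd \<kappa> q"] r q
        chart_facts(6)[OF \<kappa>] chart_facts(6)[OF \<kappa>(1), of q] by auto
    moreover have "sqrt K * norm (snd \<kappa> q - snd \<kappa> p) < sqrt K * r'"
      using q K by (auto simp: dist_norm norm_minus_commute)
    ultimately show "rdist p q < \<epsilon>" using riemannian_dist_le[of p q l] r'(3) by linarith
  qed
qed

sublocale M: Metric_space UNIV rdist
proof
  show nonneg: "0 \<le> rdist p q" for p q by (rule rdist_greatest) (rule curve_from_nonneg)
  have le: "rdist p q \<le> rdist q p" for p q
    by (rule rdist_greatest) (use riemannian_dist_le curve_from_sym in blast)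
  then show "rdist p q = rdist q p" for p q by (simp add: order_antisym)
  show "rdist p r \<le> rdist p q + rdist q r" for p q r
  proof (rule field_le_epsilon)
    fix e :: real assume e: "0 < e"
    obtain l where l: "curve_from p q l" "l < rdist p q + e / 2" using rdist_approx[of "e / 2" p q] e by auto
    obtain l' where l': "curve_from q r l'" "l' < rdist q r + e / 2" using rdist_approx[of "e / 2" q r] e by auto
    show "rdist p r \<le> rdist p q + rdist q r + e"
      using riemannian_dist_le[OF curve_from_trans[OF l(1) l'(1)]] l l' by simp
  qed
  show "(rdist p q = 0) = (p = q)" for p q
  proof
    assume 0: "rdist p q = 0"
    show "p = q"
    proof (rule ccontr)
      assume "p \<noteq> q"
      \<comment> \<open>The complement of \<open>{q}\<close> is an open neighbourhood of
        \<open>p\<close>, so it contains a distance ball around \<open>p\<close>.\<close>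
      then obtain \<epsilon> where \<epsilon>: "0 < \<epsilon>" "\<And>q'. rdist p q' < \<epsilon> \<Longrightarrow> q' \<in> - {q}"
        using rdist_small_imp_in_open[of "- {q}" p] by auto
      from \<epsilon>(2)[of q] \<epsilon>(1) 0 show False by simp
    qed
  qed (simp add: rdist_self)
qed

lemma mtopology_eq: "M.mtopology = euclidean"
proof -
  have "openin M.mtopology W \<longleftrightarrow> open W" for W
  proof
    assume W: "open W"
    have "\<exists>r>0. M.mball p r \<subseteq> W" if p: "p \<in> W" for p
    proof -
      obtain \<epsilon> where "0 < \<epsilon>" "\<And>q. rdist p q < \<epsilon> \<Longrightarrow> q \<in> W" using rdist_small_imp_in_open[OF W p] by blast
      then show ?thesis by auto
    qed
    then show "openin M.mtopology W" by (simp add: M.openin_mtopology)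
  next
    assume "openin M.mtopology W"
    then have *: "\<And>p. p \<in> W \<Longrightarrow> \<exists>r>0. M.mball p r \<subseteq> W" by (simp add: M.openin_mtopology)
    have "\<exists>T. open T \<and> p \<in> T \<and> T \<subseteq> W" if p: "p \<in> W" for p
    proof -
      obtain r where r: "0 < r" "M.mball p r \<subseteq> W" using *[OF p] by blast
      obtain T where "open T" "p \<in> T" "\<And>q. q \<in> T \<Longrightarrow> rdist p q < r" by (rule open_imp_rdist_small[OF r(1)]) (rule that)
      then show ?thesis using r(2) by (intro exI[of _ T]) auto
    qed
    then show "open W" by (subst open_subopen) blast
  qed
  then show ?thesis by (simp add: topology_eq)
qed

lemma continuous_rdist: "continuous_on UNIV (\<lambda>(p, q). rdist p q)"
  unfolding continuous_on_eq_continuous_at[OF open_UNIV]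
proof
  fix x :: "'a \<times> 'a"
  obtain p q where x: "x = (p, q)" by fastforce
  show "isCont (\<lambda>(p, q). rdist p q) x"
    unfolding continuous_at_eps_delta x isCont_def tendsto_iff
  proof (intro allI impI)
    fix e :: real assume e: "0 < e"
    obtain U where U: "open U" "p \<in> U" "\<And>p'. p' \<in> U \<Longrightarrow> rdist p p' < e / 2"
      by (rule open_imp_rdist_small[of "e / 2" p]) (use e that in auto)
    obtain V where V: "open V" "q \<in> V" "\<And>q'. q' \<in> V \<Longrightarrow> rdist q q' < e / 2"
      by (rule open_imp_rdist_small[of "e / 2" q]) (use e that in auto)
    have "\<forall>\<^sub>F y in nhds (p, q). y \<in> U \<times> V" using U V by (intro eventually_nhds_in_open open_Times) auto
    then have "\<forall>\<^sub>F y in at (p, q). y \<in> U \<times> V" by (simp add: eventually_at_filter eventually_mono)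
    then show "\<forall>\<^sub>F y in at (p, q). dist (case y of (p, q) \<Rightarrow> rdist p q) (case (p, q) of (p, q) \<Rightarrow> rdist p q) < e"
    proof eventually_elim
      case (elim y)
      obtain p' q' where y: "y = (p', q')" by fastforce
      have "rdist p p' < e / 2" "rdist q q' < e / 2" using elim U(3) V(3) by (auto simp: y)
      moreover have "rdist p' q' \<le> rdist p' p + (rdist p q + rdist q q')"
        using M.triangle[of p' p q'] M.triangle[of p q q'] by simp
      moreover have "rdist p q \<le> rdist p p' + (rdist p' q' + rdist q' q)"
        using M.triangle[of p p' q] M.triangle[of p' q' q] by simp
      ultimately have "\<bar>rdist p' q' - rdist p q\<bar> < e" using M.commute[of p p'] M.commute[of q q'] by simp
      then show ?case by (simp add: y dist_real_def)
    qed
  qed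
qed

text \<open>A small distance ball is a closed subset of a compact parametrized coordinate ball. Half
  of \<open>sqrt lam * r\<close> is taken so that the closed ball satisfies the strict
  inequality.\<close>

lemma locally_compact: "\<exists>r>0. compact (M.mcball p r)"
proof -
  obtain \<kappa> r lam K where \<kappa>: "\<kappa> \<in> A" "p \<in> fst \<kappa>" and r: "0 < r" "cball (snd \<kappa> p) r \<subseteq> snd \<kappa> ` (fst \<kappa> \<inter> UNIV)"
    and mb: "chart_ball \<kappa> (cball (snd \<kappa> p) r) lam K" by (rule ex_ball_at[OF open_UNIV UNIV_I]) (rule that)
  have r': "cball (snd \<kappa> p) r \<subseteq> snd \<kappa> ` fst \<kappa>" using r by blast
  have lam: "0 < sqrt lam * r" using r(1) metric_ball.lam_pos[OF mb] by simp
  let ?Q = "param \<kappa> ` cball (snd \<kappa> p) r"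
  have "compact ?Q"
    by (intro compact_continuous_image continuous_on_subset[OF chart_facts(5)[OF \<kappa>(1)] r']) auto
  moreover have "M.mcball p (sqrt lam * r / 2) \<subseteq> ?Q"
  proof
    fix q assume "q \<in> M.mcball p (sqrt lam * r / 2)"
    then have "rdist p q \<le> sqrt lam * r / 2" by simp
    then have "rdist p q < sqrt lam * r" using lam by linarith
    then have "q \<in> fst \<kappa>" "snd \<kappa> q \<in> ball (snd \<kappa> p) r"
      using rdist_lower_norm[OF \<kappa>(1) r' r(1) mb, of q] chart_facts(6)[OF \<kappa>] by auto
    then show "q \<in> ?Q" using chart_facts(6)[OF \<kappa>(1), of q] by (intro image_eqI[of _ _ "snd \<kappa> q"]) auto
  qed
  moreover have "closed (M.mcball p (sqrt lam * r / 2))"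
    using M.closedin_mcball[of p "sqrt lam * r / 2"] by (simp add: mtopology_eq)
  ultimately have "compact (M.mcball p (sqrt lam * r / 2))"
    by (metis compact_Int_closed inf.absorb_iff2)
  then show ?thesis using lam by (intro exI[of _ "sqrt lam * r / 2"]) auto
qed

section \<open>Length as a parameter and almost minimizing curves\<close>

lemma rdist_along:
  assumes "piecewise_C1_on A \<gamma> a b" "a \<le> s" "s \<le> t" "t \<le> b"
  shows "rdist (\<gamma> s) (\<gamma> t) \<le> integral {a..t} (speed \<gamma>) - integral {a..s} (speed \<gamma>)"
proof (cases "s = t")
  case False
  then have st: "piecewise_C1_on A \<gamma> s t" using piecewise_C1_on_subset[OF assms(1), of s t] assms by simp
  have at: "piecewise_C1_on A \<gamma> a t" using piecewise_C1_on_subset[OF assms(1), of a t] assms False by simp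
  have "curve_from (\<gamma> s) (\<gamma> t) (integral {s..t} (speed \<gamma>))" unfolding curve_from_def using st by blast
  then show ?thesis using riemannian_dist_le length_split[OF at, of s] assms by fastforce
qed (simp add: rdist_self)

lemma continuous_length:
  assumes "piecewise_C1_on A \<gamma> a b"
  shows "continuous_on {a..b} (\<lambda>t. integral {a..t} (speed \<gamma>))"
  by (rule indefinite_integral_continuous_1[OF speed_integrable[OF assms]])

text \<open>On a curve shorter than \<open>r + s\<close>, the point at length \<open>r\<close> from
  the start will do; it exists because length depends continuously on the parameter.\<close>

lemma rdist_between:
  assumes "0 < r" "0 < s" "rdist p q < r + s"
  shows "\<exists>z. rdist p z \<le> r \<and> rdist z q < s"
proof -
  obtain l where l: "curve_from p q l" "l < r + s"
    using rdist_approx[of "r + s - rdist p q" p q] assms by auto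
  obtain \<gamma> where \<gamma>: "piecewise_C1_on A \<gamma> 0 1" "\<gamma> 0 = p" "\<gamma> 1 = q" "integral {0..1} (speed \<gamma>) = l"
    by (rule curve_from_unit[OF l(1)]) (rule that)
  show ?thesis
  proof (cases "l \<le> r")
    case True
    then have "rdist p q \<le> r" using riemannian_dist_le[OF l(1)] by simp
    then show ?thesis using assms rdist_self by (intro exI[of _ q]) auto
  next
    case False
    then obtain t where t: "0 \<le> t" "t \<le> 1" "integral {0..t} (speed \<gamma>) = r"
      using IVT'[of "\<lambda>t. integral {0..t} (speed \<gamma>)" 0 r 1] continuous_length[OF \<gamma>(1)] assms \<gamma>(4) by auto
    have "rdist p (\<gamma> t) \<le> r" using rdist_along[OF \<gamma>(1), of 0 t] t \<gamma> by simp
    moreover have "rdist (\<gamma> t) q < s" using rdist_along[OF \<gamma>(1), of t 1] t \<gamma> l by simp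
    ultimately show ?thesis by blast
  qed
qed

text \<open>Parametrization proportional to length. Where the curve rests, any parameter with the
  right length is chosen; the estimate sees only the length, so the choice may be arbitrary.\<close>

lemma almost_minimizing:
  assumes "0 < \<epsilon>"
  shows "\<exists>\<sigma>. \<sigma> 0 = p \<and> \<sigma> 1 = q \<and>
      (\<forall>s\<in>{0..1::real}. \<forall>t\<in>{0..1}. rdist (\<sigma> s) (\<sigma> t) \<le> (rdist p q + \<epsilon>) * \<bar>s - t\<bar>)"
proof -
  obtain l where l: "curve_from p q l" "l < rdist p q + \<epsilon>" using rdist_approx[OF assms] by blast
  obtain \<gamma> where \<gamma>: "piecewise_C1_on A \<gamma> 0 1" "\<gamma> 0 = p" "\<gamma> 1 = q" "integral {0..1} (speed \<gamma>) = l"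
    by (rule curve_from_unit[OF l(1)]) (rule that)
  let ?L = "\<lambda>t. integral {0..t} (speed \<gamma>)"
  \<comment> \<open>The ends are prescribed separately, since the length function may be constant
    near them.\<close>
  have "\<exists>t\<in>{0..1}. ?L t = u * l \<and> (u = 0 \<longrightarrow> t = 0) \<and> (u = 1 \<longrightarrow> t = 1)" if u: "u \<in> {0..1}" for u :: real
  proof -
    consider "u = 0" | "u = 1" | "u \<noteq> 0" "u \<noteq> 1" by blast
    then show ?thesis
    proof cases
      case 3
      have l0: "0 \<le> l" by (rule curve_from_nonneg[OF l(1)])
      have "u * l \<le> 1 * l" using u l0 by (intro mult_right_mono) auto
      moreover have "0 \<le> u * l" using u l0 by simp
      ultimately obtain t where "0 \<le> t" "t \<le> 1" "?L t = u * l"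
        using IVT'[of ?L 0 "u * l" 1] continuous_length[OF \<gamma>(1)] \<gamma>(4) by auto
      then show ?thesis using 3 by (intro bexI[of _ t]) auto
    qed (use \<gamma>(4) in auto)
  qed
  then obtain \<tau> where \<tau>: "\<And>u. u \<in> {0..1} \<Longrightarrow> \<tau> u \<in> {0..1} \<and> ?L (\<tau> u) = u * l \<and> (u = 0 \<longrightarrow> \<tau> u = 0) \<and> (u = 1 \<longrightarrow> \<tau> u = 1)"
    by metis
  have "rdist (\<gamma> (\<tau> s)) (\<gamma> (\<tau> t)) \<le> (rdist p q + \<epsilon>) * \<bar>s - t\<bar>" if st: "s \<in> {0..1}" "t \<in> {0..1}" for s t
  proof -
    have "rdist (\<gamma> (\<tau> s)) (\<gamma> (\<tau> t)) \<le> \<bar>?L (\<tau> s) - ?L (\<tau> t)\<bar>"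
    proof (cases "\<tau> s \<le> \<tau> t")
      case True
      then show ?thesis using rdist_along[OF \<gamma>(1), of "\<tau> s" "\<tau> t"] \<tau>[OF st(1)] \<tau>[OF st(2)] by auto
    next
      case False
      then show ?thesis using rdist_along[OF \<gamma>(1), of "\<tau> t" "\<tau> s"] \<tau>[OF st(1)] \<tau>[OF st(2)]
          M.commute[of "\<gamma> (\<tau> s)" "\<gamma> (\<tau> t)"] by auto
    qed
    also have "\<dots> = l * \<bar>s - t\<bar>"
      using \<tau>[OF st(1)] \<tau>[OF st(2)] curve_from_nonneg[OF l(1)] by (simp flip: left_diff_distrib add: abs_mult)
    also have "\<dots> \<le> (rdist p q + \<epsilon>) * \<bar>s - t\<bar>" using l(2) by (intro mult_right_mono) auto
    finally show ?thesis .
  qed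
  then show ?thesis using \<tau>[of 0] \<tau>[of 1] \<gamma> by (intro exI[of _ "\<lambda>u. \<gamma> (\<tau> u)"]) auto
qed

theorem minimizing_curve_between:
  assumes "complete_metric A G"
  obtains \<sigma> where "\<sigma> 0 = p" "\<sigma> 1 = q"
    "\<And>s t. s \<in> {0..1::real} \<Longrightarrow> t \<in> {0..1} \<Longrightarrow> s \<le> t \<Longrightarrow> rdist (\<sigma> s) (\<sigma> t) = rdist p q * (t - s)"
proof -
  have "compactin M.mtopology (M.mcball p (rdist p q + 1))"
  proof (rule M.length_space_proper)
    show "M.mcomplete" using assms by (simp add: complete_metric_def)
    show "\<exists>r>0. compactin M.mtopology (M.mcball x r)" for x
      using locally_compact by (simp add: mtopology_eq)
    show "\<exists>z\<in>UNIV. rdist x z \<le> r \<and> rdist z y < s" if "0 < r" "0 < s" "rdist x y < r + s" for x y r s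
      using rdist_between[OF that] by simp
  qed simp
  then have "compact {z. rdist p z \<le> rdist p q + 1}" by (simp add: mtopology_eq M.mcball_def)
  from minimizing_curve_exists[OF M.Metric_space_axioms continuous_rdist this almost_minimizing]
  show ?thesis using that by blast
qed

end

section \<open>Geodesics in complete manifolds\<close>

context metric_ball
begin

lemma metric_ball_subset: "B' \<subseteq> B \<Longrightarrow> metric_ball B' h h' lam K"
  by (rule metric_ball.intro)
    (use lam_pos K_pos bil sym bil' lin' coercive bound lip bound' lip' taylor in \<open>auto simp: subset_iff\<close>)

lemma h_nonneg: "x \<in> B \<Longrightarrow> 0 \<le> h x u u"
  using coercive[of x u] lam_pos by (meson less_imp_le mult_nonneg_nonneg order_trans zero_le_power2)

lemma Cauchy_Schwarz:
  assumes x: "x \<in> B"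
  shows "h x u v \<le> sqrt (h x u u) * sqrt (h x v v)"
proof (cases "h x v v = 0")
  case True
  then have "v = 0" using coercive[OF x, of v] lam_pos by (simp add: mult_le_0_iff)
  then show ?thesis using bilinear_rzero[OF bil[OF x]] by simp
next
  case False
  then have pos: "0 < h x v v" using h_nonneg[OF x, of v] by simp
  define s where "s = h x u v / h x v v"
  have "0 \<le> h x (u - s *\<^sub>R v) (u - s *\<^sub>R v)" by (rule h_nonneg[OF x])
  also have "\<dots> = h x u u - 2 * s * h x u v + s\<^sup>2 * h x v v"
    using sym[OF x, of v u] x by (simp add: h_simps power2_eq_square algebra_simps)
  also have "\<dots> = h x u u - (h x u v)\<^sup>2 / h x v v" using pos by (simp add: s_def power2_eq_square)
  finally have "(h x u v)\<^sup>2 \<le> h x u u * h x v v" using pos by (simp add: field_simps)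
  then have "h x u v \<le> sqrt (h x u u * h x v v)" by (rule real_le_rsqrt)
  then show ?thesis by (simp add: real_sqrt_mult)
qed

end

context connected_riemannian_manifold
begin

text \<open>The lower bound compares curves from \<open>x\<close> with the metric frozen at \<open>x\<close>, on a ball whose
  radius is a multiple of \<open>norm (y - x)\<close>; longer excursions are longer than the segment.\<close>

lemma chart_distance_approx:
  assumes \<kappa>: "\<kappa> \<in> A" and x0: "x0 \<in> snd \<kappa> ` fst \<kappa>"
  obtains r lam K K2 where "0 < r" "cball x0 r \<subseteq> snd \<kappa> ` fst \<kappa>"
    "metric_ball_dist (cball x0 r) (metric_coeff A G \<kappa>) (metric_coeff_deriv \<kappa>) lam K
       (\<lambda>x y. rdist (param \<kappa> x) (param \<kappa> y)) K2"
proof -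
  obtain r lam K where r: "0 < r" "cball x0 r \<subseteq> snd \<kappa> ` fst \<kappa>" and mb: "chart_ball \<kappa> (cball x0 r) lam K"
    by (rule ex_chart_metric_ball[OF \<kappa> x0]) (rule that)
  interpret metric_ball "cball x0 r" "metric_coeff A G \<kappa>" "metric_coeff_deriv \<kappa>" lam K by (fact mb)
  let ?h = "metric_coeff A G \<kappa>"
  let ?D = "\<lambda>x y. rdist (param \<kappa> x) (param \<kappa> y)"
  define M where "M = 2 * (1 + sqrt (K / lam))"
  have M: "2 \<le> M" using K_pos lam_pos by (simp add: M_def)
  \<comment> \<open>As \<open>norm (y - x) \<le> 2 * r1\<close>, the first bound keeps the auxiliary
    balls inside the large one; the second makes the factor \<open>t\<close> below
    nonnegative.\<close>
  define r1 where "r1 = min (r / (1 + 2 * M)) (lam / (2 * K * M))"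
  have r1: "0 < r1" "r1 * (1 + 2 * M) \<le> r" "2 * K * M * r1 \<le> lam"
  proof -
    show "0 < r1" using r M K_pos lam_pos by (simp add: r1_def)
    have "r1 * (1 + 2 * M) \<le> r / (1 + 2 * M) * (1 + 2 * M)"
      using M by (intro mult_right_mono) (auto simp: r1_def)
    then show "r1 * (1 + 2 * M) \<le> r" using M by simp
    have "2 * K * M * r1 \<le> 2 * K * M * (lam / (2 * K * M))"
      using M K_pos by (intro mult_left_mono) (auto simp: r1_def)
    then show "2 * K * M * r1 \<le> lam" using M K_pos by simp
  qed
  have "r1 \<le> r1 * (1 + 2 * M)" using r1(1) M by simp
  then have r1r: "r1 \<le> r" using r1(2) by linarith
  then have sub: "cball x0 r1 \<subseteq> cball x0 r" by auto
  define K2 where "K2 = K + K\<^sup>2 * M / lam"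
  have K2: "0 \<le> K2" "K \<le> K2" "K\<^sup>2 * M / lam \<le> K2" using K_pos lam_pos M by (auto simp: K2_def)
  have approx: "\<bar>(?D x y)\<^sup>2 - ?h x (y - x) (y - x)\<bar> \<le> K2 * norm (y - x) ^ 3"
    if xy: "x \<in> cball x0 r1" "y \<in> cball x0 r1" for x y
  proof (cases "x = y")
    case True
    have "x \<in> cball x0 r" using xy(1) sub by blast
    then show ?thesis using bilinear_lzero[OF bil] True by (simp add: rdist_self)
  next
    case False
    define v where "v = y - x"
    have nv: "0 < norm v" using False by (simp add: v_def)
    have xB: "x \<in> cball x0 r" and yB: "y \<in> cball x0 r" using xy sub by blast+
    have yV: "y \<in> snd \<kappa> ` fst \<kappa>" using yB r(2) by blast
    have "dist x y \<le> dist x x0 + dist x0 y" by (rule dist_triangle)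
    then have v2: "norm v \<le> 2 * r1" using xy by (simp add: v_def dist_norm norm_minus_commute)
    define q where "q = ?h x v v"
    have q0: "0 \<le> q" unfolding q_def by (rule h_nonneg[OF xB])
    have qK: "q \<le> K * (norm v)\<^sup>2" using bound[OF xB, of v v] by (simp add: q_def power2_eq_square)
    have qpos: "0 < q" using coercive[OF xB, of v] lam_pos nv unfolding q_def
      by (meson less_le_trans mult_pos_pos zero_less_power)
    have D0: "0 \<le> ?D x y" by simp
    have up: "(?D x y)\<^sup>2 \<le> q + K * norm v ^ 3"
    proof -
      have "?h z (y - x) (y - x) \<le> (sqrt (q + K * norm v ^ 3))\<^sup>2"
        if z: "z \<in> cball x0 r" "norm (z - x) \<le> norm (y - x)" for z
      proof -
        have "\<bar>?h z v v - q\<bar> \<le> K * norm (z - x) * norm v * norm v"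
          unfolding q_def by (rule lip[OF xB z(1)])
        also have "\<dots> \<le> K * norm v * norm v * norm v"
          using z(2) K_pos by (intro mult_right_mono mult_left_mono) (auto simp: v_def)
        finally have "?h z v v \<le> q + K * norm v ^ 3" by (simp add: power3_eq_cube mult.assoc)
        then show ?thesis using q0 K_pos by (simp add: v_def)
      qed
      then obtain l where l: "curve_from (param \<kappa> x) (param \<kappa> y) l" "l \<le> sqrt (q + K * norm v ^ 3)"
        by (rule riemannian_dist_segment_le[OF \<kappa> convex_cball r(2) xB yB])
          (assumption, assumption, use q0 K_pos in simp, rule that)
      have "?D x y \<le> sqrt (q + K * norm v ^ 3)" using riemannian_dist_le[OF l(1)] l(2) by simp
      then have "(?D x y)\<^sup>2 \<le> (sqrt (q + K * norm v ^ 3))\<^sup>2" using D0 by (intro power_mono) auto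
      then show ?thesis using q0 K_pos by simp
    qed
    define \<rho> where "\<rho> = M * norm v"
    have \<rho>: "0 < \<rho>" "norm v < \<rho>" using M nv by (auto simp: \<rho>_def)
    have "\<rho> \<le> M * (2 * r1)" unfolding \<rho>_def using v2 M by (intro mult_left_mono) auto
    then have \<rho>r: "r1 + \<rho> \<le> r" using r1(2) by (simp add: algebra_simps)
    have subx: "cball x \<rho> \<subseteq> cball x0 r"
    proof
      fix z assume z: "z \<in> cball x \<rho>"
      have "dist x0 z \<le> dist x0 x + dist x z" by (rule dist_triangle)
      then show "z \<in> cball x0 r" using z xy(1) \<rho>r by simp
    qed
    \<comment> \<open>The Lipschitz bound, measured by coercivity, shows that the metric on the ball
      is at least \<open>t\<close> times the metric frozen at \<open>x\<close>; \<open>1 - t\<close>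
      is of order \<open>norm (y - x)\<close>, which times \<open>q\<close> is the cubic
      error.\<close>
    define t where "t = 1 - K * \<rho> / lam"
    have t: "0 \<le> t" "t \<le> 1"
    proof -
      have "K * \<rho> \<le> K * (M * (2 * r1))" using \<open>\<rho> \<le> M * (2 * r1)\<close> K_pos by simp
      also have "\<dots> \<le> lam" using r1(3) by (simp add: mult_ac)
      finally show "0 \<le> t" using lam_pos by (simp add: t_def)
      show "t \<le> 1" using K_pos lam_pos \<rho> by (simp add: t_def)
    qed
    have frozen: "t * ?h x u u \<le> ?h z u u" if z: "z \<in> cball x \<rho>" for z u
    proof -
      have zB: "z \<in> cball x0 r" using z subx by blast
      have "(norm u)\<^sup>2 \<le> ?h x u u / lam" using coercive[OF xB, of u] lam_pos by (simp add: field_simps)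
      then have "K * \<rho> * (norm u)\<^sup>2 \<le> K * \<rho> * (?h x u u / lam)"
        using K_pos \<rho> by (intro mult_left_mono) auto
      moreover have "K * norm (z - x) * norm u * norm u \<le> K * \<rho> * norm u * norm u"
        using z K_pos by (intro mult_right_mono mult_left_mono) (auto simp: dist_norm norm_minus_commute)
      ultimately have "?h x u u - ?h z u u \<le> K * \<rho> * (?h x u u / lam)"
        using lip[OF xB zB, of u u] abs_le_D2[OF lip[OF xB zB, of u u]]
        by (simp add: power2_eq_square mult.assoc)
      then show ?thesis by (simp add: t_def algebra_simps)
    qed
    define l where "l u = sqrt t / sqrt q * ?h x u v" for u
    have l: "linear l" "\<And>z u. z \<in> cball x \<rho> \<Longrightarrow> l u \<le> sqrt (?h z u u)"
    proof -
      show "linear l" unfolding l_def using xB by (intro linearI) (auto simp: h_simps algebra_simps)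
      fix z u assume z: "z \<in> cball x \<rho>"
      have "l u \<le> sqrt t / sqrt q * (sqrt (?h x u u) * sqrt q)"
        unfolding l_def q_def using Cauchy_Schwarz[OF xB, of u v] t h_nonneg[OF xB]
        by (intro mult_left_mono) auto
      also have "\<dots> = sqrt (t * ?h x u u)" using qpos by (simp add: real_sqrt_mult)
      also have "\<dots> \<le> sqrt (?h z u u)" using frozen[OF z] by simp
      finally show "l u \<le> sqrt (?h z u u)" .
    qed
    have "sqrt lam * \<rho> \<le> ?D x y \<or> l v \<le> ?D x y"
    proof -
      have "cball x \<rho> \<subseteq> snd \<kappa> ` fst \<kappa>" using subx r(2) by blast
      moreover have "sqrt lam * norm u \<le> sqrt (?h z u u)" if "z \<in> cball x \<rho>" for z u
        using sqrt_coercive subx that by blast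
      ultimately show ?thesis
        using rdist_lower[OF \<kappa> _ \<rho>(1), of x "sqrt lam" l "param \<kappa> y"] l lam_pos
          chart_facts(7)[OF \<kappa> yV] unfolding v_def by auto
    qed
    then have low: "q - K\<^sup>2 * M / lam * norm v ^ 3 \<le> (?D x y)\<^sup>2"
    proof
      assume "sqrt lam * \<rho> \<le> ?D x y"
      then have "(sqrt lam * \<rho>)\<^sup>2 \<le> (?D x y)\<^sup>2" using lam_pos \<rho> by (intro power_mono) auto
      moreover have "q \<le> (sqrt lam * \<rho>)\<^sup>2"
      proof -
        have "sqrt (K / lam) \<le> M" using K_pos lam_pos by (simp add: M_def)
        then have "(sqrt (K / lam))\<^sup>2 \<le> M\<^sup>2" using K_pos lam_pos by (intro power_mono) auto
        then have "K \<le> lam * M\<^sup>2" using K_pos lam_pos by (simp add: field_simps)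
        then have "K * (norm v)\<^sup>2 \<le> lam * M\<^sup>2 * (norm v)\<^sup>2" by (intro mult_right_mono) auto
        then show ?thesis using qK lam_pos by (simp add: \<rho>_def power_mult_distrib mult.assoc)
      qed
      moreover have "0 \<le> K\<^sup>2 * M / lam * norm v ^ 3" using M lam_pos by simp
      ultimately show ?thesis by linarith
    next
      assume "l v \<le> ?D x y"
      have "sqrt t / sqrt q * q = sqrt t * (q / sqrt q)" by simp
      then have lv: "l v = sqrt t * sqrt q" using q0 unfolding l_def q_def[symmetric]
        by (simp only: real_div_sqrt)
      then have "(l v)\<^sup>2 = t * q" using t q0 by (simp add: power_mult_distrib)
      moreover have "(l v)\<^sup>2 \<le> (?D x y)\<^sup>2" using \<open>l v \<le> ?D x y\<close> lv t q0 by (intro power_mono) auto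
      moreover have "K * \<rho> / lam * q \<le> K * \<rho> / lam * (K * (norm v)\<^sup>2)"
        using qK K_pos lam_pos \<rho> by (intro mult_left_mono) auto
      moreover have "K * \<rho> / lam * (K * (norm v)\<^sup>2) = K\<^sup>2 * M / lam * norm v ^ 3"
        by (simp add: \<rho>_def power2_eq_square power3_eq_cube)
      moreover have "t * q = q - K * \<rho> / lam * q" by (simp add: t_def algebra_simps)
      ultimately show ?thesis by linarith
    qed
    have "K * norm v ^ 3 \<le> K2 * norm v ^ 3" by (rule mult_right_mono[OF K2(2)]) simp
    moreover have "K\<^sup>2 * M / lam * norm v ^ 3 \<le> K2 * norm v ^ 3" by (rule mult_right_mono[OF K2(3)]) simp
    ultimately show ?thesis using up low unfolding q_def v_def by (simp add: abs_le_iff)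
  qed
  have mb1: "chart_ball \<kappa> (cball x0 r1) lam K" by (rule metric_ball_subset[OF sub])
  have "metric_ball_dist (cball x0 r1) ?h (metric_coeff_deriv \<kappa>) lam K ?D K2"
    by (intro metric_ball_dist.intro mb1 metric_ball_dist_axioms.intro approx K2(1)) (simp_all add: M.triangle)
  then show thesis using that r1(1) sub r(2) by blast
qed

text \<open>The metric at \<open>x\<close> is definite, so a solution of the Koszul formula is the
  only one.\<close>

lemma christoffel_eqI:
  assumes \<kappa>: "\<kappa> \<in> A" and x: "x \<in> snd \<kappa> ` fst \<kappa>"
    and z: "\<And>w. metric_coeff A G \<kappa> x z w =
       (metric_coeff_deriv \<kappa> x u v w + metric_coeff_deriv \<kappa> x v u w - metric_coeff_deriv \<kappa> x w u v) / 2"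
  shows "christoffel A G \<kappa> x u v = z"
  unfolding christoffel_def
proof (rule the_equality)
  show "\<forall>w. metric_coeff A G \<kappa> x z w =
       (metric_coeff_deriv \<kappa> x u v w + metric_coeff_deriv \<kappa> x v u w - metric_coeff_deriv \<kappa> x w u v) / 2"
    using z by blast
  fix z' assume z': "\<forall>w. metric_coeff A G \<kappa> x z' w =
       (metric_coeff_deriv \<kappa> x u v w + metric_coeff_deriv \<kappa> x v u w - metric_coeff_deriv \<kappa> x w u v) / 2"
  have "metric_coeff A G \<kappa> x z' w = metric_coeff A G \<kappa> x z w" for w
    using z z' by metis
  then have "metric_coeff A G \<kappa> x (z' - z) (z' - z) = 0"
    by (simp add: bilinear_lsub[OF metric_coeff_bilinear[OF \<kappa> x]])
  then show "z' = z" using metric_coeff_pos[OF \<kappa> x, of "z' - z"] by fastforce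
qed

text \<open>Being a geodesic is local: around each parameter the curve stays in a chart ball in
  which \<open>geodesic_equation\<close> applies.\<close>

lemma minimizing_curve_is_geodesic:
  assumes min: "\<And>s t. s \<in> {0..1::real} \<Longrightarrow> t \<in> {0..1} \<Longrightarrow> s \<le> t \<Longrightarrow> rdist (\<sigma> s) (\<sigma> t) = l * (t - s)"
    and l: "0 \<le> l"
  shows "geodesic A G {0..1} \<sigma>"
proof -
  have min': "rdist (\<sigma> s) (\<sigma> t) = l * \<bar>t - s\<bar>" if "s \<in> {0..1}" "t \<in> {0..1}" for s t
    using min[of s t] min[of t s] that M.commute[of "\<sigma> s" "\<sigma> t"] by (cases "s \<le> t") auto
  have local: "continuous (at t0 within {0..1}) \<sigma> \<and> (\<forall>\<kappa>\<in>charts_at A (\<sigma> t0).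
      (snd \<kappa> \<circ> \<sigma>) differentiable (at t0 within {0..1}) \<and>
      ((\<lambda>s. vector_derivative (snd \<kappa> \<circ> \<sigma>) (at s within {0..1})) has_vector_derivative
        - christoffel A G \<kappa> ((snd \<kappa> \<circ> \<sigma>) t0) (vector_derivative (snd \<kappa> \<circ> \<sigma>) (at t0 within {0..1}))
           (vector_derivative (snd \<kappa> \<circ> \<sigma>) (at t0 within {0..1}))) (at t0 within {0..1}))"
    if t0: "t0 \<in> {0..1}" for t0
  proof (intro conjI ballI)
    show "continuous (at t0 within {0..1}) \<sigma>"
      unfolding continuous_within
    proof (rule topological_tendstoI)
      fix W assume W: "open W" "\<sigma> t0 \<in> W"
      obtain \<epsilon> where \<epsilon>: "0 < \<epsilon>" "\<And>q. rdist (\<sigma> t0) q < \<epsilon> \<Longrightarrow> q \<in> W"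
        by (rule rdist_small_imp_in_open[OF W]) (rule that)
      have "((\<lambda>t. l * \<bar>t - t0\<bar>) \<longlongrightarrow> l * \<bar>t0 - t0\<bar>) (at t0 within {0..1})" by (intro tendsto_intros)
      then have "\<forall>\<^sub>F t in at t0 within {0..1}. l * \<bar>t - t0\<bar> < \<epsilon>" using \<epsilon>(1) by (intro order_tendstoD(2)) auto
      moreover have "\<forall>\<^sub>F t in at t0 within {0..1}. t \<in> {0..1}" by (simp add: eventually_at_filter)
      ultimately show "\<forall>\<^sub>F t in at t0 within {0..1}. \<sigma> t \<in> W"
        by eventually_elim (use \<epsilon>(2) min' t0 in simp)
    qed
    fix \<kappa> assume "\<kappa> \<in> charts_at A (\<sigma> t0)"
    then have \<kappa>: "\<kappa> \<in> A" and p: "\<sigma> t0 \<in> fst \<kappa>" by (auto simp: charts_at_def)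
    define c where "c = snd \<kappa> \<circ> \<sigma>"
    let ?x0 = "snd \<kappa> (\<sigma> t0)"
    have x0: "?x0 \<in> snd \<kappa> ` fst \<kappa>" using p by blast
    obtain r lam K K2 where r: "0 < r" "cball ?x0 r \<subseteq> snd \<kappa> ` fst \<kappa>"
      and mbd: "metric_ball_dist (cball ?x0 r) (metric_coeff A G \<kappa>) (metric_coeff_deriv \<kappa>) lam K
       (\<lambda>x y. rdist (param \<kappa> x) (param \<kappa> y)) K2"
      by (rule chart_distance_approx[OF \<kappa> x0]) (rule that)
    have mb: "chart_ball \<kappa> (cball ?x0 r) lam K" using mbd by (rule metric_ball_dist.axioms(1))
    have lam: "0 < sqrt lam" using metric_ball.lam_pos[OF mb] by simp
    define \<rho> where "\<rho> = r / 2"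
    have \<rho>: "0 < \<rho>" using r by (simp add: \<rho>_def)
    \<comment> \<open>Within this time the curve cannot leave the coordinate ball of radius \<rho>;
      the divisor \<open>l + 1\<close> covers constant curves, where \<open>l = 0\<close>.\<close>
    define \<delta> where "\<delta> = sqrt lam * \<rho> / (l + 1)"
    have \<delta>: "0 < \<delta>" "l * \<delta> < sqrt lam * \<rho>"
    proof -
      show d: "0 < \<delta>" using lam \<rho> l by (simp add: \<delta>_def)
      have "(l + 1) * \<delta> = sqrt lam * \<rho>" using l by (simp add: \<delta>_def)
      then show "l * \<delta> < sqrt lam * \<rho>" using d by (simp add: algebra_simps)
    qed
    define a where "a = max 0 (t0 - \<delta>)"
    define b where "b = min 1 (t0 + \<delta>)"
    have ab: "a < b" "t0 \<in> {a..b}" "{a..b} \<subseteq> {0..1}" using t0 \<delta> by (auto simp: a_def b_def)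
    have near: "\<sigma> t \<in> fst \<kappa> \<and> dist ?x0 (c t) < \<rho>" if t: "t \<in> {a..b}" for t
    proof -
      have mb\<rho>: "chart_ball \<kappa> (cball ?x0 \<rho>) lam K"
        by (rule metric_ball.metric_ball_subset[OF mb]) (use \<rho> in \<open>auto simp: \<rho>_def\<close>)
      have sub\<rho>: "cball ?x0 \<rho> \<subseteq> snd \<kappa> ` fst \<kappa>" using r \<rho> by (auto simp: \<rho>_def subset_iff)
      have "l * \<bar>t - t0\<bar> \<le> l * \<delta>" using t l by (intro mult_left_mono) (auto simp: a_def b_def)
      then have "rdist (\<sigma> t0) (\<sigma> t) < sqrt lam * \<rho>" using min'[OF t0, of t] t ab \<delta> by auto
      then show ?thesis
        using rdist_lower_norm[OF \<kappa> sub\<rho> \<rho> mb\<rho>, of "\<sigma> t"] chart_facts(6)[OF \<kappa> p] by (auto simp: c_def)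
    qed
    have room: "cball (c t) \<rho> \<subseteq> cball ?x0 r" if "t \<in> {a..b}" for t
    proof
      fix z assume "z \<in> cball (c t) \<rho>"
      then show "z \<in> cball ?x0 r" using near[OF that] dist_triangle[of ?x0 z "c t"] by (auto simp: \<rho>_def)
    qed
    have pc: "param \<kappa> (c t) = \<sigma> t" if "t \<in> {a..b}" for t
      using near[OF that] chart_facts(6)[OF \<kappa>] by (simp add: c_def)
    \<comment> \<open>Either the distance controls the coordinate distance directly, or it is at
      least \<open>sqrt lam * \<rho>\<close> while the two points are at most
      \<open>2 * \<rho>\<close> apart: hence the factor 2.\<close>
    have lips: "norm (c t - c s) \<le> (2 * l / sqrt lam) * \<bar>t - s\<bar>" if st: "s \<in> {a..b}" "t \<in> {a..b}" for s t
    proof -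
      have d: "rdist (\<sigma> s) (\<sigma> t) = l * \<bar>t - s\<bar>" using min' st ab by blast
      have sub: "cball (c s) \<rho> \<subseteq> snd \<kappa> ` fst \<kappa>" using room[OF st(1)] r by blast
      have "norm (c t - c s) \<le> 2 * \<rho>"
        using near[OF st(1)] near[OF st(2)] dist_triangle[of "c t" "c s" ?x0] by (simp add: dist_norm norm_minus_commute)
      then have "sqrt lam * norm (c t - c s) \<le> sqrt lam * (2 * \<rho>)" using lam by simp
      moreover have "sqrt lam * \<rho> \<le> l * \<bar>t - s\<bar> \<or> sqrt lam * norm (c t - c s) \<le> l * \<bar>t - s\<bar>"
        using rdist_lower_norm[OF \<kappa> sub \<rho> metric_ball.metric_ball_subset[OF mb room[OF st(1)]], of "\<sigma> t"]
        unfolding pc[OF st(1)] d by (auto simp: c_def)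
      moreover have "0 \<le> l * \<bar>t - s\<bar>" using l by simp
      ultimately have "sqrt lam * norm (c t - c s) \<le> 2 * (l * \<bar>t - s\<bar>)" by linarith
      then show ?thesis using lam by (simp add: field_simps)
    qed
    interpret mc: minimizing_curve "cball ?x0 r" "metric_coeff A G \<kappa>" "metric_coeff_deriv \<kappa>" lam K
       "\<lambda>x y. rdist (param \<kappa> x) (param \<kappa> y)" K2 c a b "2 * l / sqrt lam" \<rho> l
    proof (intro minimizing_curve.intro mbd minimizing_curve_axioms.intro ab(1) \<rho> room lips)
      show "0 \<le> 2 * l / sqrt lam" using l lam by simp
      show "rdist (param \<kappa> (c s)) (param \<kappa> (c t)) = l * (t - s)"
        if "s \<in> {a..b}" "t \<in> {a..b}" "s \<le> t" for s t
        using min[of s t] that ab pc by auto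
    qed
    obtain vel acc where vel: "\<And>u. u \<in> {a..b} \<Longrightarrow> (c has_vector_derivative vel u) (at u within {a..b})"
      and acc: "\<And>u. u \<in> {a..b} \<Longrightarrow> (vel has_vector_derivative acc u) (at u within {a..b})"
      and eq: "\<And>u e. u \<in> {a..b} \<Longrightarrow> metric_coeff A G \<kappa> (c u) (acc u) e =
         metric_coeff_deriv \<kappa> (c u) e (vel u) (vel u) / 2 - metric_coeff_deriv \<kappa> (c u) (vel u) (vel u) e"
      by (rule mc.geodesic_equation) (rule that)
    \<comment> \<open>Near \<open>t0\<close>, derivatives within \<open>{0..1}\<close> and within
      the short interval agree, also when \<open>t0\<close> is an end of
      \<open>{0..1}\<close>.\<close>
    have within: "at u within {0..1} = at u within {a..b}" if "u \<in> {0..1}" "dist u t0 < \<delta>" for u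
    proof (rule at_within_nhd)
      show "u \<in> {t0 - \<delta><..<t0 + \<delta>}" "open {t0 - \<delta><..<t0 + \<delta>}" using that by (auto simp: dist_real_def)
      show "{0..1} \<inter> {t0 - \<delta><..<t0 + \<delta>} - {u} = {a..b} \<inter> {t0 - \<delta><..<t0 + \<delta>} - {u}"
        by (auto simp: a_def b_def)
    qed
    have in_ab: "u \<in> {a..b}" if "u \<in> {0..1}" "dist u t0 < \<delta>" for u
      using that by (auto simp: dist_real_def a_def b_def)
    have t00: "dist t0 t0 < \<delta>" using \<delta> by simp
    have vd: "vector_derivative c (at u within {0..1}) = vel u" if "u \<in> {0..1}" "dist u t0 < \<delta>" for u
      using vector_derivative_within[OF at_within_Icc_ne_bot[OF zero_less_one that(1)]]
        vel[OF in_ab[OF that]] within[OF that] by simp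
    have ct0: "c t0 \<in> snd \<kappa> ` fst \<kappa>" using x0 by (simp add: c_def)
    \<comment> \<open>For equal arguments the first two terms of the Koszul formula coincide, and
      its right side becomes the negative of that in \<open>eq\<close>.\<close>
    have "christoffel A G \<kappa> (c t0) (vel t0) (vel t0) = - acc t0"
    proof (rule christoffel_eqI[OF \<kappa> ct0])
      fix w
      have "metric_coeff A G \<kappa> (c t0) (- acc t0) w = - metric_coeff A G \<kappa> (c t0) (acc t0) w"
        by (rule bilinear_lneg[OF metric_coeff_bilinear[OF \<kappa> ct0]])
      then show "metric_coeff A G \<kappa> (c t0) (- acc t0) w =
         (metric_coeff_deriv \<kappa> (c t0) (vel t0) (vel t0) w + metric_coeff_deriv \<kappa> (c t0) (vel t0) (vel t0) w -
           metric_coeff_deriv \<kappa> (c t0) w (vel t0) (vel t0)) / 2"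
        unfolding eq[OF ab(2)] by (simp add: field_simps)
    qed
    moreover have "((\<lambda>s. vector_derivative c (at s within {0..1})) has_vector_derivative acc t0) (at t0 within {0..1})"
      by (rule has_vector_derivative_transform_within[OF acc[OF ab(2), folded within[OF t0 t00]] \<delta>(1) t0])
        (simp add: vd)
    ultimately show "((\<lambda>s. vector_derivative (snd \<kappa> \<circ> \<sigma>) (at s within {0..1})) has_vector_derivative
        - christoffel A G \<kappa> ((snd \<kappa> \<circ> \<sigma>) t0) (vector_derivative (snd \<kappa> \<circ> \<sigma>) (at t0 within {0..1}))
           (vector_derivative (snd \<kappa> \<circ> \<sigma>) (at t0 within {0..1}))) (at t0 within {0..1})"
      unfolding c_def[symmetric] vd[OF t0 t00] by simp
    show "(snd \<kappa> \<circ> \<sigma>) differentiable (at t0 within {0..1})"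
      unfolding c_def[symmetric] using vel[OF ab(2), folded within[OF t0 t00]] by (rule differentiableI_vector)
  qed
  have "continuous_on {0..1} \<sigma>" using local by (simp add: continuous_on_eq_continuous_within)
  then show ?thesis unfolding geodesic_def Let_def using local by (auto simp: is_interval_cc)
qed

theorem ex_geodesic:
  assumes "complete_metric A G"
  obtains \<gamma> where "geodesic A G {0..1} \<gamma>" "\<gamma> 0 = p" "\<gamma> 1 = q"
proof -
  obtain \<sigma> where \<sigma>: "\<sigma> 0 = p" "\<sigma> 1 = q"
    "\<And>s t. s \<in> {0..1::real} \<Longrightarrow> t \<in> {0..1} \<Longrightarrow> s \<le> t \<Longrightarrow> rdist (\<sigma> s) (\<sigma> t) = rdist p q * (t - s)"
    by (rule minimizing_curve_between[OF assms]) (rule that)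
  have "geodesic A G {0..1} \<sigma>" by (rule minimizing_curve_is_geodesic[OF \<sigma>(3)]) simp_all
  then show ?thesis using that \<sigma> by blast
qed

end

section \<open>Optimality\<close>

lemma center_simps [simp]:
  "center 0 = 0" "center (S + T) = center S + center T" "center (interval_of r) = r"
  by (simp_all add: center_def add_divide_distrib)

lemma center_scale:
  assumes "0 \<le> r"
  shows "center (interval_of r * T) = r * center T"
proof -
  have "r * lower T \<le> r * upper T" using assms by (intro mult_left_mono) auto
  then show ?thesis by (simp add: center_def lower_times upper_times algebra_simps)
qed

lemma center_cw_interval:
  assumes "0 \<le> w"
  shows "center (cw_interval c w) = c"
proof -
  have "lower (Ivl a b) = a" "upper (Ivl a b) = b" if "a \<le> b" for a b :: real
    using that by (simp_all add: lower.rep_eq upper.rep_eq Ivl.rep_eq)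
  then show ?thesis using assms by (simp add: center_def cw_interval_def)
qed

lemma center_gH_diff: "center (S \<ominus>gH T) = center S - center T"
  by (simp add: gH_diff_def center_cw_interval)

lemma center_interval_dist: "\<bar>center S - center T\<bar> \<le> interval_dist S T"
  unfolding center_def interval_dist_def by (simp add: abs_if max_def field_simps split: if_splits)

lemma interval_eqI_cw: "center S = center T \<Longrightarrow> half_width S = half_width T \<Longrightarrow> S = T"
  unfolding center_def half_width_def by (rule interval_eqI) (simp_all add: field_simps)

text \<open>The center is 1-Lipschitz for the Hausdorff distance and turns the gH-difference into an
  ordinary difference, so it commutes with the limit.\<close>

lemma gH_dir_deriv_center:
  assumes "((\<lambda>s. interval_dist (interval_of (1 / s) * (f (\<gamma> s) \<ominus>gH f p0)) D) \<longlongrightarrow> 0) (at_right 0)"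
  shows "((\<lambda>s. (center (f (\<gamma> s)) - center (f p0)) / s) \<longlongrightarrow> center D) (at_right 0)"
proof -
  have "((\<lambda>s. (center (f (\<gamma> s)) - center (f p0)) / s - center D) \<longlongrightarrow> 0) (at_right 0)"
  proof (rule Lim_null_comparison[OF _ assms])
    have "\<forall>\<^sub>F s in at_right (0::real). 0 < s" by (simp add: eventually_at_right_less)
    then show "\<forall>\<^sub>F s in at_right 0. norm ((center (f (\<gamma> s)) - center (f p0)) / s - center D)
        \<le> interval_dist (interval_of (1 / s) * (f (\<gamma> s) \<ominus>gH f p0)) D"
    proof eventually_elim
      case (elim s)
      then show ?case
        using center_interval_dist[of "interval_of (1 / s) * (f (\<gamma> s) \<ominus>gH f p0)" D]
        by (simp add: center_scale center_gH_diff)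
    qed
  qed
  then show ?thesis by (simp add: LIM_zero_iff)
qed

text \<open>This is what evaluates the \<open>THE\<close> in \<open>gH_dir_deriv\<close>.\<close>

lemma interval_dist_limit_unique:
  assumes "((\<lambda>s. interval_dist (F s) D) \<longlongrightarrow> 0) Z" "((\<lambda>s. interval_dist (F s) D') \<longlongrightarrow> 0) Z" "Z \<noteq> bot"
  shows "D = D'"
proof -
  have "((\<lambda>s. interval_dist (F s) D + interval_dist (F s) D') \<longlongrightarrow> 0 + 0) Z"
    by (intro tendsto_add assms)
  moreover have "interval_dist D D' \<le> interval_dist (F s) D + interval_dist (F s) D'" for s
    unfolding interval_dist_def
    using max.cobounded1[of "\<bar>lower (F s) - lower D\<bar>" "\<bar>upper (F s) - upper D\<bar>"]
      max.cobounded2[of "\<bar>upper (F s) - upper D\<bar>" "\<bar>lower (F s) - lower D\<bar>"]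
      max.cobounded1[of "\<bar>lower (F s) - lower D'\<bar>" "\<bar>upper (F s) - upper D'\<bar>"]
      max.cobounded2[of "\<bar>upper (F s) - upper D'\<bar>" "\<bar>lower (F s) - lower D'\<bar>"]
    by (intro max.boundedI) linarith+
  ultimately have "interval_dist D D' \<le> 0 + 0"
    by (intro tendsto_lowerbound[of _ "0 + 0" Z]) (auto simp: assms)
  then show ?thesis unfolding interval_dist_def by (intro interval_eqI) (auto simp: max_def split: if_splits)
qed

lemma has_dir_deriv_dir_deriv:
  assumes "dir_differentiable_at A G E h p0" "X \<in> tangent_directions A G E p0"
  shows "has_dir_deriv A G E h p0 X (dir_deriv A G E h p0 X)"
proof -
  obtain D where D: "has_dir_deriv A G E h p0 X D" using assms unfolding dir_differentiable_at_def by blast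
  obtain I \<gamma> where \<gamma>: "geodesic_in_direction A G E p0 X I \<gamma>"
    using assms(2) unfolding tangent_directions_def by blast
  have "D' = D" if "has_dir_deriv A G E h p0 X D'" for D'
  proof (rule tendsto_unique)
    show "((\<lambda>s. (h (\<gamma> s) - h p0) / s) \<longlongrightarrow> D') (at_right 0)"
      "((\<lambda>s. (h (\<gamma> s) - h p0) / s) \<longlongrightarrow> D) (at_right 0)"
      using that D \<gamma> unfolding has_dir_deriv_def by blast+
  qed simp
  then have "dir_deriv A G E h p0 X = D" unfolding dir_deriv_def using D by (intro the_equality)
  then show ?thesis using D by simp
qed

lemma has_gH_dir_deriv_gH_dir_deriv:
  assumes "gH_dir_differentiable_at A G E f p0" "X \<in> tangent_directions A G E p0"
  shows "has_gH_dir_deriv A G E f p0 X (gH_dir_deriv A G E f p0 X)"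
proof -
  obtain D where D: "has_gH_dir_deriv A G E f p0 X D" using assms unfolding gH_dir_differentiable_at_def by blast
  obtain I \<gamma> where \<gamma>: "geodesic_in_direction A G E p0 X I \<gamma>"
    using assms(2) unfolding tangent_directions_def by blast
  have "D' = D" if "has_gH_dir_deriv A G E f p0 X D'" for D'
  proof (rule interval_dist_limit_unique)
    show "((\<lambda>s. interval_dist (interval_of (1 / s) * (f (\<gamma> s) \<ominus>gH f p0)) D') \<longlongrightarrow> 0) (at_right 0)"
      "((\<lambda>s. interval_dist (interval_of (1 / s) * (f (\<gamma> s) \<ominus>gH f p0)) D) \<longlongrightarrow> 0) (at_right 0)"
      using that D \<gamma> unfolding has_gH_dir_deriv_def by blast+
  qed simp
  then have "gH_dir_deriv A G E f p0 X = D" unfolding gH_dir_deriv_def using D by (intro the_equality)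
  then show ?thesis using D by simp
qed

text \<open>A function convex at \<open>p0\<close> lies below its chord along the geodesic, so every
  difference quotient at \<open>p0\<close> is at most the total increment.\<close>

lemma convex_difference_quotient_limit:
  assumes "\<And>s. s \<in> {0<..<1::real} \<Longrightarrow> h (\<gamma> s) \<le> (1 - s) * h p0 + s * h p"
    and "((\<lambda>s. (h (\<gamma> s) - h p0) / s) \<longlongrightarrow> D) (at_right 0)"
  shows "D \<le> h p - (h p0 :: real)"
proof (rule tendsto_upperbound[OF assms(2)])
  have "\<forall>\<^sub>F s in at_right (0::real). s \<in> {0<..<1}" by (rule eventually_at_right_real) simp
  then show "\<forall>\<^sub>F s in at_right 0. (h (\<gamma> s) - h p0) / s \<le> h p - h p0"
    by eventually_elim (use assms(1) in \<open>auto simp: field_simps\<close>)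
qed simp

text \<open>Membership in \<open>tangent_directions\<close> asks for compatible coordinates in all
  charts, which the chain rule provides.\<close>

lemma (in smooth_manifold) velocity_in_tangent_space:
  assumes \<gamma>: "geodesic A G {0..1} \<gamma>"
  shows "velocity A \<gamma> {0..1} 0 \<in> tangent_space A (\<gamma> 0)"
proof -
  obtain \<kappa> where \<kappa>: "\<kappa> \<in> charts_at A (\<gamma> 0)" using ex_chart by blast
  have "continuous_on {0..1} \<gamma>" and diff: "(snd \<kappa> \<circ> \<gamma>) differentiable (at 0 within {0..1})"
    using \<gamma> \<kappa> unfolding geodesic_def Let_def by auto
  then have "continuous (at 0 within {0..1}) \<gamma>" by (simp add: continuous_on_eq_continuous_within)
  then have "velocity A \<gamma> {0..1} 0 =
      coord_vector A \<kappa> (\<gamma> 0) (vector_derivative (snd \<kappa> \<circ> \<gamma>) (at 0 within {0..1}))"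
    using diff at_within_Icc_ne_bot[of 0 1 0]
    by (intro velocity_eq_coord_vector \<kappa>) (auto simp: vector_derivative_works)
  then show ?thesis using coord_vector_in_tangent_space[OF \<kappa>] by simp
qed

theorem theorem6p2:
  fixes A :: "('a::{t2_space, second_countable_topology}, 'e::euclidean_space) chart set"
    and G :: "'a \<Rightarrow> ('a, 'e) tangent \<Rightarrow> ('a, 'e) tangent \<Rightarrow> real"
    and E :: "'a set" and p0 :: 'a
    and f :: "'a \<Rightarrow> real interval" and m :: nat and g :: "nat \<Rightarrow> 'a \<Rightarrow> real"
    and \<mu> :: "nat \<Rightarrow> real"
  assumes "riemannian_manifold A G"
    and "connected (UNIV :: 'a set)"
    and "complete_metric A G"
    and "star_shaped_at A G E p0"
    and "p0 \<in> feasible_set E m g"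
    and "cw_convex_at A G E f p0"
    and "\<And>i. i \<in> {1..m} \<Longrightarrow> g i p0 = 0 \<Longrightarrow> convex_at A G E (g i) p0"
    and "\<And>I \<gamma>. geodesic A G I \<gamma> \<Longrightarrow> 0 \<in> I \<Longrightarrow> \<gamma> ` I \<subseteq> E \<Longrightarrow> \<gamma> 0 = p0 \<Longrightarrow>
           mono_on (I \<inter> {0..}) (\<lambda>t. half_width (f (\<gamma> t)))"
    and "gH_dir_differentiable_at A G E f p0"
    and "\<And>i. i \<in> {1..m} \<Longrightarrow> dir_differentiable_at A G E (g i) p0"
    and "\<And>i. i \<in> {1..m} \<Longrightarrow> 0 \<le> \<mu> i"
    and "\<And>X. X \<in> tangent_directions A G E p0 \<Longrightarrow>
           0 \<le>min gH_dir_deriv A G E f p0 X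
                 + interval_of (\<Sum>i=1..m. \<mu> i * dir_deriv A G E (g i) p0 X)"
    and "\<And>i. i \<in> {1..m} \<Longrightarrow> \<mu> i * g i p0 = 0"
  shows "optimal_solution (feasible_set E m g) f p0 \<and>
         (nonconstant_on (feasible_set E m g) f \<longrightarrow>
            strict_optimal_solution (feasible_set E m g) f p0)"
proof -
  interpret riemannian_manifold A G by fact
  interpret connected_riemannian_manifold A G by unfold_locales fact
  \<comment> \<open>This excludes strictly better feasible points, and for \<open>f\<close>
    injective on the feasible set any other point that is as good.\<close>
  have no_better: "f p = f p0" if p: "p \<in> feasible_set E m g" and le: "f p \<le>min f p0" for p
  proof -
    have pE: "p \<in> E" and gp: "\<And>i. i \<in> {1..m} \<Longrightarrow> g i p \<le> 0" using p by (auto simp: feasible_set_def)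
    have p0E: "p0 \<in> E" using assms(5) by (simp add: feasible_set_def)
    obtain \<gamma> where \<gamma>: "geodesic A G {0..1} \<gamma>" "\<gamma> 0 = p0" "\<gamma> 1 = p"
      by (rule ex_geodesic[OF assms(3)]) (rule that)
    have \<gamma>E: "\<gamma> ` {0..1} \<subseteq> E"
    proof
      fix q assume "q \<in> \<gamma> ` {0..1}"
      then obtain s where s: "s \<in> {0..1}" "q = \<gamma> s" by blast
      then consider "s = 0" | "s = 1" | "s \<in> {0<..<1}" by fastforce
      then show "q \<in> E" using s(2) \<gamma> pE p0E assms(4) by cases (auto simp: star_shaped_at_def)
    qed
    define X where "X = velocity A \<gamma> {0..1} 0"
    have dir: "geodesic_in_direction A G E p0 X {0..1} \<gamma>"
      unfolding geodesic_in_direction_def using \<gamma> \<gamma>E by (auto simp: X_def intro!: exI[of _ 1])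
    then have X: "X \<in> tangent_directions A G E p0"
      unfolding tangent_directions_def using velocity_in_tangent_space[OF \<gamma>(1)] \<gamma>(2) X_def by auto
    \<comment> \<open>Monotonicity between the parameters 0 and 1 rules out equal centers with a
      smaller width at \<open>p\<close>.\<close>
    have width: "half_width (f p0) \<le> half_width (f p)"
      using mono_onD[OF assms(8)[OF \<gamma>(1) _ \<gamma>E \<gamma>(2)], of 0 1] \<gamma> by simp
    have "center (gH_dir_deriv A G E f p0 X) \<le> center (f p) - center (f p0)"
    proof (rule convex_difference_quotient_limit[where h = "\<lambda>p. center (f p)"])
      show "center (f (\<gamma> s)) \<le> (1 - s) * center (f p0) + s * center (f p)" if "s \<in> {0<..<1}" for s
        using assms(6) \<gamma> pE that unfolding cw_convex_at_def convex_at_def by auto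
      show "((\<lambda>s. (center (f (\<gamma> s)) - center (f p0)) / s) \<longlongrightarrow> center (gH_dir_deriv A G E f p0 X)) (at_right 0)"
        using has_gH_dir_deriv_gH_dir_deriv[OF assms(9) X] dir unfolding has_gH_dir_deriv_def
        by (blast intro: gH_dir_deriv_center)
    qed
    moreover have "\<mu> i * dir_deriv A G E (g i) p0 X \<le> 0" if i: "i \<in> {1..m}" for i
    proof (cases "g i p0 = 0")
      case True
      have "dir_deriv A G E (g i) p0 X \<le> g i p - g i p0"
      proof (rule convex_difference_quotient_limit)
        show "g i (\<gamma> s) \<le> (1 - s) * g i p0 + s * g i p" if "s \<in> {0<..<1}" for s
          using assms(7)[OF i True] \<gamma> pE that unfolding convex_at_def by blast
        show "((\<lambda>s. (g i (\<gamma> s) - g i p0) / s) \<longlongrightarrow> dir_deriv A G E (g i) p0 X) (at_right 0)"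
          using has_dir_deriv_dir_deriv[OF assms(10)[OF i] X] dir unfolding has_dir_deriv_def by blast
      qed
      then show ?thesis using True gp[OF i] assms(11)[OF i] by (intro mult_nonneg_nonpos) auto
    next
      case False
      \<comment> \<open>An inactive constraint has \<open>\<mu> i = 0\<close> by complementary
        slackness, so the sign of its derivative does not matter.\<close>
      then show ?thesis using assms(13)[OF i] by simp
    qed
    then have "(\<Sum>i=1..m. \<mu> i * dir_deriv A G E (g i) p0 X) \<le> 0" by (rule sum_nonpos)
    moreover have "0 \<le> center (gH_dir_deriv A G E f p0 X) + (\<Sum>i=1..m. \<mu> i * dir_deriv A G E (g i) p0 X)"
      using assms(12)[OF X] by (auto simp: le_min_def)
    ultimately have "center (f p0) \<le> center (f p)" by linarith
    \<comment> \<open>Together with \<open>le\<close> the centers are equal; \<open>le\<close> then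
      compares the half-widths, and \<open>width\<close> is the reverse inequality.\<close>
    then show "f p = f p0" using le width by (intro interval_eqI_cw) (auto simp: le_min_def)
  qed
  then show ?thesis
    using assms(5) unfolding optimal_solution_def strict_optimal_solution_def nonconstant_on_def less_min_def
    by metis
qed

end
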